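(* Let $1<p<\infty$, let $(X,d,\mu)$ be a complete metric space equipped with a positive doubling Borel measure $\mu$ and supporting a weak $(1,p)$-Poincaré inequality, let $\Omega\subset X$ be open and bounded, let $0<T<\infty$, and write $\Omega_T=\Omega\times(0,T)$ and $d\nu=d\mu\,dt$. Let $\alpha>0$ and $K\ge1$. A function $u\in L^p_{\mathrm{loc}}(0,T;N^{1,p}_{\mathrm{loc}}(\Omega))\cap L^2_{\mathrm{loc}}(\Omega_T)$ is a parabolic $K$-quasisuperminimizer (with constant $\alpha$) if and only if for every nonnegative $\phi\in\mathrm{Lip}(\Omega_T)$ such that $\{\phi\ne0\}\Subset\Omega_T$, we have $$\alpha\int_{\{\phi\neq0\}} u\,\frac{\partial\phi}{\partial t}\,d\nu+\int_{\{\phi\ne0\}} g_u^p\,d\nu\le K\int_{\{\phi\ne0\}} g_{u+\phi}^p\,d\nu.$$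
   Context: Doubling: there is $C_\mu\ge1$ with $\mu(B(x,2r))\le C_\mu\,\mu(B(x,r))$ for all $x\in X$, $r>0$; moreover $0<\mu(B(x,r))<\infty$ for all $x\in X$, $r>0$. Upper gradients: a nonnegative Borel function $g:\Omega\to[0,\infty]$ is an upper gradient of $u:\Omega\to[-\infty,\infty]$ if $|u(x)-u(y)|\le\int_\gamma g\,ds$ for all compact rectifiable paths $\gamma$ in $\Omega$ joining $x$ and $y$ (the left side is taken to be $\infty$ if $u(x)=u(y)=\infty$ or $u(x)=u(y)=-\infty$). If the inequality holds for all paths outside a family of zero $p$-modulus, $g$ is a $p$-weak upper gradient. If a measurable $u$ has an upper gradient in $L^p(\Omega)$, then $g_u$ denotes its minimal $p$-weak upper gradient: $g_u$ is a $p$-weak upper gradient and $g_u\le g$ $\mu$-a.e. for every $p$-weak upper gradient $g$ of $u$. Newtonian spaces: for $u\in L^p(\Omega)$, $\|u\|_{1,p,\Omega}=\|u\|_{L^p(\Omega,\mu)}+\|g_u\|_{L^p(\Omega,\mu)}$; $N^{1,p}(\Omega)$ is the space of $u$ with $\|u\|_{1,p,\Omega}<\infty$, modulo $u\sim v$ iff $\|u-v\|_{1,p,\Omega}=0$. The notation $A\Subset B$ means that $\overline{A}$ is a compact subset of $B$. $N^{1,p}_{\mathrm{loc}}(\Omega)$ consists of functions in $N^{1,p}(\Omega')$ for every $\Omega'\Subset\Omega$. Weak $(1,p)$-Poincaré inequality: there are $P_0>0$, $\tau\ge1$ such that for every $u\in N^{1,p}(X)$, $x\in X$, $r>0$, $$\frac1{\mu(B(x,r))}\int_{B(x,r)}|u-u_{B(x,r)}|\,d\mu\le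 P_0\, r\Big(\frac1{\mu(B(x,\tau r))}\int_{B(x,\tau r)}g_u^p\,d\mu\Big)^{1/p},$$ where $u_{B(x,r)}$ is the mean value of $u$ over $B(x,r)$. Parabolic spaces: for $u=u(x,t)$, $g_u(x,t)=g_{u(\cdot,t)}(x)$ (upper gradient in the space variable only). $L^p(t_1,t_2;N^{1,p}(\Omega'))$ is the space of functions $u(x,t)$ with $u(\cdot,t)\in N^{1,p}(\Omega')$ for a.e. $t_1<t<t_2$ and $\int_{t_1}^{t_2}\|u(\cdot,t)\|_{1,p,\Omega'}^p\,dt<\infty$. $u\in L^p_{\mathrm{loc}}(0,T;N^{1,p}_{\mathrm{loc}}(\Omega))$ means $u\in L^p(t_1,t_2;N^{1,p}(\Omega'))$ for all $0<t_1<t_2<T$ and $\Omega'\Subset\Omega$. $\mathrm{Lip}(\Omega_T)$ is the set of Lipschitz continuous functions on $\Omega_T$. Parabolic $K$-quasisuperminimizer (with constant $\alpha>0$): a function $u\in L^p_{\mathrm{loc}}(0,T;N^{1,p}_{\mathrm{loc}}(\Omega))\cap L^2_{\mathrm{loc}}(\Omega_T)$ such that for every open $U\Subset\Omega_T$ and every nonnegative $\phi\in\mathrm{Lip}(\Omega_T)$ with $\{\phi>0\}\subset U$, $$\alpha\int_U u\,\frac{\partial\phi}{\partial t}\,d\nu+\int_U g_u^p\,d\nu\le K\int_U g_{u+\phi}^p\,d\nu.$$ *)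

theory Defs
  imports "HOL-Analysis.Analysis"
begin

definition compactly_contained :: "'a::topological_space set \<Rightarrow> 'a set \<Rightarrow> bool"
    (infix "\<Subset>" 50) where
  "A \<Subset> B \<longleftrightarrow> compact (closure A) \<and> closure A \<subseteq> B"

text \<open>Real powers on \<open>[0,\<infinity>]\<close>; only used with a positive exponent.\<close>

definition epowr :: "ennreal \<Rightarrow> real \<Rightarrow> ennreal" where
  "epowr x a = (if x = \<infinity> then \<infinity> else ennreal (enn2real x powr a))"

definition doubling_measure :: "'a::metric_space measure \<Rightarrow> bool" where
  "doubling_measure \<mu> \<longleftrightarrow> sets \<mu> = sets borel \<and>
     (\<forall>x r. 0 < r \<longrightarrow> 0 < emeasure \<mu> (ball x r) \<and> emeasure \<mu> (ball x r) < \<infinity>) \<and>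
     (\<exists>C\<ge>1. \<forall>x r. 0 < r \<longrightarrow>
        emeasure \<mu> (ball x (2 * r)) \<le> ennreal C * emeasure \<mu> (ball x r))"


section \<open>Rectifiable paths and path integrals\<close>

text \<open>Paths are parametrised over \<open>[0,1]\<close>, as in the library; \<open>length_upto \<gamma> t\<close> is the length
  of the restriction of \<open>\<gamma>\<close> to \<open>[0,t]\<close>.\<close>

definition length_upto :: "(real \<Rightarrow> 'a::metric_space) \<Rightarrow> real \<Rightarrow> ennreal" where
  "length_upto \<gamma> t =
     (SUP ts \<in> {ts. sorted ts \<and> set ts \<subseteq> {0..t}}.
        \<Sum>i<length ts - 1. ennreal (dist (\<gamma> (ts ! i)) (\<gamma> (ts ! Suc i))))"

definition path_length :: "(real \<Rightarrow> 'a::metric_space) \<Rightarrow> ennreal" where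
  "path_length \<gamma> = length_upto \<gamma> 1"

text \<open>As usual in this theory, paths are non-constant. A constant path through a point where
  \<open>u = \<plusminus>\<infinity>\<close> would violate the upper gradient inequality for every \<open>g\<close>, and no family
  containing a constant path has modulus zero.\<close>

definition rectifiable_paths :: "'a::metric_space set \<Rightarrow> (real \<Rightarrow> 'a) set" where
  "rectifiable_paths \<Omega> =
     {\<gamma>. path \<gamma> \<and> path_image \<gamma> \<subseteq> \<Omega> \<and> 0 < path_length \<gamma> \<and> path_length \<gamma> < \<infinity>}"

text \<open>The choice of the parameter \<open>t\<close> is immaterial: \<open>\<gamma>\<close> is constant between any two
  parameters with equal \<open>length_upto\<close>.\<close>

definition arclength_param :: "(real \<Rightarrow> 'a::metric_space) \<Rightarrow> real \<Rightarrow> 'a" where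
  "arclength_param \<gamma> s = \<gamma> (SOME t. t \<in> {0..1} \<and> length_upto \<gamma> t = ennreal s)"

definition line_integral :: "('a::metric_space \<Rightarrow> ennreal) \<Rightarrow> (real \<Rightarrow> 'a) \<Rightarrow> ennreal" where
  "line_integral g \<gamma> =
     (\<integral>\<^sup>+s\<in>{0..enn2real (path_length \<gamma>)}. g (arclength_param \<gamma> s) \<partial>lborel)"

definition modulus ::
    "real \<Rightarrow> 'a::metric_space measure \<Rightarrow> (real \<Rightarrow> 'a) set \<Rightarrow> ennreal" where
  "modulus p \<mu> \<Gamma> =
     (INF \<rho> \<in> {\<rho> \<in> borel_measurable borel. \<forall>\<gamma>\<in>\<Gamma>. 1 \<le> line_integral \<rho> \<gamma>}.
        \<integral>\<^sup>+x. epowr (\<rho> x) p \<partial>\<mu>)"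


section \<open>Upper gradients\<close>

text \<open>In \<^typ>\<open>ereal\<close> one has \<open>\<bar>\<infinity> - \<infinity>\<bar> = \<bar>-\<infinity> - (-\<infinity>)\<bar> = \<infinity>\<close>, which is exactly the convention
  for the left-hand side of the upper gradient inequality.\<close>

definition ug_inequality ::
    "('a::metric_space \<Rightarrow> ereal) \<Rightarrow> ('a \<Rightarrow> ennreal) \<Rightarrow> (real \<Rightarrow> 'a) \<Rightarrow> bool" where
  "ug_inequality u g \<gamma> \<longleftrightarrow>
     \<bar>u (pathstart \<gamma>) - u (pathfinish \<gamma>)\<bar> \<le> enn2ereal (line_integral g \<gamma>)"

definition upper_gradient ::
    "'a::metric_space set \<Rightarrow> ('a \<Rightarrow> ereal) \<Rightarrow> ('a \<Rightarrow> ennreal) \<Rightarrow> bool" where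
  "upper_gradient \<Omega> u g \<longleftrightarrow> g \<in> borel_measurable (restrict_space borel \<Omega>) \<and>
     (\<forall>\<gamma> \<in> rectifiable_paths \<Omega>. ug_inequality u g \<gamma>)"

definition weak_upper_gradient ::
    "real \<Rightarrow> 'a::metric_space measure \<Rightarrow> 'a set \<Rightarrow> ('a \<Rightarrow> ereal) \<Rightarrow> ('a \<Rightarrow> ennreal) \<Rightarrow> bool" where
  "weak_upper_gradient p \<mu> \<Omega> u g \<longleftrightarrow> g \<in> borel_measurable (restrict_space borel \<Omega>) \<and>
     (\<exists>\<Gamma> \<subseteq> rectifiable_paths \<Omega>. modulus p \<mu> \<Gamma> = 0 \<and>
        (\<forall>\<gamma> \<in> rectifiable_paths \<Omega> - \<Gamma>. ug_inequality u g \<gamma>))"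

definition Lp_norm ::
    "real \<Rightarrow> 'a measure \<Rightarrow> 'a set \<Rightarrow> ('a \<Rightarrow> ennreal) \<Rightarrow> ennreal" where
  "Lp_norm p \<mu> \<Omega> f = epowr (\<integral>\<^sup>+x\<in>\<Omega>. epowr (f x) p \<partial>\<mu>) (1 / p)"

text \<open>The competitors \<open>h\<close> have to be in \<open>L\<^sup>p(\<Omega>)\<close>: on the real line, the function that is \<open>0\<close> on a
  fat Cantor set and \<open>\<infinity>\<close> elsewhere is an upper gradient of every function, so that no
  weak upper gradient is minimal among all of them.\<close>

definition minimal_weak_upper_gradient ::
    "real \<Rightarrow> 'a::metric_space measure \<Rightarrow> 'a set \<Rightarrow> ('a \<Rightarrow> ereal) \<Rightarrow> ('a \<Rightarrow> ennreal) \<Rightarrow> bool" where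
  "minimal_weak_upper_gradient p \<mu> \<Omega> u g \<longleftrightarrow>
     weak_upper_gradient p \<mu> \<Omega> u g \<and> Lp_norm p \<mu> \<Omega> g < \<infinity> \<and>
     (\<forall>h. weak_upper_gradient p \<mu> \<Omega> u h \<and> Lp_norm p \<mu> \<Omega> h < \<infinity> \<longrightarrow>
        (AE x in \<mu>. x \<in> \<Omega> \<longrightarrow> g x \<le> h x))"

definition min_grad ::
    "real \<Rightarrow> 'a::metric_space measure \<Rightarrow> 'a set \<Rightarrow> ('a \<Rightarrow> ereal) \<Rightarrow> 'a \<Rightarrow> ennreal" where
  "min_grad p \<mu> \<Omega> u = (SOME g. minimal_weak_upper_gradient p \<mu> \<Omega> u g)"

text \<open>For \<open>u\<close> that is only locally in \<open>N\<^sup>1\<^sup>,\<^sup>p(\<Omega>)\<close>, the minimal weak upper gradient in \<open>\<Omega>\<close> is the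
  function whose restriction to each open \<open>\<Omega>' \<Subset> \<Omega>\<close> is the one of \<open>u\<close> in \<open>\<Omega>'\<close>.\<close>

definition min_grad_loc ::
    "real \<Rightarrow> 'a::metric_space measure \<Rightarrow> 'a set \<Rightarrow> ('a \<Rightarrow> ereal) \<Rightarrow> 'a \<Rightarrow> ennreal" where
  "min_grad_loc p \<mu> \<Omega> u =
     (SOME g. \<forall>\<Omega>'. open \<Omega>' \<and> \<Omega>' \<Subset> \<Omega> \<longrightarrow> minimal_weak_upper_gradient p \<mu> \<Omega>' u g)"


section \<open>Newtonian spaces and the Poincare inequality\<close>

definition newton_norm ::
    "real \<Rightarrow> 'a::metric_space measure \<Rightarrow> 'a set \<Rightarrow> ('a \<Rightarrow> ereal) \<Rightarrow> ennreal" where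
  "newton_norm p \<mu> \<Omega> u =
     (if \<exists>g. upper_gradient \<Omega> u g \<and> Lp_norm p \<mu> \<Omega> g < \<infinity>
      then Lp_norm p \<mu> \<Omega> (\<lambda>x. e2ennreal \<bar>u x\<bar>) + Lp_norm p \<mu> \<Omega> (min_grad p \<mu> \<Omega> u)
      else \<infinity>)"

text \<open>The elements are the everywhere defined representatives, not equivalence classes.
  Measurability of functions (as opposed to upper gradients, which are Borel) refers to the
  completed measure.\<close>

definition newtonian ::
    "real \<Rightarrow> 'a::metric_space measure \<Rightarrow> 'a set \<Rightarrow> ('a \<Rightarrow> ereal) set" where
  "newtonian p \<mu> \<Omega> = {u \<in> borel_measurable (restrict_space (completion \<mu>) \<Omega>).
     newton_norm p \<mu> \<Omega> u < \<infinity>}"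

definition mean_value :: "'a measure \<Rightarrow> 'a set \<Rightarrow> ('a \<Rightarrow> ereal) \<Rightarrow> real" where
  "mean_value \<mu> B u = (LINT x:B|completion \<mu>. real_of_ereal (u x)) / measure \<mu> B"

definition supports_poincare :: "real \<Rightarrow> 'a::metric_space measure \<Rightarrow> bool" where
  "supports_poincare p \<mu> \<longleftrightarrow>
     (\<exists>P\<^sub>0>0. \<exists>\<tau>\<ge>1. \<forall>u \<in> newtonian p \<mu> UNIV. \<forall>x r. 0 < r \<longrightarrow>
        (\<integral>\<^sup>+y\<in>ball x r. e2ennreal \<bar>u y - ereal (mean_value \<mu> (ball x r) u)\<bar> \<partial>completion \<mu>)
            / emeasure \<mu> (ball x r)
        \<le> ennreal (P\<^sub>0 * r) *
           epowr ((\<integral>\<^sup>+y\<in>ball x (\<tau> * r). epowr (min_grad p \<mu> UNIV u y) p \<partial>\<mu>)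
                    / emeasure \<mu> (ball x (\<tau> * r))) (1 / p))"


section \<open>Parabolic spaces\<close>

abbreviation cylinder :: "'a set \<Rightarrow> real \<Rightarrow> ('a \<times> real) set" where
  "cylinder \<Omega> T \<equiv> \<Omega> \<times> {0<..<T}"

abbreviation parabolic_measure :: "'a measure \<Rightarrow> ('a \<times> real) measure" where
  "parabolic_measure \<mu> \<equiv> \<mu> \<Otimes>\<^sub>M lborel"

definition Lp_newtonian ::
    "real \<Rightarrow> 'a::metric_space measure \<Rightarrow> real \<Rightarrow> real \<Rightarrow> 'a set \<Rightarrow> ('a \<times> real \<Rightarrow> ereal) set" where
  "Lp_newtonian p \<mu> t\<^sub>1 t\<^sub>2 \<Omega> =
     {u \<in> borel_measurable (restrict_space (completion (parabolic_measure \<mu>)) (\<Omega> \<times> {t\<^sub>1<..<t\<^sub>2})).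
        (AE t in lborel. t \<in> {t\<^sub>1<..<t\<^sub>2} \<longrightarrow> (\<lambda>x. u (x, t)) \<in> newtonian p \<mu> \<Omega>) \<and>
        (\<integral>\<^sup>+t\<in>{t\<^sub>1<..<t\<^sub>2}. epowr (newton_norm p \<mu> \<Omega> (\<lambda>x. u (x, t))) p \<partial>lborel) < \<infinity>}"

definition Lp_newtonian_loc ::
    "real \<Rightarrow> 'a::metric_space measure \<Rightarrow> 'a set \<Rightarrow> real \<Rightarrow> ('a \<times> real \<Rightarrow> ereal) set" where
  "Lp_newtonian_loc p \<mu> \<Omega> T =
     {u. \<forall>t\<^sub>1 t\<^sub>2 \<Omega>'. 0 < t\<^sub>1 \<and> t\<^sub>1 < t\<^sub>2 \<and> t\<^sub>2 < T \<and> open \<Omega>' \<and> \<Omega>' \<Subset> \<Omega> \<longrightarrow>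
        u \<in> Lp_newtonian p \<mu> t\<^sub>1 t\<^sub>2 \<Omega>'}"

definition L2_loc ::
    "'a::metric_space measure \<Rightarrow> 'a set \<Rightarrow> real \<Rightarrow> ('a \<times> real \<Rightarrow> ereal) set" where
  "L2_loc \<mu> \<Omega> T =
     {u \<in> borel_measurable (restrict_space (completion (parabolic_measure \<mu>)) (cylinder \<Omega> T)).
        \<forall>V. open V \<and> V \<Subset> cylinder \<Omega> T \<longrightarrow>
          (\<integral>\<^sup>+z\<in>V. (e2ennreal \<bar>u z\<bar>)\<^sup>2 \<partial>completion (parabolic_measure \<mu>)) < \<infinity>}"

definition Lip :: "'a::metric_space set \<Rightarrow> ('a \<Rightarrow> real) set" where
  "Lip S = {\<phi>. \<exists>L. L-lipschitz_on S \<phi>}"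

text \<open>For Lipschitz \<open>\<phi>\<close> the derivative exists outside a null set, on which \<^const>\<open>deriv\<close> is a fixed
  constant, so that \<open>time_deriv \<phi>\<close> is measurable.\<close>

definition time_deriv :: "('a \<times> real \<Rightarrow> real) \<Rightarrow> 'a \<times> real \<Rightarrow> real" where
  "time_deriv \<phi> z = deriv (\<lambda>t. \<phi> (fst z, t)) (snd z)"

definition slice_grad ::
    "real \<Rightarrow> 'a::metric_space measure \<Rightarrow> 'a set \<Rightarrow> ('a \<times> real \<Rightarrow> ereal) \<Rightarrow> 'a \<times> real \<Rightarrow> ennreal" where
  "slice_grad p \<mu> \<Omega> u z = min_grad_loc p \<mu> \<Omega> (\<lambda>x. u (x, snd z)) (fst z)"

text \<open>\<open>grad_energy p \<mu> \<Omega> u U\<close> is \<open>\<integral>\<^sub>U g\<^sub>u\<^sup>p d\<nu>\<close>. The functions \<open>g\<^sub>u(\<cdot>,t)\<close> are chosen for each \<open>t\<close>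
  separately and only unique up to a null set, so that an arbitrary choice need not be
  jointly measurable. The integral is therefore taken as the upper integral with respect to
  jointly measurable functions that dominate almost every slice almost everywhere. For every
  jointly measurable version of \<open>g\<^sub>u\<close> it is the ordinary integral
  (see \<open>grad_energy_eq_nn_integral\<close>).\<close>

definition grad_energy ::
    "real \<Rightarrow> 'a::metric_space measure \<Rightarrow> 'a set \<Rightarrow> ('a \<times> real \<Rightarrow> ereal) \<Rightarrow> ('a \<times> real) set
      \<Rightarrow> ennreal" where
  "grad_energy p \<mu> \<Omega> u U =
     (INF h \<in> {h \<in> borel_measurable (parabolic_measure \<mu>).
          AE t in lborel. AE x in \<mu>. (x, t) \<in> U \<longrightarrow> slice_grad p \<mu> \<Omega> u (x, t) \<le> h (x, t)}.
        \<integral>\<^sup>+z\<in>U. epowr (h z) p \<partial>parabolic_measure \<mu>)"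

lemma grad_energy_eq_nn_integral:
  fixes \<mu> :: "'a::metric_space measure"
  assumes p: "0 < p" and fin: "sigma_finite_measure \<mu>"
    and U: "U \<in> sets (parabolic_measure \<mu>)"
    and G: "G \<in> borel_measurable (parabolic_measure \<mu>)"
    and version: "AE t in lborel. AE x in \<mu>. (x, t) \<in> U \<longrightarrow> G (x, t) = slice_grad p \<mu> \<Omega> u (x, t)"
  shows "grad_energy p \<mu> \<Omega> u U = (\<integral>\<^sup>+z\<in>U. epowr (G z) p \<partial>parabolic_measure \<mu>)"
proof -
  interpret \<mu>: sigma_finite_measure \<mu> by (rule fin)
  interpret pair_sigma_finite \<mu> "lborel :: real measure" ..
  have mono: "epowr x p \<le> epowr y p" if "x \<le> y" for x y
    using that p by (auto simp: epowr_def top.extremum_unique enn2real_mono less_top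
        intro!: powr_mono2 ennreal_leI)
  show ?thesis
    unfolding grad_energy_def
  proof (rule antisym)
    show "(INF h \<in> {h \<in> borel_measurable (parabolic_measure \<mu>).
          AE t in lborel. AE x in \<mu>. (x, t) \<in> U \<longrightarrow> slice_grad p \<mu> \<Omega> u (x, t) \<le> h (x, t)}.
        \<integral>\<^sup>+z\<in>U. epowr (h z) p \<partial>parabolic_measure \<mu>)
      \<le> (\<integral>\<^sup>+z\<in>U. epowr (G z) p \<partial>parabolic_measure \<mu>)"
    proof (rule INF_lower)
      show "G \<in> {h \<in> borel_measurable (parabolic_measure \<mu>).
          AE t in lborel. AE x in \<mu>. (x, t) \<in> U \<longrightarrow> slice_grad p \<mu> \<Omega> u (x, t) \<le> h (x, t)}"
        using G version by (auto elim!: eventually_mono)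
    qed
    show "(\<integral>\<^sup>+z\<in>U. epowr (G z) p \<partial>parabolic_measure \<mu>)
      \<le> (INF h \<in> {h \<in> borel_measurable (parabolic_measure \<mu>).
          AE t in lborel. AE x in \<mu>. (x, t) \<in> U \<longrightarrow> slice_grad p \<mu> \<Omega> u (x, t) \<le> h (x, t)}.
        \<integral>\<^sup>+z\<in>U. epowr (h z) p \<partial>parabolic_measure \<mu>)"
    proof (rule INF_greatest)
      fix h
      assume "h \<in> {h \<in> borel_measurable (parabolic_measure \<mu>).
          AE t in lborel. AE x in \<mu>. (x, t) \<in> U \<longrightarrow> slice_grad p \<mu> \<Omega> u (x, t) \<le> h (x, t)}"
      then have h: "h \<in> borel_measurable (parabolic_measure \<mu>)"
        and dom: "AE t in lborel. AE x in \<mu>.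
          (x, t) \<in> U \<longrightarrow> slice_grad p \<mu> \<Omega> u (x, t) \<le> h (x, t)"
        by auto
      have slices: "AE t in lborel. AE x in \<mu>. (x, t) \<in> U \<longrightarrow> G (x, t) \<le> h (x, t)"
        using version dom
      proof eventually_elim
        case (elim t)
        from elim show ?case by eventually_elim auto
      qed
      have meas: "{z \<in> space (parabolic_measure \<mu>). z \<in> U \<longrightarrow> G z \<le> h z} \<in> sets (parabolic_measure \<mu>)"
        using U G h by measurable
      have "AE x in \<mu>. AE t in lborel. (x, t) \<in> U \<longrightarrow> G (x, t) \<le> h (x, t)"
        using slices meas by (subst AE_commute) (simp_all add: split_beta' space_pair_measure)
      then have "AE z in parabolic_measure \<mu>. z \<in> U \<longrightarrow> G z \<le> h z"
        using meas by (intro AE_pair_measure) auto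
      then show "(\<integral>\<^sup>+z\<in>U. epowr (G z) p \<partial>parabolic_measure \<mu>)
          \<le> (\<integral>\<^sup>+z\<in>U. epowr (h z) p \<partial>parabolic_measure \<mu>)"
        by (intro nn_integral_mono_AE) (auto elim!: eventually_mono simp: indicator_def mono)
    qed
  qed
qed


section \<open>Parabolic quasisuperminimizers\<close>

text \<open>The quasiminimizing inequality on \<open>U\<close>, in the extended reals.\<close>

definition quasimin_inequality ::
    "real \<Rightarrow> 'a::metric_space measure \<Rightarrow> 'a set \<Rightarrow> real \<Rightarrow> real
      \<Rightarrow> ('a \<times> real \<Rightarrow> ereal) \<Rightarrow> ('a \<times> real \<Rightarrow> real) \<Rightarrow> ('a \<times> real) set \<Rightarrow> bool" where
  "quasimin_inequality p \<mu> \<Omega> \<alpha> K u \<phi> U \<longleftrightarrow>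
     ereal (\<alpha> * (LINT z:U|completion (parabolic_measure \<mu>). real_of_ereal (u z) * time_deriv \<phi> z))
       + enn2ereal (grad_energy p \<mu> \<Omega> u U)
     \<le> ereal K * enn2ereal (grad_energy p \<mu> \<Omega> (\<lambda>z. u z + ereal (\<phi> z)) U)"

definition quasisuperminimizer ::
    "real \<Rightarrow> 'a::metric_space measure \<Rightarrow> 'a set \<Rightarrow> real \<Rightarrow> real \<Rightarrow> real
      \<Rightarrow> ('a \<times> real \<Rightarrow> ereal) \<Rightarrow> bool" where
  "quasisuperminimizer p \<mu> \<Omega> T \<alpha> K u \<longleftrightarrow>
     u \<in> Lp_newtonian_loc p \<mu> \<Omega> T \<inter> L2_loc \<mu> \<Omega> T \<and>
     (\<forall>U \<phi>. open U \<and> U \<Subset> cylinder \<Omega> T \<and> \<phi> \<in> Lip (cylinder \<Omega> T) \<and>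
        (\<forall>z \<in> cylinder \<Omega> T. 0 \<le> \<phi> z) \<and> {z \<in> cylinder \<Omega> T. 0 < \<phi> z} \<subseteq> U \<longrightarrow>
        quasimin_inequality p \<mu> \<Omega> \<alpha> K u \<phi> U)"

end

theory Submission
  imports Defs
begin

text \<open>The set \<open>S = {\<phi> \<noteq> 0}\<close> is open, so the inequality over \<open>S\<close> is the case \<open>U = S\<close> of the
  definition of a quasisuperminimizer. Conversely, let \<open>U\<close> be an open set that contains \<open>S\<close> and is
  compactly contained in the cylinder. The inequality over \<open>U\<close> follows from the one over \<open>S\<close> because
  two things hold almost everywhere on \<open>U - S\<close>, where \<open>\<phi>\<close> vanishes: the time derivative of \<open>\<phi>\<close> is
  zero, and the minimal weak upper gradient of \<open>u\<close> in space is at most that of \<open>u + \<phi>\<close>. Passing from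
  \<open>S\<close> to \<open>U\<close> therefore leaves the first integral unchanged, adds some energy \<open>R\<close> of \<open>u\<close> on the left,
  and adds at least \<open>K * R \<ge> R\<close> on the right (\<open>quasimin_inequality_enlarge_set\<close>).

  The time derivative. Fix \<open>x\<close>, and let \<open>t\<close> be a zero of \<open>\<phi>(x,\<cdot>)\<close> at which the derivative is not
  zero. As \<open>\<phi>(x,\<cdot>)\<close> is Lipschitz, there are intervals free of zeros arbitrarily close to \<open>t\<close> whose
  length is comparable to their distance from \<open>t\<close>: the zero set is porous at \<open>t\<close>. By a Vitali covering
  argument a measurable set has only a null set of such points (\<open>negligible_porous_points\<close>).

  The gradients. \<open>min_grad_loc\<close> chooses a function that is minimal on all compactly contained open
  subsets, which says nothing unless such a function exists. On almost every time slice, existence has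
  to be shown both for \<open>u\<close> and for \<open>u + \<phi>\<close> before the two can be compared. All statements about weak
  upper gradients are reduced to the real line. A family of paths has modulus zero if and only if some
  \<open>p\<close>-integrable density has infinite integral over all of its paths (\<open>modulus_zero_iff\<close>). Outside such
  a family, \<open>g\<close> being a weak upper gradient of \<open>u\<close> means that the increments of \<open>s \<mapsto> u (\<gamma> s)\<close>, with
  \<open>\<gamma>\<close> parametrised by arc length, are bounded on every subinterval by the measure \<open>g (\<gamma> s) ds\<close>.
  Two such bounds can be glued along any Borel set of parameters, and a bound that is known only for
  pairs of parameters in a closed set may be used on this set (\<open>increment_le_borel_gluing\<close>,
  \<open>increment_le_closed_gluing\<close>).

  Back on the metric space, the first kind of gluing shows that the minimum of two weak upper gradients
  is a weak upper gradient and that competitors on a smaller open set can be used on a larger one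
  (\<open>weak_upper_gradient_glue\<close>). Hence a sequence that minimises the \<open>L\<^sup>p\<close>-norm can be taken to be
  decreasing; its limit is a weak upper gradient by monotone convergence along the remaining paths, and
  it is minimal (\<open>ex_minimal_weak_upper_gradient\<close>). The second kind shows that on the zero set of \<open>\<phi>\<close> a weak
  upper gradient of \<open>u\<close> may be replaced by one of \<open>u + \<phi>\<close> (\<open>weak_upper_gradient_glue_closed\<close>), and
  minimality gives the comparison (\<open>min_grad_loc_le_on_zero_set\<close>).\<close>

section \<open>Powers with real exponent on the extended half-line\<close>

lemma epowr_0 [simp]: "epowr 0 a = 0"
  by (simp add: epowr_def)

lemma epowr_top [simp]: "epowr top a = top"
  by (simp add: epowr_def)

lemma epowr_ennreal: "0 \<le> x \<Longrightarrow> epowr (ennreal x) a = ennreal (x powr a)"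
  by (simp add: epowr_def)

lemma epowr_mono: "0 < a \<Longrightarrow> x \<le> y \<Longrightarrow> epowr x a \<le> epowr y a"
  by (auto simp: epowr_def top.extremum_unique enn2real_mono less_top
        intro!: powr_mono2 ennreal_leI)

lemma epowr_inverse: "0 < a \<Longrightarrow> epowr (epowr x (1 / a)) a = x"
  by (cases x) (auto simp: epowr_ennreal powr_powr)

lemma epowr_inverse': "0 < a \<Longrightarrow> epowr (epowr x a) (1 / a) = x"
  by (cases x) (auto simp: epowr_ennreal powr_powr)

lemma epowr_eq_iff: "0 < a \<Longrightarrow> epowr x a = epowr y a \<longleftrightarrow> x = y"
  by (metis epowr_inverse')

lemma epowr_less_top_iff [simp]: "epowr x a < top \<longleftrightarrow> x < top"
  by (auto simp: epowr_def less_top)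

lemma epowr_mult: "0 \<le> c \<Longrightarrow> 0 < a \<Longrightarrow> epowr (ennreal c * x) a = ennreal (c powr a) * epowr x a"
proof (cases x)
  case (real r)
  assume "0 \<le> c" "0 < a"
  then show ?thesis using real by (simp add: epowr_ennreal powr_mult flip: ennreal_mult)
next
  case top
  assume "0 \<le> c" "0 < a"
  then show ?thesis using top by (cases "c = 0") (auto simp: ennreal_mult_top)
qed

lemma measurable_epowr [measurable]: "(\<lambda>x. epowr x a) \<in> borel_measurable borel"
  unfolding epowr_def by measurable

lemma Lp_norm_less_top_iff:
  "0 < p \<Longrightarrow> Lp_norm p \<mu> \<Omega> f < \<infinity> \<longleftrightarrow> (\<integral>\<^sup>+x\<in>\<Omega>. epowr (f x) p \<partial>\<mu>) < \<infinity>"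
  by (simp add: Lp_norm_def)

text \<open>Serves in place of the triangle inequality in \<open>L\<^sup>p\<close>: the energy of a supremum of densities is
  controlled by the sum of their energies.\<close>

lemma epowr_SUP_le_suminf:
  fixes f :: "nat \<Rightarrow> ennreal"
  assumes a: "0 < a"
  shows "epowr (SUP n. f n) a \<le> (\<Sum>n. epowr (f n) a)"
proof -
  have "f n \<le> epowr (\<Sum>n. epowr (f n) a) (1 / a)" for n
  proof -
    have "epowr (f n) a \<le> (\<Sum>n. epowr (f n) a)"
      using sum_le_suminf[of "\<lambda>n. epowr (f n) a" "{n}"] by auto
    then have "epowr (epowr (f n) a) (1 / a) \<le> epowr (\<Sum>n. epowr (f n) a) (1 / a)"
      using a by (intro epowr_mono) auto
    then show ?thesis using a by (simp add: epowr_inverse')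
  qed
  then have "(SUP n. f n) \<le> epowr (\<Sum>n. epowr (f n) a) (1 / a)" by (intro SUP_least)
  then have "epowr (SUP n. f n) a \<le> epowr (epowr (\<Sum>n. epowr (f n) a) (1 / a)) a"
    using a by (intro epowr_mono)
  then show ?thesis using a by (simp add: epowr_inverse)
qed

lemma ex_small_factor:
  assumes "I < \<infinity>" "0 < e" "0 < a"
  obtains c where "0 < c" "ennreal (c powr a) * I \<le> ennreal e"
proof -
  obtain r where r: "I = ennreal r" "0 \<le> r" using assms(1) by (cases I) auto
  define c where "c = (e / (1 + r)) powr (1 / a)"
  have "0 < c" using assms r by (simp add: c_def)
  moreover have "c powr a = e / (1 + r)" using assms r by (simp add: c_def powr_powr)
  moreover have "e / (1 + r) * r \<le> e" using assms r by (simp add: field_simps)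
  ultimately have "0 < c" "c powr a * r \<le> e" by auto
  then have "ennreal (c powr a) * I \<le> ennreal e"
    using r by (simp flip: ennreal_mult add: ennreal_leI)
  with \<open>0 < c\<close> show thesis by (rule that)
qed

section \<open>Length of paths\<close>

text \<open>The sums in \<^const>\<open>length_upto\<close> in recursive form, so that polygons can be split and refined by
  induction on lists.\<close>

fun polygon_length :: "(real \<Rightarrow> 'a::metric_space) \<Rightarrow> real list \<Rightarrow> real" where
  "polygon_length \<gamma> [] = 0"
| "polygon_length \<gamma> [x] = 0"
| "polygon_length \<gamma> (x # y # zs) = dist (\<gamma> x) (\<gamma> y) + polygon_length \<gamma> (y # zs)"

lemma polygon_length_nonneg [simp]: "0 \<le> polygon_length \<gamma> ts"
  by (induction \<gamma> ts rule: polygon_length.induct) auto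

lemma polygon_length_eq_sum:
  "(\<Sum>i<length ts - 1. ennreal (dist (\<gamma> (ts ! i)) (\<gamma> (ts ! Suc i)))) = ennreal (polygon_length \<gamma> ts)"
proof (induction \<gamma> ts rule: polygon_length.induct)
  case (3 \<gamma> x y zs)
  have "(\<Sum>i<length (x # y # zs) - 1. ennreal (dist (\<gamma> ((x # y # zs) ! i)) (\<gamma> ((x # y # zs) ! Suc i))))
     = ennreal (dist (\<gamma> x) (\<gamma> y)) + ennreal (polygon_length \<gamma> (y # zs))"
    using 3 by (simp add: sum.lessThan_Suc_shift del: sum.lessThan_Suc)
  then show ?case by (simp add: ennreal_plus)
qed auto

lemma polygon_length_append:
  "polygon_length \<gamma> (xs @ d # ys) = polygon_length \<gamma> (xs @ [d]) + polygon_length \<gamma> (d # ys)"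
  by (induction \<gamma> xs rule: polygon_length.induct) auto

lemma polygon_length_Cons_le: "polygon_length \<gamma> ys \<le> polygon_length \<gamma> (d # ys)"
  by (cases ys) auto

lemma polygon_length_append_le:
  "polygon_length \<gamma> xs + polygon_length \<gamma> ys \<le> polygon_length \<gamma> (xs @ ys)"
  by (induction \<gamma> xs rule: polygon_length.induct) (auto intro: order_trans[OF _ polygon_length_Cons_le])

lemma polygon_length_insert_le:
  "polygon_length \<gamma> (xs @ ys) \<le> polygon_length \<gamma> (xs @ d # ys)"
proof (induction \<gamma> xs rule: polygon_length.induct)
  case (2 \<gamma> x)
  show ?case
    by (cases ys) (auto intro: dist_triangle order_trans[OF add_right_mono[OF dist_triangle]])
qed (auto intro: polygon_length_Cons_le)

lemma polygon_length_map: "polygon_length (\<lambda>x. \<gamma> (f x)) ts = polygon_length \<gamma> (map f ts)"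
  by (induction \<gamma> ts rule: polygon_length.induct) auto

definition arc_length :: "(real \<Rightarrow> 'a::metric_space) \<Rightarrow> real \<Rightarrow> real \<Rightarrow> ennreal" where
  "arc_length \<gamma> a b = (SUP ts \<in> {ts. sorted ts \<and> set ts \<subseteq> {a..b}}. ennreal (polygon_length \<gamma> ts))"

lemma length_upto_eq_arc_length: "length_upto \<gamma> t = arc_length \<gamma> 0 t"
  unfolding length_upto_def arc_length_def polygon_length_eq_sum ..

lemma polygon_length_le_arc_length:
  "sorted ts \<Longrightarrow> set ts \<subseteq> {a..b} \<Longrightarrow> ennreal (polygon_length \<gamma> ts) \<le> arc_length \<gamma> a b"
  unfolding arc_length_def by (rule SUP_upper) auto

lemma polygon_length_split:
  assumes "sorted ts" "set ts \<subseteq> {a..b}" "a \<le> c" "c \<le> b"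
  shows "ennreal (polygon_length \<gamma> (filter (\<lambda>x. x \<le> c) ts @ [c])) \<le> arc_length \<gamma> a c"
    and "ennreal (polygon_length \<gamma> (c # filter (\<lambda>x. \<not> x \<le> c) ts)) \<le> arc_length \<gamma> c b"
    and "filter (\<lambda>x. x \<le> c) ts @ filter (\<lambda>x. \<not> x \<le> c) ts = ts"
proof -
  show "ennreal (polygon_length \<gamma> (filter (\<lambda>x. x \<le> c) ts @ [c])) \<le> arc_length \<gamma> a c"
    using assms by (intro polygon_length_le_arc_length) (auto simp: sorted_append sorted_wrt_filter)
  show "ennreal (polygon_length \<gamma> (c # filter (\<lambda>x. \<not> x \<le> c) ts)) \<le> arc_length \<gamma> c b"
    using assms by (intro polygon_length_le_arc_length) (auto simp: sorted_wrt_filter)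
  show "filter (\<lambda>x. x \<le> c) ts @ filter (\<lambda>x. \<not> x \<le> c) ts = ts"
    using assms(1)
  proof (induction ts)
    case (Cons x ts)
    show ?case
    proof (cases "x \<le> c")
      case False
      with Cons.prems have "filter (\<lambda>x. x \<le> c) ts = []" "filter (\<lambda>x. \<not> x \<le> c) ts = ts"
        by (auto simp: filter_empty_conv filter_id_conv)
      with False show ?thesis by simp
    qed (use Cons in auto)
  qed simp
qed

lemma arc_length_add:
  assumes "a \<le> c" "c \<le> b"
  shows "arc_length \<gamma> a c + arc_length \<gamma> c b = arc_length \<gamma> a b"
proof (rule antisym)
  have ne: "{ts. sorted ts \<and> set ts \<subseteq> {x..y}} \<noteq> {}" for x y :: real
    by (auto intro!: exI[of _ "[]"])
  have "ennreal (polygon_length \<gamma> xs) + ennreal (polygon_length \<gamma> ys) \<le> arc_length \<gamma> a b"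
    if "sorted xs" "set xs \<subseteq> {a..c}" "sorted ys" "set ys \<subseteq> {c..b}" for xs ys
  proof -
    have "sorted (xs @ ys)" "set (xs @ ys) \<subseteq> {a..b}"
      using that assms by (force simp: sorted_append)+
    then have "ennreal (polygon_length \<gamma> (xs @ ys)) \<le> arc_length \<gamma> a b"
      by (rule polygon_length_le_arc_length)
    then show ?thesis
      using ennreal_leI[OF polygon_length_append_le[of \<gamma> xs ys]] by (simp add: ennreal_plus)
  qed
  then show "arc_length \<gamma> a c + arc_length \<gamma> c b \<le> arc_length \<gamma> a b"
    unfolding arc_length_def[of _ a c] arc_length_def[of _ c b]
    unfolding ennreal_SUP_add_left[OF ne, symmetric] ennreal_SUP_add_right[OF ne]
    by (intro SUP_least) auto
next
  show "arc_length \<gamma> a b \<le> arc_length \<gamma> a c + arc_length \<gamma> c b"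
    unfolding arc_length_def[of _ a b]
  proof (rule SUP_least, clarsimp)
    fix ts :: "real list" assume ts: "sorted ts" "set ts \<subseteq> {a..b}"
    note split = polygon_length_split[OF ts assms]
    have "polygon_length \<gamma> ts \<le> polygon_length \<gamma> (filter (\<lambda>x. x \<le> c) ts @ [c])
        + polygon_length \<gamma> (c # filter (\<lambda>x. \<not> x \<le> c) ts)"
      using polygon_length_insert_le[of \<gamma> "filter (\<lambda>x. x \<le> c) ts" "filter (\<lambda>x. \<not> x \<le> c) ts" c]
      unfolding split(3) polygon_length_append[of _ _ c "filter _ _"] .
    then have "ennreal (polygon_length \<gamma> ts) \<le> ennreal (polygon_length \<gamma> (filter (\<lambda>x. x \<le> c) ts @ [c]))
        + ennreal (polygon_length \<gamma> (c # filter (\<lambda>x. \<not> x \<le> c) ts))"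
      by (simp flip: ennreal_plus add: ennreal_leI)
    also have "\<dots> \<le> arc_length \<gamma> a c + arc_length \<gamma> c b"
      using split(1,2) by (rule add_mono)
    finally show "ennreal (polygon_length \<gamma> ts) \<le> arc_length \<gamma> a c + arc_length \<gamma> c b" .
  qed
qed

lemma arc_length_mono: "a \<le> c \<Longrightarrow> c \<le> b \<Longrightarrow> arc_length \<gamma> a c \<le> arc_length \<gamma> a b"
  using arc_length_add[of a c b \<gamma>] by (metis le_iff_add)

lemma dist_le_arc_length: "a \<le> b \<Longrightarrow> ennreal (dist (\<gamma> a) (\<gamma> b)) \<le> arc_length \<gamma> a b"
  using polygon_length_le_arc_length[of "[a, b]" a b \<gamma>] by auto

lemma arc_length_same [simp]: "arc_length \<gamma> a a = 0"
proof -
  have "polygon_length \<gamma> ts = 0" if "set ts \<subseteq> {a}" for ts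
    using that by (induction \<gamma> ts rule: polygon_length.induct) auto
  then show ?thesis unfolding arc_length_def by (auto simp: SUP_eq_const bot_ennreal intro!: antisym SUP_least)
qed

lemma arc_length_affine:
  assumes "c < d" "a \<le> b"
  shows "arc_length (\<lambda>x. \<gamma> ((d - c) * x + c)) a b = arc_length \<gamma> ((d - c) * a + c) ((d - c) * b + c)"
proof -
  have *: "{ts. sorted ts \<and> set ts \<subseteq> {(d - c) * a + c..(d - c) * b + c}}
      = map (\<lambda>x. (d - c) * x + c) ` {ts. sorted ts \<and> set ts \<subseteq> {a..b}}" (is "?L = ?R")
  proof (intro set_eqI iffI)
    fix ts assume "ts \<in> ?R"
    then obtain us where us: "ts = map (\<lambda>x. (d - c) * x + c) us" "sorted us" "set us \<subseteq> {a..b}"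
      by blast
    have "sorted ts" unfolding us(1) sorted_map
      by (rule sorted_wrt_mono_rel[OF _ us(2)]) (use assms(1) in \<open>auto intro: mult_left_mono\<close>)
    moreover have "set ts \<subseteq> {(d - c) * a + c..(d - c) * b + c}"
      using us(1,3) assms(1) by (fastforce intro: mult_left_mono)
    ultimately show "ts \<in> ?L" by simp
  next
    fix ts assume ts: "ts \<in> ?L"
    let ?us = "map (\<lambda>y. (y - c) / (d - c)) ts"
    have "ts = map (\<lambda>x. (d - c) * x + c) ?us" using assms(1) by (simp add: comp_def)
    moreover have "sorted ?us" unfolding sorted_map
      by (rule sorted_wrt_mono_rel[of _ "(\<le>)"]) (use ts assms(1) in \<open>auto simp: divide_right_mono\<close>)
    moreover have "set ?us \<subseteq> {a..b}" using ts assms(1) by (auto simp: field_simps subset_eq)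
    ultimately show "ts \<in> ?R" by blast
  qed
  show ?thesis unfolding arc_length_def * polygon_length_map[where f = "\<lambda>x. (d - c) * x + c"] by (simp only: image_image)
qed

lemma arc_length_less_top:
  assumes "arc_length \<gamma> a b < \<infinity>" "a \<le> s" "s \<le> t" "t \<le> b"
  shows "arc_length \<gamma> s t < \<infinity>"
  using assms arc_length_add[of a s b \<gamma>] arc_length_add[of s t b \<gamma>]
  by (metis ennreal_add_eq_top infinity_ennreal_def less_top order_trans)

text \<open>If a polygon with vertices at the parameters \<open>F\<close> falls short of the full length by less than \<open>e\<close>,
  then on an interval without such parameters arc and chord differ by less than \<open>e\<close>: inserting the end
  points of the interval does not shorten the polygon.\<close>

lemma arc_length_almost_chord:
  assumes fin: "arc_length \<gamma> a b < \<infinity>" and e: "0 < e"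
  obtains F where "finite F"
    "\<And>s t. a \<le> s \<Longrightarrow> s \<le> t \<Longrightarrow> t \<le> b \<Longrightarrow> F \<inter> {s<..<t} = {} \<Longrightarrow>
       arc_length \<gamma> s t \<le> ennreal (dist (\<gamma> s) (\<gamma> t) + e)"
proof -
  have ne: "{ts. sorted ts \<and> set ts \<subseteq> {a..b}} \<noteq> {}" by (auto intro!: exI[of _ "[]"])
  have "arc_length \<gamma> a b \<noteq> \<infinity>" using fin by simp
  from SUP_approx_ennreal[OF _ ne arc_length_def this, of e] e
  obtain ts where ts: "sorted ts" "set ts \<subseteq> {a..b}"
    and less: "arc_length \<gamma> a b < ennreal (polygon_length \<gamma> ts) + ennreal e"
    by auto
  show ?thesis
  proof (rule that[of "set ts"])
    fix s t assume st: "a \<le> s" "s \<le> t" "t \<le> b" and gap: "set ts \<inter> {s<..<t} = {}"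
    define xs where "xs = filter (\<lambda>x. x \<le> s) ts"
    define ys where "ys = filter (\<lambda>x. \<not> x \<le> s) ts"
    have tsplit: "xs @ ys = ts" and 1: "ennreal (polygon_length \<gamma> (xs @ [s])) \<le> arc_length \<gamma> a s"
      using polygon_length_split[OF ts, of s] st unfolding xs_def ys_def by auto
    have "sorted (t # ys)" "set (t # ys) \<subseteq> {t..b}"
      using ts gap st by (force simp: ys_def sorted_wrt_filter)+
    then have 2: "ennreal (polygon_length \<gamma> (t # ys)) \<le> arc_length \<gamma> t b"
      by (rule polygon_length_le_arc_length)
    have "polygon_length \<gamma> ts \<le> polygon_length \<gamma> (xs @ s # ys)"
      using polygon_length_insert_le[of \<gamma> xs ys s] tsplit by simp
    also have "\<dots> \<le> polygon_length \<gamma> ((xs @ [s]) @ t # ys)"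
      using polygon_length_insert_le[of \<gamma> "xs @ [s]" ys t] by simp
    also have "\<dots> = polygon_length \<gamma> (xs @ s # [t]) + polygon_length \<gamma> (t # ys)"
      using polygon_length_append[of \<gamma> "xs @ [s]" t ys] by simp
    also have "\<dots> = polygon_length \<gamma> (xs @ [s]) + dist (\<gamma> s) (\<gamma> t) + polygon_length \<gamma> (t # ys)"
      using polygon_length_append[of \<gamma> xs s "[t]"] by simp
    finally have "ennreal (polygon_length \<gamma> ts) + ennreal e \<le> ennreal (polygon_length \<gamma> (xs @ [s]))
        + ennreal (dist (\<gamma> s) (\<gamma> t)) + ennreal (polygon_length \<gamma> (t # ys)) + ennreal e"
      using e by (simp flip: ennreal_plus add: ennreal_leI)
    also have "\<dots> \<le> arc_length \<gamma> a s + ennreal (dist (\<gamma> s) (\<gamma> t)) + arc_length \<gamma> t b + ennreal e"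
      using 1 2 by (intro add_mono) auto
    finally have "arc_length \<gamma> a b
        < arc_length \<gamma> a s + ennreal (dist (\<gamma> s) (\<gamma> t)) + arc_length \<gamma> t b + ennreal e"
      by (rule less_le_trans[OF less])
    moreover have "arc_length \<gamma> a b = arc_length \<gamma> a s + arc_length \<gamma> s t + arc_length \<gamma> t b"
      using st arc_length_add[of a s b \<gamma>] arc_length_add[of s t b \<gamma>] by (simp add: add.assoc)
    moreover have "arc_length \<gamma> a s < \<infinity>" "arc_length \<gamma> t b < \<infinity>"
      using arc_length_less_top[OF fin] st by auto
    ultimately show "arc_length \<gamma> s t \<le> ennreal (dist (\<gamma> s) (\<gamma> t) + e)"
      using e by (cases "arc_length \<gamma> a s"; cases "arc_length \<gamma> t b"; cases "arc_length \<gamma> s t")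
        (auto simp flip: ennreal_plus simp: ennreal_less_iff ennreal_le_iff top_unique intro!: ennreal_leI)
  qed auto
qed

text \<open>Close to \<open>t0\<close> the only vertex of the polygon is possibly \<open>t0\<close> itself, so short arcs that begin or
  end at \<open>t0\<close> are almost as short as their chords, and these are small as \<open>\<gamma>\<close> is continuous.\<close>

lemma continuous_on_arc_length:
  assumes cont: "continuous_on {a..b} \<gamma>" and fin: "arc_length \<gamma> a b < \<infinity>"
  shows "continuous_on {a..b} (\<lambda>t. enn2real (arc_length \<gamma> a t))"
  unfolding continuous_on_iff
proof (intro ballI allI impI)
  fix t0 e :: real assume t0: "t0 \<in> {a..b}" and e: "0 < e"
  obtain F where F: "finite F" "\<And>s t. a \<le> s \<Longrightarrow> s \<le> t \<Longrightarrow> t \<le> b \<Longrightarrow> F \<inter> {s<..<t} = {} \<Longrightarrow>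
       arc_length \<gamma> s t \<le> ennreal (dist (\<gamma> s) (\<gamma> t) + e / 2)"
    using arc_length_almost_chord[OF fin, of "e / 2"] e by auto
  obtain d1 where d1: "d1 > 0" "\<forall>t \<in> {a..b}. dist t t0 < d1 \<longrightarrow> dist (\<gamma> t) (\<gamma> t0) < e / 2"
    using cont t0 e unfolding continuous_on_iff by (meson half_gt_zero)
  obtain d2 where d2: "d2 > 0" "\<And>x. x \<in> F \<Longrightarrow> x \<noteq> t0 \<Longrightarrow> d2 \<le> dist t0 x"
    using finite_set_avoid[OF F(1), of t0] by auto
  have key: "\<bar>enn2real (arc_length \<gamma> a t) - enn2real (arc_length \<gamma> a s)\<bar> < e"
    if st: "a \<le> s" "s \<le> t" "t \<le> b" and gap: "F \<inter> {s<..<t} = {}" and dst: "dist (\<gamma> s) (\<gamma> t) < e / 2" for s t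
  proof -
    have "arc_length \<gamma> a s + arc_length \<gamma> s t = arc_length \<gamma> a t"
      using st by (intro arc_length_add) auto
    moreover have "arc_length \<gamma> a t < \<infinity>" using arc_length_mono[of a t b \<gamma>] st fin by (auto simp: less_top top_unique)
    moreover have "arc_length \<gamma> s t \<le> ennreal (dist (\<gamma> s) (\<gamma> t) + e / 2)" using F(2)[OF st gap] .
    ultimately show ?thesis using dst e
      by (cases "arc_length \<gamma> a s"; cases "arc_length \<gamma> s t"; cases "arc_length \<gamma> a t")
        (auto simp flip: ennreal_plus simp: add_nonneg_pos)
  qed
  show "\<exists>d>0. \<forall>t\<in>{a..b}. dist t t0 < d \<longrightarrow>
      dist (enn2real (arc_length \<gamma> a t)) (enn2real (arc_length \<gamma> a t0)) < e"
  proof (intro exI[of _ "min d1 d2"] conjI ballI impI)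
    fix t assume t: "t \<in> {a..b}" "dist t t0 < min d1 d2"
    have "F \<inter> {min t t0<..<max t t0} = {}"
      using d2(2) t by (fastforce simp: dist_real_def)
    then show "dist (enn2real (arc_length \<gamma> a t)) (enn2real (arc_length \<gamma> a t0)) < e"
      using key[of t t0] key[of t0 t] t t0 d1(2)[rule_format, of t]
      by (cases "t \<le> t0") (auto simp: dist_real_def[of "enn2real _"] dist_commute abs_minus_commute)
  qed (use d1 d2 in auto)
qed

section \<open>Arc length parametrisation\<close>

lemma rectifiable_pathD:
  assumes "\<gamma> \<in> rectifiable_paths \<Omega>"
  shows "continuous_on {0..1} \<gamma>" "arc_length \<gamma> 0 1 < \<infinity>" "0 < arc_length \<gamma> 0 1"
    "\<gamma> ` {0..1} \<subseteq> \<Omega>"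
  using assms by (auto simp: rectifiable_paths_def path_def path_image_def path_length_def
      length_upto_eq_arc_length)

definition total_length :: "(real \<Rightarrow> 'a::metric_space) \<Rightarrow> real" where
  "total_length \<gamma> = enn2real (path_length \<gamma>)"

lemma total_length_pos: "\<gamma> \<in> rectifiable_paths \<Omega> \<Longrightarrow> 0 < total_length \<gamma>"
  by (auto simp: total_length_def rectifiable_paths_def enn2real_positive_iff)

lemma line_integral_eq:
  "line_integral g \<gamma> = (\<integral>\<^sup>+s\<in>{0..total_length \<gamma>}. g (arclength_param \<gamma> s) \<partial>lborel)"
  by (simp add: line_integral_def total_length_def)

context
  fixes \<gamma> :: "real \<Rightarrow> 'a::metric_space" and \<Omega>
  assumes \<gamma>: "\<gamma> \<in> rectifiable_paths \<Omega>"
begin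

lemma arclength_param_eq:
  assumes t: "t \<in> {0..1}" and s: "arc_length \<gamma> 0 t = ennreal s"
  shows "arclength_param \<gamma> s = \<gamma> t"
proof -
  define t' where "t' = (SOME t. t \<in> {0..1} \<and> length_upto \<gamma> t = ennreal s)"
  have "t' \<in> {0..1} \<and> length_upto \<gamma> t' = ennreal s"
    unfolding t'_def length_upto_eq_arc_length by (rule someI[of _ t]) (use t s in blast)
  then have t': "t' \<in> {0..1}" "arc_length \<gamma> 0 t' = ennreal s"
    by (auto simp: length_upto_eq_arc_length)
  have eq: "\<gamma> x = \<gamma> y"
    if "x \<in> {0..1}" "y \<in> {0..1}" "x \<le> y" "arc_length \<gamma> 0 x = ennreal s" "arc_length \<gamma> 0 y = ennreal s" for x y
  proof -
    have "arc_length \<gamma> 0 x + arc_length \<gamma> x y = arc_length \<gamma> 0 y"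
      using that by (intro arc_length_add) auto
    then have "ennreal s + arc_length \<gamma> x y = ennreal s + 0" using that by simp
    then have "arc_length \<gamma> x y = 0"
      by (subst (asm) ennreal_add_left_cancel) auto
    then show ?thesis using dist_le_arc_length[of x y \<gamma>] that by simp
  qed
  have "\<gamma> t' = \<gamma> t"
    using eq[OF t t'(1) _ s t'(2)] eq[OF t'(1) t _ t'(2) s] by (metis linear)
  then show ?thesis by (simp add: arclength_param_def t'_def)
qed

text \<open>Arc length is continuous and hence takes all intermediate values; thus the choice in
  \<^const>\<open>arclength_param\<close> is always among actual parameters.\<close>

lemma ex_arc_length_eq:
  assumes "s \<in> {0..total_length \<gamma>}"
  obtains t where "t \<in> {0..1}" "arc_length \<gamma> 0 t = ennreal s" "arclength_param \<gamma> s = \<gamma> t"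
proof -
  note D = rectifiable_pathD[OF \<gamma>]
  have "\<exists>t\<ge>0. t \<le> 1 \<and> enn2real (arc_length \<gamma> 0 t) = s"
    using assms
    by (intro IVT' continuous_on_arc_length D(1,2))
      (auto simp: total_length_def path_length_def length_upto_eq_arc_length)
  then obtain t where t: "t \<in> {0..1}" "enn2real (arc_length \<gamma> 0 t) = s" by auto
  have "arc_length \<gamma> 0 t < \<infinity>" by (rule arc_length_less_top[OF D(2)]) (use t in auto)
  then have "arc_length \<gamma> 0 t = ennreal s" using t(2) by auto
  from that[OF t(1) this arclength_param_eq[OF t(1) this]] show thesis .
qed

lemma total_length_eq: "arc_length \<gamma> 0 1 = ennreal (total_length \<gamma>)"
  using rectifiable_pathD[OF \<gamma>]
  by (simp add: total_length_def path_length_def length_upto_eq_arc_length)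

lemma arclength_param_0: "arclength_param \<gamma> 0 = pathstart \<gamma>"
  by (subst arclength_param_eq[of 0]) (auto simp: pathstart_def)

lemma arclength_param_total: "arclength_param \<gamma> (total_length \<gamma>) = pathfinish \<gamma>"
  by (subst arclength_param_eq[of 1]) (auto simp: pathfinish_def total_length_eq)

lemma arclength_param_in: "s \<in> {0..total_length \<gamma>} \<Longrightarrow> arclength_param \<gamma> s \<in> \<Omega>"
  using rectifiable_pathD(4)[OF \<gamma>] by (elim ex_arc_length_eq) auto

lemma arclength_param_parameters:
  assumes ab: "0 \<le> a" "a < b" "b \<le> total_length \<gamma>"
  obtains c d where "0 \<le> c" "c < d" "d \<le> 1" "arc_length \<gamma> 0 c = ennreal a"
    "arc_length \<gamma> 0 d = ennreal b" "arc_length \<gamma> c d = ennreal (b - a)"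
    "arclength_param \<gamma> a = \<gamma> c" "arclength_param \<gamma> b = \<gamma> d"
proof -
  obtain c where c: "c \<in> {0..1}" "arc_length \<gamma> 0 c = ennreal a" "arclength_param \<gamma> a = \<gamma> c"
    using ab by (elim ex_arc_length_eq[rotated]) auto
  obtain d where d: "d \<in> {0..1}" "arc_length \<gamma> 0 d = ennreal b" "arclength_param \<gamma> b = \<gamma> d"
    using ab by (elim ex_arc_length_eq[rotated]) auto
  have "c < d"
  proof (rule ccontr)
    assume "\<not> c < d"
    then have "arc_length \<gamma> 0 d \<le> arc_length \<gamma> 0 c" using d c by (intro arc_length_mono) auto
    then show False using c d ab by (simp add: ennreal_le_iff)
  qed
  moreover have "arc_length \<gamma> c d = ennreal (b - a)"
  proof -
    have "ennreal a + arc_length \<gamma> c d = ennreal b"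
      using arc_length_add[of 0 c d \<gamma>] c d \<open>c < d\<close> by simp
    also have "\<dots> = ennreal a + ennreal (b - a)" using ab by (simp flip: ennreal_plus)
    finally show ?thesis by (subst (asm) ennreal_add_left_cancel) auto
  qed
  ultimately show thesis using c d by (intro that[of c d]) auto
qed

lemma arclength_param_lipschitz: "1-lipschitz_on {0..total_length \<gamma>} (arclength_param \<gamma>)"
proof (rule lipschitz_onI)
  have *: "dist (arclength_param \<gamma> a) (arclength_param \<gamma> b) \<le> b - a"
    if ab: "0 \<le> a" "a < b" "b \<le> total_length \<gamma>" for a b
  proof -
    obtain c d where cd: "0 \<le> c" "c < d" "d \<le> 1" "arc_length \<gamma> c d = ennreal (b - a)"
      "arclength_param \<gamma> a = \<gamma> c" "arclength_param \<gamma> b = \<gamma> d"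
      using arclength_param_parameters[OF ab] by metis
    then show ?thesis using dist_le_arc_length[of c d \<gamma>] ab by (simp add: ennreal_le_iff)
  qed
  fix x y assume "x \<in> {0..total_length \<gamma>}" "y \<in> {0..total_length \<gamma>}"
  then show "dist (arclength_param \<gamma> x) (arclength_param \<gamma> y) \<le> 1 * dist x y"
    using *[of x y] *[of y x] by (cases x y rule: linorder_cases) (auto simp: dist_commute dist_real_def)
qed simp

lemma borel_measurable_along_path:
  assumes "g \<in> borel_measurable (restrict_space borel \<Omega>)"
  shows "(\<lambda>s. g (arclength_param \<gamma> s) * indicator {0..total_length \<gamma>} s :: ennreal) \<in> borel_measurable borel"
proof -
  have "continuous_on {0..total_length \<gamma>} (arclength_param \<gamma>)"
    using arclength_param_lipschitz by (rule lipschitz_on_continuous_on)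
  then have "arclength_param \<gamma> \<in> restrict_space borel {0..total_length \<gamma>} \<rightarrow>\<^sub>M borel"
    by (rule borel_measurable_continuous_on_restrict)
  then have "arclength_param \<gamma> \<in> restrict_space borel {0..total_length \<gamma>} \<rightarrow>\<^sub>M restrict_space borel \<Omega>"
    by (rule measurable_restrict_space2[rotated]) (auto simp: space_restrict_space intro: arclength_param_in)
  from measurable_compose[OF this assms]
  have "(\<lambda>s. g (arclength_param \<gamma> s)) \<in> borel_measurable (restrict_space borel {0..total_length \<gamma>})" .
  then show ?thesis
    by (subst (asm) borel_measurable_restrict_space_iff_ennreal) auto
qed

end

text \<open>Pieces of the arc length parametrisation are rectifiable paths, with the same parametrisation up to
  a shift. Through this lemma an inequality for all paths becomes one for all subintervals of a path.\<close>

lemma rectifiable_subpath: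
  assumes \<gamma>: "\<gamma> \<in> rectifiable_paths \<Omega>"
    and ab: "0 \<le> a" "a < b" "b \<le> total_length \<gamma>"
    and image: "arclength_param \<gamma> ` {a..b} \<subseteq> \<Omega>'"
  obtains \<sigma> where "\<sigma> \<in> rectifiable_paths \<Omega>'" "pathstart \<sigma> = arclength_param \<gamma> a"
    "pathfinish \<sigma> = arclength_param \<gamma> b" "total_length \<sigma> = b - a"
    "\<And>s. s \<in> {0..b - a} \<Longrightarrow> arclength_param \<sigma> s = arclength_param \<gamma> (a + s)"
proof -
  obtain c d where cd: "0 \<le> c" "c < d" "d \<le> 1" "arc_length \<gamma> 0 c = ennreal a"
    "arc_length \<gamma> 0 d = ennreal b" "arc_length \<gamma> c d = ennreal (b - a)"
    "arclength_param \<gamma> a = \<gamma> c" "arclength_param \<gamma> b = \<gamma> d"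
    by (rule arclength_param_parameters[OF \<gamma> ab])
  define \<sigma> where "\<sigma> = (\<lambda>x. \<gamma> ((d - c) * x + c))"
  have len: "arc_length \<sigma> 0 t = arc_length \<gamma> c ((d - c) * t + c)" if "0 \<le> t" for t
    unfolding \<sigma>_def using arc_length_affine[of c d 0 t \<gamma>] cd that by simp
  have in_cd: "(d - c) * t + c \<in> {c..d}" if "t \<in> {0..1}" for t
  proof -
    have "(d - c) * t \<le> (d - c) * 1" using cd that by (intro mult_left_mono) auto
    moreover have "0 \<le> (d - c) * t" using cd that by (intro mult_nonneg_nonneg) auto
    ultimately show ?thesis using cd that unfolding atLeastAtMost_iff mult_1_right by linarith
  qed
  have \<sigma>_param: "\<sigma> t = arclength_param \<gamma> (a + s) \<and> s \<in> {0..b - a}"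
    if t: "t \<in> {0..1}" and s: "arc_length \<sigma> 0 t = ennreal s" and s0: "0 \<le> s" for t s
  proof -
    let ?t = "(d - c) * t + c"
    have "arc_length \<gamma> 0 ?t = arc_length \<gamma> 0 c + arc_length \<gamma> c ?t"
      using arc_length_add[of 0 c ?t \<gamma>] cd in_cd[OF t] by simp
    also have "\<dots> = ennreal (a + s)" using s len[of t] t cd s0 ab by (simp add: ennreal_plus)
    finally have "arclength_param \<gamma> (a + s) = \<gamma> ?t"
      using in_cd[OF t] cd by (intro arclength_param_eq[OF \<gamma>]) auto
    moreover have "ennreal s \<le> ennreal (b - a)"
      using arc_length_mono[of c ?t d \<gamma>] in_cd[OF t] s len[of t] t cd by simp
    ultimately show ?thesis using s0 ab by (simp add: \<sigma>_def ennreal_le_iff)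
  qed
  have "\<sigma> ` {0..1} \<subseteq> \<Omega>'"
  proof clarify
    fix t :: real assume t: "t \<in> {0..1}"
    have "arc_length \<sigma> 0 t < \<infinity>"
      unfolding len[of t, OF conjunct1[OF t[unfolded atLeastAtMost_iff]]]
      by (rule arc_length_less_top[OF rectifiable_pathD(2)[OF \<gamma>]]) (use in_cd[OF t] cd in auto)
    then obtain s where "arc_length \<sigma> 0 t = ennreal s" "0 \<le> s" by (cases "arc_length \<sigma> 0 t") auto
    from \<sigma>_param[OF t this] show "\<sigma> t \<in> \<Omega>'" using image by auto
  qed
  moreover have "continuous_on {0..1} \<sigma>" unfolding \<sigma>_def
    by (rule continuous_on_compose2[OF rectifiable_pathD(1)[OF \<gamma>]])
      (use in_cd cd in \<open>fastforce intro!: continuous_intros\<close>)+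
  moreover have pl: "path_length \<sigma> = ennreal (b - a)"
    using len[of 1] cd by (simp add: path_length_def length_upto_eq_arc_length)
  ultimately have \<sigma>: "\<sigma> \<in> rectifiable_paths \<Omega>'"
    using ab by (auto simp: rectifiable_paths_def path_def path_image_def)
  show thesis
  proof (rule that[OF \<sigma>])
    show tl: "total_length \<sigma> = b - a" using pl ab by (simp add: total_length_def)
    show "pathstart \<sigma> = arclength_param \<gamma> a" "pathfinish \<sigma> = arclength_param \<gamma> b"
      using cd by (auto simp: \<sigma>_def pathstart_def pathfinish_def)
    fix s assume s: "s \<in> {0..b - a}"
    obtain t where "t \<in> {0..1}" "arc_length \<sigma> 0 t = ennreal s" "arclength_param \<sigma> s = \<sigma> t"
      using ex_arc_length_eq[OF \<sigma>, of s] s tl by auto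
    then show "arclength_param \<sigma> s = arclength_param \<gamma> (a + s)" using \<sigma>_param s by auto
  qed
qed

lemma line_integral_subpath:
  assumes \<gamma>: "\<gamma> \<in> rectifiable_paths \<Omega>"
    and g: "g \<in> borel_measurable (restrict_space borel \<Omega>)"
    and ab: "0 \<le> a" "a < b" "b \<le> total_length \<gamma>"
    and tl: "total_length \<sigma> = b - a"
    and param: "\<And>s. s \<in> {0..b - a} \<Longrightarrow> arclength_param \<sigma> s = arclength_param \<gamma> (a + s)"
  shows "line_integral g \<sigma> = (\<integral>\<^sup>+s\<in>{a..b}. g (arclength_param \<gamma> s) \<partial>lborel)"
proof -
  let ?G = "\<lambda>s. g (arclength_param \<gamma> s) * indicator {0..total_length \<gamma>} s"
  have [measurable]: "?G \<in> borel_measurable borel" by (rule borel_measurable_along_path[OF \<gamma> g])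
  have "(\<integral>\<^sup>+s\<in>{a..b}. g (arclength_param \<gamma> s) \<partial>lborel) = (\<integral>\<^sup>+s. ?G s * indicator {a..b} s \<partial>lborel)"
    using ab by (intro nn_integral_cong) (auto simp: indicator_def)
  also have "\<dots> = (\<integral>\<^sup>+s. ?G (a + 1 * s) * indicator {a..b} (a + 1 * s) \<partial>lborel)"
    by (subst nn_integral_real_affine[where c = 1 and t = a]) auto
  also have "\<dots> = line_integral g \<sigma>"
    unfolding line_integral_eq tl using ab param
    by (intro nn_integral_cong) (auto simp: indicator_def)
  finally show ?thesis ..
qed

section \<open>Gluing bounds for increments on the real line\<close>

text \<open>Increments between points of \<open>Q\<close> are bounded both by \<open>M\<close> and by \<open>N\<close>. The intervals in \<open>W\<close> are
  switched from \<open>M\<close> to \<open>N\<close> one at a time, which is harmless because their end points lie in \<open>Q\<close>, so that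
  an increment can be split there. The passage to infinitely many intervals needs \<open>M\<close> to be finite.\<close>

lemma increment_le_component_gluing:
  fixes f :: "real \<Rightarrow> real" and M N :: "real measure" and c' d' :: "nat \<Rightarrow> real"
  assumes sets [measurable_cong, simp]: "sets M = sets borel" "sets N = sets borel"
    and fin: "emeasure M UNIV < \<infinity>"
    and M: "\<And>a b. a \<in> Q \<Longrightarrow> b \<in> Q \<Longrightarrow> a < b \<Longrightarrow> ennreal \<bar>f a - f b\<bar> \<le> emeasure M {a<..b}"
    and N: "\<And>a b. a \<in> Q \<Longrightarrow> b \<in> Q \<Longrightarrow> a < b \<Longrightarrow> ennreal \<bar>f a - f b\<bar> \<le> emeasure N {a<..b}"
    and I: "\<And>n. c' n \<in> Q" "\<And>n. d' n \<in> Q" "\<And>n. c' n \<le> d' n"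
    and ab: "a \<in> Q" "b \<in> Q" "a < b"
  defines "W \<equiv> \<Union>n. {c' n<..d' n}"
  shows "ennreal \<bar>f a - f b\<bar> \<le> emeasure M ({a<..b} - W) + emeasure N ({a<..b} \<inter> W)"
proof -
  define A where "A n = (\<Union>k<n. {c' k<..d' k})" for n
  have A [measurable]: "A n \<in> sets borel" for n unfolding A_def by auto
  have step: "ennreal \<bar>f c - f d\<bar> \<le> emeasure M ({c<..d} - A n) + emeasure N ({c<..d} \<inter> A n)"
    if "c \<in> Q" "d \<in> Q" "c \<le> d" for n c d
    using that
  proof (induction n arbitrary: c d)
    case 0
    then show ?case using M[of c d] by (cases "c = d") (auto simp: A_def)
  next
    case (Suc n)
    \<comment> \<open>The next interval, clamped to \<open>[c, d]\<close>; its end points \<open>x\<close> and \<open>y\<close> are still in \<open>Q\<close>.\<close>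
    define x where "x = max c (min (c' n) d)"
    define y where "y = max c (min (d' n) d)"
    have xy: "x \<in> Q" "y \<in> Q" "c \<le> x" "x \<le> y" "y \<le> d"
      using Suc.prems I[of n] by (auto simp: x_def y_def max_def min_def)
    have I_eq: "{c<..d} \<inter> {c' n<..d' n} = {x<..y}"
      by (auto simp: x_def y_def)
    have split: "{c<..d} - {c' n<..d' n} = {c<..x} \<union> {y<..d}" "{c<..d} = {c<..x} \<union> {x<..y} \<union> {y<..d}"
      using I(3)[of n] xy by (auto simp: x_def y_def)
    have AS: "A (Suc n) = A n \<union> {c' n<..d' n}" by (auto simp: A_def lessThan_Suc)
    have mid: "ennreal \<bar>f x - f y\<bar> \<le> emeasure N {x<..y}"
      using N[of x y] xy by (cases "x = y") auto
    have "ennreal \<bar>f c - f d\<bar> \<le> ennreal \<bar>f c - f x\<bar> + ennreal \<bar>f x - f y\<bar> + ennreal \<bar>f y - f d\<bar>"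
      by (simp flip: ennreal_plus add: ennreal_leI)
    also have "\<dots> \<le> (emeasure M ({c<..x} - A n) + emeasure N ({c<..x} \<inter> A n)) + emeasure N {x<..y}
        + (emeasure M ({y<..d} - A n) + emeasure N ({y<..d} \<inter> A n))"
      using Suc.IH[of c x] Suc.IH[of y d] mid xy Suc.prems by (intro add_mono) auto
    also have "\<dots> = (emeasure M ({c<..x} - A n) + emeasure M ({y<..d} - A n))
        + (emeasure N ({c<..x} \<inter> A n) + emeasure N {x<..y} + emeasure N ({y<..d} \<inter> A n))"
      by (simp add: ac_simps)
    also have "emeasure M ({c<..x} - A n) + emeasure M ({y<..d} - A n)
        = emeasure M (({c<..x} - A n) \<union> ({y<..d} - A n))"
      using xy by (intro plus_emeasure) auto
    also have "({c<..x} - A n) \<union> ({y<..d} - A n) = {c<..d} - A (Suc n)"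
      using split(1) unfolding AS by blast
    also have "emeasure N ({c<..x} \<inter> A n) + emeasure N {x<..y} = emeasure N (({c<..x} \<inter> A n) \<union> {x<..y})"
      using xy by (intro plus_emeasure) auto
    also have "\<dots> + emeasure N ({y<..d} \<inter> A n)
        = emeasure N ((({c<..x} \<inter> A n) \<union> {x<..y}) \<union> ({y<..d} \<inter> A n))"
      using xy by (intro plus_emeasure) auto
    also have "(({c<..x} \<inter> A n) \<union> {x<..y}) \<union> ({y<..d} \<inter> A n) = {c<..d} \<inter> A (Suc n)"
      using I_eq split(2) unfolding AS by blast
    finally show ?case .
  qed
  have "(\<lambda>n. emeasure M ({a<..b} - A n)) \<longlonglongrightarrow> emeasure M (\<Inter>n. {a<..b} - A n)"
  proof (rule Lim_emeasure_decseq)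
    show "decseq (\<lambda>n. {a<..b} - A n)" by (force simp: decseq_def A_def)
    show "emeasure M ({a<..b} - A i) \<noteq> \<infinity>" for i
      using emeasure_mono[of "{a<..b} - A i" UNIV M] fin sets_eq_imp_space_eq[OF sets(1)]
      by (auto simp: top_unique)
  qed auto
  moreover have "(\<lambda>n. emeasure N ({a<..b} \<inter> A n)) \<longlonglongrightarrow> emeasure N (\<Union>n. {a<..b} \<inter> A n)"
    by (rule Lim_emeasure_incseq) (force simp: incseq_def A_def)+
  ultimately have "(\<lambda>n. emeasure M ({a<..b} - A n) + emeasure N ({a<..b} \<inter> A n))
      \<longlonglongrightarrow> emeasure M (\<Inter>n. {a<..b} - A n) + emeasure N (\<Union>n. {a<..b} \<inter> A n)"
    by (rule tendsto_add)
  then have "ennreal \<bar>f a - f b\<bar> \<le> emeasure M (\<Inter>n. {a<..b} - A n) + emeasure N (\<Union>n. {a<..b} \<inter> A n)"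
    by (rule tendsto_lowerbound) (use step ab in auto)
  moreover have "(\<Inter>n. {a<..b} - A n) = {a<..b} - W" "(\<Union>n. {a<..b} \<inter> A n) = {a<..b} \<inter> W"
    by (auto simp: A_def W_def)
  ultimately show ?thesis by simp
qed

lemma nearest_point_below:
  fixes Q :: "real set"
  assumes "closed Q" "a \<in> Q" "a \<le> q"
  obtains c where "c \<in> Q" "a \<le> c" "c \<le> q" "{c<..q} \<inter> Q = {}"
proof -
  have "compact (Q \<inter> {a..q})" using assms(1) by (auto intro: closed_Int_compact)
  moreover have "Q \<inter> {a..q} \<noteq> {}" using assms by auto
  ultimately obtain c where "c \<in> Q \<inter> {a..q}" "\<And>t. t \<in> Q \<inter> {a..q} \<Longrightarrow> t \<le> c"
    using compact_attains_sup[of "Q \<inter> {a..q}"] by metis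
  then show thesis by (intro that[of c]) force+
qed

lemma nearest_point_above:
  fixes Q :: "real set"
  assumes "closed Q" "b \<in> Q" "q \<le> b"
  obtains d where "d \<in> Q" "q \<le> d" "d \<le> b" "{q..<d} \<inter> Q = {}"
proof -
  have "compact (Q \<inter> {q..b})" using assms(1) by (auto intro: closed_Int_compact)
  moreover have "Q \<inter> {q..b} \<noteq> {}" using assms by auto
  ultimately obtain d where "d \<in> Q \<inter> {q..b}" "\<And>t. t \<in> Q \<inter> {q..b} \<Longrightarrow> d \<le> t"
    using compact_attains_inf[of "Q \<inter> {q..b}"] by metis
  then show thesis by (intro that[of d]) force+
qed

text \<open>Here \<open>M\<close> bounds only the increments between points of \<open>Q\<close>. Between two points of \<open>Q\<close>, its
  complement is the union of the gaps around rational numbers, and the end points of a gap lie in \<open>Q\<close>. The half-open intervals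
  to be glued exceed the gaps by countably many end points, which \<open>N\<close> does not charge.\<close>

lemma increment_le_closed_gluing:
  fixes f :: "real \<Rightarrow> real" and M N :: "real measure"
  assumes sets [measurable_cong, simp]: "sets M = sets borel" "sets N = sets borel"
    and fin: "emeasure M UNIV < \<infinity>"
    and atom: "\<And>x. emeasure N {x} = 0"
    and Q: "closed Q"
    and M: "\<And>a b. a \<in> Q \<Longrightarrow> b \<in> Q \<Longrightarrow> lo \<le> a \<Longrightarrow> a < b \<Longrightarrow> b \<le> hi \<Longrightarrow>
      ennreal \<bar>f a - f b\<bar> \<le> emeasure M {a<..b}"
    and N: "\<And>a b. lo \<le> a \<Longrightarrow> a < b \<Longrightarrow> b \<le> hi \<Longrightarrow> ennreal \<bar>f a - f b\<bar> \<le> emeasure N {a<..b}"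
    and ab: "lo \<le> a" "a < b" "b \<le> hi"
  shows "ennreal \<bar>f a - f b\<bar> \<le> emeasure M ({a<..b} \<inter> Q) + emeasure N ({a<..b} - Q)"
proof (cases "{a..b} \<inter> Q = {}")
  case True
  then have "{a<..b} - Q = {a<..b}" by (auto simp: disjoint_iff)
  with N[OF ab] show ?thesis by (simp add: add_increasing)
next
  case False
  have [measurable]: "Q \<in> sets borel" using Q by simp
  from False obtain r where r: "r \<in> Q" "a \<le> r" "r \<le> b" by auto
  obtain a' where a': "a' \<in> Q" "a \<le> a'" "a' \<le> r" "{a..<a'} \<inter> Q = {}"
    using nearest_point_above[OF Q r(1,2)] .
  obtain b' where b': "b' \<in> Q" "r \<le> b'" "b' \<le> b" "{b'<..b} \<inter> Q = {}"
    using nearest_point_below[OF Q r(1,3)] .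
  have countable_null: "emeasure N C = 0" if "countable C" for C
  proof -
    have "emeasure N C = (\<integral>\<^sup>+x. emeasure N {x} \<partial>count_space C)"
      using that by (intro emeasure_countable_singleton) auto
    then show ?thesis by (simp add: atom)
  qed
  have drop: "emeasure N A \<le> emeasure N B" if "A - B \<subseteq> C" "countable C" and [measurable]: "A \<in> sets borel" "B \<in> sets borel" for A B C
  proof -
    have "countable (A - B)" using that(1,2) countable_subset by blast
    then have "emeasure N (A - B) = 0" by (rule countable_null)
    moreover have "emeasure N A \<le> emeasure N (B \<union> (A - B))" by (intro emeasure_mono) auto
    moreover have "\<dots> \<le> emeasure N B + emeasure N (A - B)" by (intro emeasure_subadditive) auto
    ultimately show ?thesis by simp
  qed
  have mid: "ennreal \<bar>f a' - f b'\<bar> \<le> emeasure M ({a'<..b'} \<inter> Q) + emeasure N ({a'<..b'} - Q)"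
  proof (cases "a' = b'")
    case neq: False
    then have less: "a' < b'" using a' b' by simp
    obtain q :: "nat \<Rightarrow> real" where q: "\<rat> = range q"
      using countable_rat uncountable_def Rats_0 by (metis countableE_infinite bij_betw_imp_surj_on rat_denum countable_as_injective_image Rats_infinite)
    \<comment> \<open>The gap around the \<open>n\<close>-th rational reaches from \<open>c' n\<close> to \<open>d' n\<close>.\<close>
    define p where "p n = max a' (min (q n) b')" for n
    have p: "a' \<le> p n" "p n \<le> b'" for n using less by (auto simp: p_def)
    have "\<exists>c. c \<in> Q \<and> a' \<le> c \<and> c \<le> p n \<and> {c<..p n} \<inter> Q = {}" for n
      using nearest_point_below[OF Q a'(1) p(1)] by metis
    then obtain c' where c': "\<And>n. c' n \<in> Q" "\<And>n. a' \<le> c' n" "\<And>n. c' n \<le> p n" "\<And>n. {c' n<..p n} \<inter> Q = {}"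
      by metis
    have "\<exists>d. d \<in> Q \<and> p n \<le> d \<and> d \<le> b' \<and> {p n..<d} \<inter> Q = {}" for n
      using nearest_point_above[OF Q b'(1) p(2)] by metis
    then obtain d' where d': "\<And>n. d' n \<in> Q" "\<And>n. p n \<le> d' n" "\<And>n. d' n \<le> b'" "\<And>n. {p n..<d' n} \<inter> Q = {}"
      by metis
    define W where "W = (\<Union>n. {c' n<..d' n})"
    have [measurable]: "W \<in> sets borel" unfolding W_def by auto
    have "ennreal \<bar>f a' - f b'\<bar> \<le> emeasure M ({a'<..b'} - W) + emeasure N ({a'<..b'} \<inter> W)"
      unfolding W_def
    proof (rule increment_le_component_gluing[where Q = "Q \<inter> {a'..b'}"])
      show "c' n \<in> Q \<inter> {a'..b'}" "d' n \<in> Q \<inter> {a'..b'}" "c' n \<le> d' n" for n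
        using c'[of n] d'[of n] p[of n] by auto
    qed (use fin M N ab a' b' less in auto)
    also have "emeasure M ({a'<..b'} - W) \<le> emeasure M ({a'<..b'} \<inter> Q)"
    proof (intro emeasure_mono)
      show "{a'<..b'} - W \<subseteq> {a'<..b'} \<inter> Q"
      proof (rule ccontr)
        assume "\<not> {a'<..b'} - W \<subseteq> {a'<..b'} \<inter> Q"
        then obtain s where s: "s \<in> {a'<..b'}" "s \<notin> W" "s \<notin> Q" by blast
        then have "s \<noteq> b'" using b' by auto
        with s have "s \<in> {a'<..<b'} - Q" by auto
        moreover have "open ({a'<..<b'} - Q)" using Q by auto
        ultimately obtain e where e: "e > 0" "ball s e \<subseteq> {a'<..<b'} - Q"
          by (meson open_contains_ball)
        obtain t where t: "t \<in> \<rat>" "s < t" "t < s + e"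
          using Rats_dense_in_real[of s "s + e"] e by auto
        then obtain n where n: "t = q n" using q by auto
        have st: "{s..t} \<subseteq> ball s e" using t by (auto simp: dist_real_def)
        then have "p n = t" using e t n by (auto simp: p_def subset_eq)
        have "c' n < s"
        proof (rule ccontr)
          assume "\<not> c' n < s"
          then have "c' n \<in> {s..t}" using c'(3)[of n] \<open>p n = t\<close> by auto
          then show False using c'(1)[of n] st e by auto
        qed
        moreover have "s \<le> d' n" using d'(2)[of n] \<open>p n = t\<close> t by simp
        ultimately show False using s by (auto simp: W_def)
      qed
    qed auto
    also have "emeasure N ({a'<..b'} \<inter> W) \<le> emeasure N ({a'<..b'} - Q)"
    proof (rule drop)
      have "x = d' n" if "x \<in> {c' n<..d' n}" "x \<in> Q" for x n
        using that c'(4)[of n] d'(4)[of n]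
        by (cases "x \<le> p n") (auto simp: disjoint_iff not_le less_le)
      then show "{a'<..b'} \<inter> W - ({a'<..b'} - Q) \<subseteq> range d'" unfolding W_def by blast
    qed auto
    finally show ?thesis by (simp add: add_mono)
  qed simp
  have left: "ennreal \<bar>f a - f a'\<bar> \<le> emeasure N ({a<..a'} - Q)"
  proof (cases "a = a'")
    case False
    then have "ennreal \<bar>f a - f a'\<bar> \<le> emeasure N {a<..a'}" using N[of a a'] ab a' b' r by simp
    also have "\<dots> \<le> emeasure N ({a<..a'} - Q)"
    proof (rule drop)
      show "{a<..a'} - ({a<..a'} - Q) \<subseteq> {a'}"
        using a'(4) by (auto simp: disjoint_iff not_le less_le)
    qed auto
    finally show ?thesis .
  qed simp
  have right: "ennreal \<bar>f b' - f b\<bar> \<le> emeasure N ({b'<..b} - Q)"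
  proof (cases "b' = b")
    case False
    moreover have "{b'<..b} - Q = {b'<..b}" using b'(4) by auto
    ultimately show ?thesis using N[of b' b] ab a' b' r by simp
  qed simp
  have "ennreal \<bar>f a - f b\<bar> \<le> ennreal \<bar>f a - f a'\<bar> + ennreal \<bar>f a' - f b'\<bar> + ennreal \<bar>f b' - f b\<bar>"
    by (simp flip: ennreal_plus add: ennreal_leI)
  also have "\<dots> \<le> emeasure N ({a<..a'} - Q)
      + (emeasure M ({a'<..b'} \<inter> Q) + emeasure N ({a'<..b'} - Q)) + emeasure N ({b'<..b} - Q)"
    by (intro add_mono left mid right)
  also have "\<dots> = emeasure M ({a'<..b'} \<inter> Q)
      + (emeasure N ({a<..a'} - Q) + emeasure N ({a'<..b'} - Q) + emeasure N ({b'<..b} - Q))"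
    by (simp add: ac_simps)
  also have "emeasure N ({a<..a'} - Q) + emeasure N ({a'<..b'} - Q) = emeasure N (({a<..a'} - Q) \<union> ({a'<..b'} - Q))"
    by (intro plus_emeasure) auto
  also have "\<dots> + emeasure N ({b'<..b} - Q) = emeasure N ((({a<..a'} - Q) \<union> ({a'<..b'} - Q)) \<union> ({b'<..b} - Q))"
    using a' b' by (intro plus_emeasure) auto
  also have "(({a<..a'} - Q) \<union> ({a'<..b'} - Q)) \<union> ({b'<..b} - Q) = {a<..b} - Q"
    using a' b' by auto
  also have "emeasure M ({a'<..b'} \<inter> Q) \<le> emeasure M ({a<..b} \<inter> Q)"
    using a' b' by (intro emeasure_mono) auto
  finally show ?thesis by (simp add: add_mono)
qed

text \<open>By inner regularity of \<open>N\<close>, a Borel set may be replaced by a compact subset at the cost of an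
  arbitrarily small amount of \<open>N\<close>-measure.\<close>

lemma increment_le_borel_gluing:
  fixes f :: "real \<Rightarrow> real" and M N :: "real measure"
  assumes sets [measurable_cong, simp]: "sets M = sets borel" "sets N = sets borel"
    and fin: "emeasure M UNIV < \<infinity>" "emeasure N UNIV < \<infinity>"
    and atom: "\<And>x. emeasure N {x} = 0"
    and M: "\<And>a b. lo \<le> a \<Longrightarrow> a < b \<Longrightarrow> b \<le> hi \<Longrightarrow> ennreal \<bar>f a - f b\<bar> \<le> emeasure M {a<..b}"
    and N: "\<And>a b. lo \<le> a \<Longrightarrow> a < b \<Longrightarrow> b \<le> hi \<Longrightarrow> ennreal \<bar>f a - f b\<bar> \<le> emeasure N {a<..b}"
    and ab: "lo \<le> a" "a < b" "b \<le> hi"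
    and B [measurable]: "B \<in> sets borel"
  shows "ennreal \<bar>f a - f b\<bar> \<le> emeasure M ({a<..b} \<inter> B) + emeasure N ({a<..b} - B)"
proof (rule ennreal_le_epsilon)
  fix e :: real assume e: "0 < e"
  have spN: "space N = UNIV" using sets_eq_imp_space_eq[OF sets(2)] by simp
  have finN: "emeasure N A < \<infinity>" for A
    using fin(2) emeasure_space[of N A] spN by (auto simp: less_top top_unique)
  have Nspace: "emeasure N (space N) \<noteq> \<infinity>" using finN[of "space N"] by simp
  have sup: "emeasure N B = (SUP K\<in>{K. K \<subseteq> B \<and> compact K}. emeasure N K)"
    by (rule inner_regular[OF sets(2) Nspace B])
  have ne: "{K. K \<subseteq> B \<and> compact K} \<noteq> {}" using compact_empty by blast
  have "emeasure N B \<noteq> \<infinity>" using finN[of B] by simp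
  then have "\<exists>K\<in>{K. K \<subseteq> B \<and> compact K}. emeasure N B < emeasure N K + ennreal e"
    by (rule SUP_approx_ennreal[OF e ne sup])
  then obtain K where K: "K \<subseteq> B" "compact K" and less: "emeasure N B < emeasure N K + ennreal e"
    by auto
  have [measurable]: "K \<in> sets borel" using K(2) by (simp add: compact_imp_closed)
  have "emeasure N K + emeasure N (B - K) = emeasure N (K \<union> (B - K))"
    by (intro plus_emeasure) auto
  also have "K \<union> (B - K) = B" using K by auto
  finally have "emeasure N K + emeasure N (B - K) \<le> emeasure N K + ennreal e" using less by simp
  then have small: "emeasure N (B - K) \<le> ennreal e"
    using finN[of K] by (subst (asm) ennreal_add_left_cancel_le) auto
  have "ennreal \<bar>f a - f b\<bar> \<le> emeasure M ({a<..b} \<inter> K) + emeasure N ({a<..b} - K)"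
    by (rule increment_le_closed_gluing[OF sets fin(1) atom compact_imp_closed[OF K(2)] M N ab])
  also have "emeasure M ({a<..b} \<inter> K) \<le> emeasure M ({a<..b} \<inter> B)"
    using K by (intro emeasure_mono) auto
  also have "emeasure N ({a<..b} - K) \<le> emeasure N (({a<..b} - B) \<union> (B - K))"
    by (intro emeasure_mono) auto
  also have "\<dots> \<le> emeasure N ({a<..b} - B) + emeasure N (B - K)"
    by (intro emeasure_subadditive) auto
  also have "\<dots> \<le> emeasure N ({a<..b} - B) + ennreal e" using small by (rule add_left_mono)
  finally show "ennreal \<bar>f a - f b\<bar> \<le> emeasure M ({a<..b} \<inter> B) + emeasure N ({a<..b} - B) + ennreal e"
    by (simp add: add_mono add.assoc)
qed

text \<open>Increments are subadditive and measures are additive, so a bound on short intervals is a bound on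
  all of them.\<close>

lemma increment_le_measure_of_short:
  fixes f :: "real \<Rightarrow> real" and R :: "real measure"
  assumes sets [measurable_cong, simp]: "sets R = sets borel"
    and short: "\<And>a b. lo \<le> a \<Longrightarrow> a < b \<Longrightarrow> b \<le> hi \<Longrightarrow> b - a \<le> \<delta> \<Longrightarrow>
      ennreal \<bar>f a - f b\<bar> \<le> emeasure R {a<..b}"
    and \<delta>: "0 < \<delta>" and ab: "lo \<le> a" "a < b" "b \<le> hi"
  shows "ennreal \<bar>f a - f b\<bar> \<le> emeasure R {a<..b}"
proof -
  have "ennreal \<bar>f a - f b\<bar> \<le> emeasure R {a<..b}" if "lo \<le> a" "a < b" "b \<le> hi" "b - a \<le> real n * \<delta>" for n a b
    using that
  proof (induction n arbitrary: b)
    case (Suc n)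
    show ?case
    proof (cases "b - a \<le> \<delta>")
      case True
      with Suc.prems short show ?thesis by blast
    next
      case False
      have "ennreal \<bar>f a - f b\<bar> \<le> ennreal \<bar>f a - f (b - \<delta>)\<bar> + ennreal \<bar>f (b - \<delta>) - f b\<bar>"
        by (simp flip: ennreal_plus add: ennreal_leI)
      also have "\<dots> \<le> emeasure R {a<..b - \<delta>} + emeasure R {b - \<delta><..b}"
        using Suc.prems False \<delta>
        by (intro add_mono Suc.IH short) (auto simp: algebra_simps)
      also have "\<dots> = emeasure R ({a<..b - \<delta>} \<union> {b - \<delta><..b})"
        by (intro plus_emeasure) auto
      also have "{a<..b - \<delta>} \<union> {b - \<delta><..b} = {a<..b}" using False \<delta> by auto
      finally show ?thesis .
    qed
  qed simp
  moreover obtain n :: nat where "(b - a) / \<delta> \<le> real n" using real_arch_simple by blast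
  ultimately show ?thesis using ab \<delta> by (auto simp: field_simps)
qed

section \<open>Exceptional families of paths\<close>

definition Lp_densities :: "real \<Rightarrow> 'a::metric_space measure \<Rightarrow> ('a \<Rightarrow> ennreal) set" where
  "Lp_densities p \<mu> = {\<rho> \<in> borel_measurable borel. (\<integral>\<^sup>+x. epowr (\<rho> x) p \<partial>\<mu>) < \<infinity>}"

lemma rectifiable_paths_mono: "A \<subseteq> B \<Longrightarrow> rectifiable_paths A \<subseteq> rectifiable_paths B"
  by (auto simp: rectifiable_paths_def)

lemma borel_measurable_along_path':
  assumes "\<gamma> \<in> rectifiable_paths \<Omega>" "g \<in> borel_measurable borel"
  shows "(\<lambda>s. g (arclength_param \<gamma> s) * indicator {0..total_length \<gamma>} s :: ennreal) \<in> borel_measurable borel"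
proof (rule borel_measurable_along_path)
  show "\<gamma> \<in> rectifiable_paths UNIV" using assms(1) rectifiable_paths_mono[of \<Omega> UNIV] by auto
  show "g \<in> borel_measurable (restrict_space borel UNIV)" using assms(2) by simp
qed

lemma line_integral_cmult:
  assumes "\<gamma> \<in> rectifiable_paths \<Omega>" "g \<in> borel_measurable borel"
  shows "line_integral (\<lambda>x. c * g x) \<gamma> = c * line_integral g \<gamma>"
  unfolding line_integral_eq using borel_measurable_along_path'[OF assms]
  by (subst nn_integral_cmult[symmetric]) (auto simp: mult.assoc)

lemma line_integral_mono:
  assumes "\<And>x. f x \<le> g x"
  shows "line_integral f \<gamma> \<le> line_integral g \<gamma>"
  unfolding line_integral_eq by (intro nn_integral_mono mult_right_mono assms) auto

locale metric_measure =
  fixes \<mu> :: "'a::metric_space measure" and p :: real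
  assumes sets_\<mu> [measurable_cong, simp]: "sets \<mu> = sets borel" and p_pos: "0 < p"
begin

abbreviation Lp_integral :: "'a set \<Rightarrow> ('a \<Rightarrow> ennreal) \<Rightarrow> ennreal" where
  "Lp_integral \<Omega> g \<equiv> (\<integral>\<^sup>+x\<in>\<Omega>. epowr (g x) p \<partial>\<mu>)"

lemma SUP_Lp_densities:
  assumes meas: "\<And>n::nat. \<sigma> n \<in> borel_measurable borel"
    and bound: "\<And>n. (\<integral>\<^sup>+x. epowr (\<sigma> n x) p \<partial>\<mu>) \<le> ennreal ((1 / 2) ^ n)"
  shows "(\<lambda>x. SUP n. \<sigma> n x) \<in> Lp_densities p \<mu>"
proof -
  note [measurable] = meas
  have "(\<integral>\<^sup>+x. epowr (SUP n. \<sigma> n x) p \<partial>\<mu>) \<le> (\<integral>\<^sup>+x. (\<Sum>n. epowr (\<sigma> n x) p) \<partial>\<mu>)"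
    by (intro nn_integral_mono epowr_SUP_le_suminf p_pos)
  also have "\<dots> = (\<Sum>n. \<integral>\<^sup>+x. epowr (\<sigma> n x) p \<partial>\<mu>)"
    by (intro nn_integral_suminf) measurable
  also have "\<dots> \<le> (\<Sum>n. ennreal ((1 / 2) ^ n))"
    by (intro suminf_le bound) auto
  also have "\<dots> = ennreal (\<Sum>n. (1 / 2) ^ n)"
    by (intro suminf_ennreal2) auto
  also have "\<dots> < \<infinity>" by simp
  finally show ?thesis unfolding Lp_densities_def by simp
qed

text \<open>Countably many exceptional families have a common witness: scale the densities so that their
  energies are summable, and take the supremum.\<close>

lemma ex_common_density:
  assumes "\<And>n::nat. \<rho> n \<in> Lp_densities p \<mu>"
  obtains \<sigma> where "\<sigma> \<in> Lp_densities p \<mu>"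
    "\<And>\<gamma> \<Omega> n. \<gamma> \<in> rectifiable_paths \<Omega> \<Longrightarrow> line_integral \<sigma> \<gamma> < \<infinity> \<Longrightarrow> line_integral (\<rho> n) \<gamma> < \<infinity>"
proof -
  have \<rho> [measurable]: "\<And>n. \<rho> n \<in> borel_measurable borel"
    and fin: "\<And>n. (\<integral>\<^sup>+x. epowr (\<rho> n x) p \<partial>\<mu>) < \<infinity>"
    using assms by (auto simp: Lp_densities_def)
  have "\<exists>c>0. ennreal (c powr p) * (\<integral>\<^sup>+x. epowr (\<rho> n x) p \<partial>\<mu>) \<le> ennreal ((1 / 2) ^ n)" for n
    by (rule ex_small_factor[OF fin[of n] _ p_pos, of "(1 / 2) ^ n"]) auto
  then obtain c where c: "\<And>n. c n > 0"
    and small: "\<And>n. ennreal (c n powr p) * (\<integral>\<^sup>+x. epowr (\<rho> n x) p \<partial>\<mu>) \<le> ennreal ((1 / 2) ^ n)"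
    by metis
  define \<sigma> where "\<sigma> = (\<lambda>x. SUP n. ennreal (c n) * \<rho> n x)"
  have "\<sigma> \<in> Lp_densities p \<mu>"
    unfolding \<sigma>_def
  proof (rule SUP_Lp_densities)
    fix n
    have "(\<integral>\<^sup>+x. epowr (ennreal (c n) * \<rho> n x) p \<partial>\<mu>) = (\<integral>\<^sup>+x. ennreal (c n powr p) * epowr (\<rho> n x) p \<partial>\<mu>)"
      using c[of n] p_pos by (simp add: epowr_mult)
    also have "\<dots> = ennreal (c n powr p) * (\<integral>\<^sup>+x. epowr (\<rho> n x) p \<partial>\<mu>)"
      by (intro nn_integral_cmult) measurable
    finally show "(\<integral>\<^sup>+x. epowr (ennreal (c n) * \<rho> n x) p \<partial>\<mu>) \<le> ennreal ((1 / 2) ^ n)"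
      using small[of n] by simp
  qed simp
  moreover have "line_integral (\<rho> n) \<gamma> < \<infinity>"
    if \<gamma>: "\<gamma> \<in> rectifiable_paths \<Omega>" and "line_integral \<sigma> \<gamma> < \<infinity>" for \<gamma> \<Omega> n
  proof -
    have "ennreal (c n) * line_integral (\<rho> n) \<gamma> \<le> line_integral \<sigma> \<gamma>"
      unfolding line_integral_cmult[OF \<gamma> \<rho>, symmetric]
      by (intro line_integral_mono) (auto simp: \<sigma>_def intro: SUP_upper)
    then have "ennreal (c n) * line_integral (\<rho> n) \<gamma> < \<infinity>" using that(2) by (rule le_less_trans)
    then show ?thesis using c[of n] by (auto simp: ennreal_mult_less_top)
  qed
  ultimately show thesis by (rule that)
qed

lemma ex_common_density2:
  assumes "\<rho> \<in> Lp_densities p \<mu>" "\<rho>' \<in> Lp_densities p \<mu>"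
  obtains \<sigma> where "\<sigma> \<in> Lp_densities p \<mu>"
    "\<And>\<gamma> \<Omega>. \<gamma> \<in> rectifiable_paths \<Omega> \<Longrightarrow> line_integral \<sigma> \<gamma> < \<infinity> \<Longrightarrow>
      line_integral \<rho> \<gamma> < \<infinity> \<and> line_integral \<rho>' \<gamma> < \<infinity>"
proof -
  define \<rho>s where "\<rho>s n = (if n = 0 then \<rho> else \<rho>')" for n :: nat
  have "\<rho>s n \<in> Lp_densities p \<mu>" for n using assms by (simp add: \<rho>s_def)
  then obtain \<sigma> where \<sigma>: "\<sigma> \<in> Lp_densities p \<mu>" "\<And>\<gamma> \<Omega> n. \<gamma> \<in> rectifiable_paths \<Omega> \<Longrightarrow>
      line_integral \<sigma> \<gamma> < \<infinity> \<Longrightarrow> line_integral (\<rho>s n) \<gamma> < \<infinity>"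
    using ex_common_density[of \<rho>s] by blast
  show thesis
  proof (rule that[OF \<sigma>(1)])
    fix \<gamma> and \<Omega> :: "'a set" assume "\<gamma> \<in> rectifiable_paths \<Omega>" "line_integral \<sigma> \<gamma> < \<infinity>"
    from \<sigma>(2)[OF this, of 0] \<sigma>(2)[OF this, of 1]
    show "line_integral \<rho> \<gamma> < \<infinity> \<and> line_integral \<rho>' \<gamma> < \<infinity>" by (simp add: \<rho>s_def)
  qed
qed

text \<open>If the modulus is zero, choose admissible densities \<open>\<rho> n\<close> whose energy is so small that the multiples
  \<open>(n + 1) * \<rho> n\<close> have summable energies; their supremum has integral at least \<open>n + 1\<close> over every path,
  for all \<open>n\<close>. Conversely, all positive multiples of a density with infinite integrals are admissible, and their
  energy is arbitrarily small.\<close>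

lemma modulus_zero_iff:
  assumes \<Gamma>: "\<Gamma> \<subseteq> rectifiable_paths \<Omega>"
  shows "modulus p \<mu> \<Gamma> = 0 \<longleftrightarrow> (\<exists>\<rho>\<in>Lp_densities p \<mu>. \<forall>\<gamma>\<in>\<Gamma>. line_integral \<rho> \<gamma> = \<infinity>)"
proof
  assume zero: "modulus p \<mu> \<Gamma> = 0"
  have "\<exists>\<rho>. \<rho> \<in> borel_measurable borel \<and> (\<forall>\<gamma>\<in>\<Gamma>. 1 \<le> line_integral \<rho> \<gamma>) \<and>
      ennreal (real (Suc n) powr p) * (\<integral>\<^sup>+x. epowr (\<rho> x) p \<partial>\<mu>) \<le> ennreal ((1 / 2) ^ n)" for n
  proof -
    have pos: "0 < (1 / 2) ^ n / real (Suc n) powr p" by (simp add: divide_pos_pos)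
    then have "modulus p \<mu> \<Gamma> < ennreal ((1 / 2) ^ n / real (Suc n) powr p)" using zero by simp
    then obtain \<rho> where \<rho>: "\<rho> \<in> borel_measurable borel" "\<forall>\<gamma>\<in>\<Gamma>. 1 \<le> line_integral \<rho> \<gamma>"
      and less: "(\<integral>\<^sup>+x. epowr (\<rho> x) p \<partial>\<mu>) < ennreal ((1 / 2) ^ n / real (Suc n) powr p)"
      unfolding modulus_def INF_less_iff by auto
    have "ennreal (real (Suc n) powr p) * (\<integral>\<^sup>+x. epowr (\<rho> x) p \<partial>\<mu>)
        \<le> ennreal (real (Suc n) powr p) * ennreal ((1 / 2) ^ n / real (Suc n) powr p)"
      using less by (intro mult_left_mono) auto
    also have "\<dots> = ennreal ((1 / 2) ^ n)"
      using pos by (subst ennreal_mult[symmetric]) auto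
    finally show ?thesis using \<rho> by blast
  qed
  then obtain \<rho> where \<rho> [measurable]: "\<And>n. \<rho> n \<in> borel_measurable borel"
    and adm: "\<And>n \<gamma>. \<gamma> \<in> \<Gamma> \<Longrightarrow> 1 \<le> line_integral (\<rho> n) \<gamma>"
    and small: "\<And>n. ennreal (real (Suc n) powr p) * (\<integral>\<^sup>+x. epowr (\<rho> n x) p \<partial>\<mu>) \<le> ennreal ((1 / 2) ^ n)"
    by metis
  define \<sigma> where "\<sigma> = (\<lambda>x. SUP n. ennreal (real (Suc n)) * \<rho> n x)"
  have "\<sigma> \<in> Lp_densities p \<mu>"
    unfolding \<sigma>_def
  proof (rule SUP_Lp_densities)
    fix n
    have "(\<integral>\<^sup>+x. epowr (ennreal (real (Suc n)) * \<rho> n x) p \<partial>\<mu>)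
        = (\<integral>\<^sup>+x. ennreal (real (Suc n) powr p) * epowr (\<rho> n x) p \<partial>\<mu>)"
      using p_pos by (subst epowr_mult) auto
    also have "\<dots> = ennreal (real (Suc n) powr p) * (\<integral>\<^sup>+x. epowr (\<rho> n x) p \<partial>\<mu>)"
      by (intro nn_integral_cmult) measurable
    finally show "(\<integral>\<^sup>+x. epowr (ennreal (real (Suc n)) * \<rho> n x) p \<partial>\<mu>) \<le> ennreal ((1 / 2) ^ n)"
      using small[of n] by simp
  qed simp
  moreover have "line_integral \<sigma> \<gamma> = \<infinity>" if \<gamma>: "\<gamma> \<in> \<Gamma>" for \<gamma>
  proof -
    have "ennreal (real (Suc n)) \<le> line_integral \<sigma> \<gamma>" for n
    proof -
      have "ennreal (real (Suc n)) * 1 \<le> ennreal (real (Suc n)) * line_integral (\<rho> n) \<gamma>"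
        using adm[OF \<gamma>] by (intro mult_left_mono) auto
      also have "\<dots> = line_integral (\<lambda>x. ennreal (real (Suc n)) * \<rho> n x) \<gamma>"
        using \<gamma> \<Gamma> by (subst line_integral_cmult[of _ \<Omega>]) auto
      also have "\<dots> \<le> line_integral \<sigma> \<gamma>"
        by (intro line_integral_mono) (auto simp: \<sigma>_def intro: SUP_upper)
      finally show ?thesis by simp
    qed
    note large = this
    show ?thesis
    proof (rule ccontr)
      assume "line_integral \<sigma> \<gamma> \<noteq> \<infinity>"
      then obtain r where r: "line_integral \<sigma> \<gamma> = ennreal r" "0 \<le> r"
        by (cases "line_integral \<sigma> \<gamma>") auto
      obtain n where "r < real n" using reals_Archimedean2 by blast
      have "ennreal (real (Suc n)) \<le> ennreal r" using large[of n] r by simp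
      then have "real (Suc n) \<le> r" using r by (subst (asm) ennreal_le_iff) auto
      with \<open>r < real n\<close> show False by simp
    qed
  qed
  ultimately show "\<exists>\<rho>\<in>Lp_densities p \<mu>. \<forall>\<gamma>\<in>\<Gamma>. line_integral \<rho> \<gamma> = \<infinity>" by blast
next
  assume "\<exists>\<rho>\<in>Lp_densities p \<mu>. \<forall>\<gamma>\<in>\<Gamma>. line_integral \<rho> \<gamma> = \<infinity>"
  then obtain \<rho> where \<rho> [measurable]: "\<rho> \<in> borel_measurable borel"
    and fin: "(\<integral>\<^sup>+x. epowr (\<rho> x) p \<partial>\<mu>) < \<infinity>" and inf: "\<And>\<gamma>. \<gamma> \<in> \<Gamma> \<Longrightarrow> line_integral \<rho> \<gamma> = \<infinity>"
    by (auto simp: Lp_densities_def)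
  have "modulus p \<mu> \<Gamma> \<le> 0 + ennreal e" if e: "0 < e" for e
  proof -
    obtain c where c: "0 < c" "ennreal (c powr p) * (\<integral>\<^sup>+x. epowr (\<rho> x) p \<partial>\<mu>) \<le> ennreal e"
      using ex_small_factor[OF fin e p_pos] .
    have "modulus p \<mu> \<Gamma> \<le> (\<integral>\<^sup>+x. epowr (ennreal c * \<rho> x) p \<partial>\<mu>)"
      unfolding modulus_def
    proof (rule INF_lower, safe)
      fix \<gamma> assume \<gamma>: "\<gamma> \<in> \<Gamma>"
      then have "line_integral (\<lambda>x. ennreal c * \<rho> x) \<gamma> = ennreal c * line_integral \<rho> \<gamma>"
        using \<Gamma> by (intro line_integral_cmult[of _ \<Omega>]) auto
      then show "1 \<le> line_integral (\<lambda>x. ennreal c * \<rho> x) \<gamma>"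
        using inf[OF \<gamma>] c by (simp add: ennreal_mult_top)
    qed measurable
    also have "\<dots> = (\<integral>\<^sup>+x. ennreal (c powr p) * epowr (\<rho> x) p \<partial>\<mu>)"
      using c p_pos by (simp add: epowr_mult)
    also have "\<dots> = ennreal (c powr p) * (\<integral>\<^sup>+x. epowr (\<rho> x) p \<partial>\<mu>)"
      by (intro nn_integral_cmult) measurable
    finally show ?thesis using c(2) by simp
  qed
  then have "modulus p \<mu> \<Gamma> \<le> 0" by (rule ennreal_le_epsilon)
  then show "modulus p \<mu> \<Gamma> = 0" unfolding le_zero_eq .
qed

text \<open>In contrast to membership in a family of modulus zero, finiteness of the integral of \<open>\<rho>\<close> passes from
  a path to its subpaths.\<close>

lemma weak_upper_gradient_iff:
  "weak_upper_gradient p \<mu> \<Omega> u g \<longleftrightarrow> g \<in> borel_measurable (restrict_space borel \<Omega>) \<and>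
     (\<exists>\<rho>\<in>Lp_densities p \<mu>. \<forall>\<gamma>\<in>rectifiable_paths \<Omega>. line_integral \<rho> \<gamma> < \<infinity> \<longrightarrow> ug_inequality u g \<gamma>)"
proof -
  have "(\<exists>\<Gamma> \<subseteq> rectifiable_paths \<Omega>. modulus p \<mu> \<Gamma> = 0 \<and>
        (\<forall>\<gamma> \<in> rectifiable_paths \<Omega> - \<Gamma>. ug_inequality u g \<gamma>))
    \<longleftrightarrow> (\<exists>\<rho>\<in>Lp_densities p \<mu>. \<forall>\<gamma>\<in>rectifiable_paths \<Omega>. line_integral \<rho> \<gamma> < \<infinity> \<longrightarrow> ug_inequality u g \<gamma>)"
    (is "?L \<longleftrightarrow> ?R")
  proof
    assume ?L
    then obtain \<Gamma> where \<Gamma>: "\<Gamma> \<subseteq> rectifiable_paths \<Omega>" "modulus p \<mu> \<Gamma> = 0"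
      "\<And>\<gamma>. \<gamma> \<in> rectifiable_paths \<Omega> - \<Gamma> \<Longrightarrow> ug_inequality u g \<gamma>" by blast
    then obtain \<rho> where \<rho>: "\<rho>\<in>Lp_densities p \<mu>" "\<And>\<gamma>. \<gamma>\<in>\<Gamma> \<Longrightarrow> line_integral \<rho> \<gamma> = \<infinity>"
      using modulus_zero_iff[OF \<Gamma>(1)] by auto
    show ?R
    proof (intro bexI[OF _ \<rho>(1)] ballI impI)
      fix \<gamma> assume "\<gamma> \<in> rectifiable_paths \<Omega>" "line_integral \<rho> \<gamma> < \<infinity>"
      with \<rho>(2)[of \<gamma>] show "ug_inequality u g \<gamma>" by (intro \<Gamma>(3)) auto
    qed
  next
    assume ?R
    then obtain \<rho> where \<rho>: "\<rho>\<in>Lp_densities p \<mu>"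
      "\<And>\<gamma>. \<gamma>\<in>rectifiable_paths \<Omega> \<Longrightarrow> line_integral \<rho> \<gamma> < \<infinity> \<Longrightarrow> ug_inequality u g \<gamma>" by blast
    define \<Gamma> where "\<Gamma> = {\<gamma>\<in>rectifiable_paths \<Omega>. line_integral \<rho> \<gamma> = \<infinity>}"
    have sub: "\<Gamma> \<subseteq> rectifiable_paths \<Omega>" by (auto simp: \<Gamma>_def)
    have "\<forall>\<gamma>\<in>\<Gamma>. line_integral \<rho> \<gamma> = \<infinity>" by (auto simp: \<Gamma>_def)
    with \<rho>(1) have "modulus p \<mu> \<Gamma> = 0" unfolding modulus_zero_iff[OF sub] by blast
    moreover have "ug_inequality u g \<gamma>" if "\<gamma> \<in> rectifiable_paths \<Omega> - \<Gamma>" for \<gamma>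
      using that by (intro \<rho>(2)) (auto simp: \<Gamma>_def less_top)
    ultimately show ?L using sub by (intro exI[of _ \<Gamma>] conjI ballI)
  qed
  then show ?thesis by (simp add: weak_upper_gradient_def)
qed

end

section \<open>Weak upper gradients along paths\<close>

text \<open>As \<open>\<bar>\<infinity> - \<infinity>\<bar> = \<infinity>\<close>, a finite bound on the difference forces both values to be finite. On paths
  with finite integrals one can therefore compute with real numbers.\<close>

lemma abs_ereal_diff_le_iff:
  assumes "I < (\<infinity> :: ennreal)"
  shows "\<bar>x - y\<bar> \<le> enn2ereal I \<longleftrightarrow>
    \<bar>x\<bar> \<noteq> \<infinity> \<and> \<bar>y\<bar> \<noteq> \<infinity> \<and> ennreal \<bar>real_of_ereal x - real_of_ereal y\<bar> \<le> I"
proof -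
  obtain r where "I = ennreal r" "0 \<le> r" using assms by (cases I) auto
  then show ?thesis by (cases x; cases y) (auto simp: ennreal_le_iff)
qed

abbreviation zero_ext :: "'a set \<Rightarrow> ('a \<Rightarrow> ennreal) \<Rightarrow> 'a \<Rightarrow> ennreal" where
  "zero_ext \<Omega> g \<equiv> (\<lambda>x. g x * indicator \<Omega> x)"

lemma borel_measurable_zero_ext_iff:
  assumes "\<Omega> \<in> sets borel"
  shows "zero_ext \<Omega> g \<in> borel_measurable borel \<longleftrightarrow> g \<in> borel_measurable (restrict_space borel \<Omega>)"
  using assms by (subst borel_measurable_restrict_space_iff_ennreal) auto

text \<open>The integrals over all subpaths of \<open>\<gamma>\<close> are the values of this measure on subintervals, so that the
  gluing lemmas on the real line apply.\<close>

definition curve_measure ::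
    "('a::metric_space \<Rightarrow> ennreal) \<Rightarrow> (real \<Rightarrow> 'a) \<Rightarrow> real measure" where
  "curve_measure g \<gamma> =
     density lborel (\<lambda>s. g (arclength_param \<gamma> s) * indicator {0..total_length \<gamma>} s)"

lemma sets_curve_measure [simp, measurable_cong]: "sets (curve_measure g \<gamma>) = sets borel"
  by (simp add: curve_measure_def)

context
  fixes \<gamma> :: "real \<Rightarrow> 'a::metric_space" and \<Omega>\<^sub>0 and g :: "'a \<Rightarrow> ennreal"
  assumes \<gamma>: "\<gamma> \<in> rectifiable_paths \<Omega>\<^sub>0" and g: "g \<in> borel_measurable borel"
begin

lemma emeasure_curve_measure:
  assumes "A \<in> sets borel"
  shows "emeasure (curve_measure g \<gamma>) A =
    (\<integral>\<^sup>+s. g (arclength_param \<gamma> s) * indicator {0..total_length \<gamma>} s * indicator A s \<partial>lborel)"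
  unfolding curve_measure_def using borel_measurable_along_path'[OF \<gamma> g] assms
  by (subst emeasure_density) auto

lemma emeasure_curve_measure_UNIV: "emeasure (curve_measure g \<gamma>) UNIV = line_integral g \<gamma>"
  by (simp add: emeasure_curve_measure line_integral_eq)

lemma emeasure_curve_measure_point: "emeasure (curve_measure g \<gamma>) {s} = 0"
proof -
  have "AE t in lborel. t \<noteq> s" by (rule AE_lborel_singleton)
  then have "emeasure (curve_measure g \<gamma>) {s} = (\<integral>\<^sup>+t. 0 \<partial>(lborel :: real measure))"
    by (subst emeasure_curve_measure) (auto intro!: nn_integral_cong_AE)
  then show ?thesis by simp
qed

lemma emeasure_curve_measure_Ioc:
  assumes "0 \<le> a" "b \<le> total_length \<gamma>"
  shows "emeasure (curve_measure g \<gamma>) {a<..b} = (\<integral>\<^sup>+s\<in>{a..b}. g (arclength_param \<gamma> s) \<partial>lborel)"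
proof -
  have "AE t in lborel. t \<noteq> a" by (rule AE_lborel_singleton)
  then show ?thesis using assms
    by (subst emeasure_curve_measure) (auto intro!: nn_integral_cong_AE simp: indicator_def)
qed

lemma emeasure_curve_measure_all:
  "emeasure (curve_measure g \<gamma>) {0<..total_length \<gamma>} = line_integral g \<gamma>"
  by (simp add: emeasure_curve_measure_Ioc line_integral_eq)

end

lemma borel_preimage_along_path:
  assumes \<gamma>: "\<gamma> \<in> rectifiable_paths \<Omega>\<^sub>0" and E: "E \<in> sets borel"
  shows "{s \<in> {0..total_length \<gamma>}. arclength_param \<gamma> s \<in> E} \<in> sets borel"
proof -
  have [measurable]: "(\<lambda>s. indicator E (arclength_param \<gamma> s) * indicator {0..total_length \<gamma>} s :: ennreal)
      \<in> borel_measurable borel"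
    using E by (intro borel_measurable_along_path'[OF \<gamma>]) auto
  have "{s \<in> space borel. indicator E (arclength_param \<gamma> s) * indicator {0..total_length \<gamma>} s = (1 :: ennreal)}
      \<in> sets borel" by measurable
  also have "{s \<in> space borel. indicator E (arclength_param \<gamma> s) * indicator {0..total_length \<gamma>} s = (1 :: ennreal)}
      = {s \<in> {0..total_length \<gamma>}. arclength_param \<gamma> s \<in> E}"
    by (auto simp: indicator_def)
  finally show ?thesis .
qed

lemma emeasure_curve_measure_if:
  assumes \<gamma>: "\<gamma> \<in> rectifiable_paths \<Omega>\<^sub>0" and E [measurable]: "E \<in> sets borel"
    and [measurable]: "g \<in> borel_measurable borel" "h \<in> borel_measurable borel" "A \<in> sets borel"
  defines "B \<equiv> {s \<in> {0..total_length \<gamma>}. arclength_param \<gamma> s \<in> E}"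
  shows "emeasure (curve_measure (\<lambda>x. if x \<in> E then h x else g x) \<gamma>) A
    = emeasure (curve_measure h \<gamma>) (A \<inter> B) + emeasure (curve_measure g \<gamma>) (A - B)"
proof -
  have [measurable]: "B \<in> sets borel" unfolding B_def by (rule borel_preimage_along_path[OF \<gamma> E])
  have [measurable]: "(\<lambda>s. h (arclength_param \<gamma> s) * indicator {0..total_length \<gamma>} s) \<in> borel_measurable borel"
     "(\<lambda>s. g (arclength_param \<gamma> s) * indicator {0..total_length \<gamma>} s) \<in> borel_measurable borel"
    by (auto intro!: borel_measurable_along_path'[OF \<gamma>])
  have "emeasure (curve_measure h \<gamma>) (A \<inter> B) + emeasure (curve_measure g \<gamma>) (A - B)
     = (\<integral>\<^sup>+s. h (arclength_param \<gamma> s) * indicator {0..total_length \<gamma>} s * indicator (A \<inter> B) s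
         + g (arclength_param \<gamma> s) * indicator {0..total_length \<gamma>} s * indicator (A - B) s \<partial>lborel)"
    by (subst (1 2) emeasure_curve_measure[OF \<gamma>]) (auto simp: nn_integral_add)
  also have "\<dots> = emeasure (curve_measure (\<lambda>x. if x \<in> E then h x else g x) \<gamma>) A"
    by (subst emeasure_curve_measure[OF \<gamma>]) (auto intro!: nn_integral_cong simp: indicator_def B_def)
  finally show ?thesis ..
qed

text \<open>The path may leave \<open>\<Omega>\<close>, but only the subintervals that it spends in \<open>\<Omega>\<close> are considered. This allows
  weak upper gradients on different sets to be compared along one path.\<close>

definition increments_bounded_along ::
    "'a::metric_space set \<Rightarrow> ('a \<Rightarrow> ereal) \<Rightarrow> ('a \<Rightarrow> ennreal) \<Rightarrow> (real \<Rightarrow> 'a) \<Rightarrow> bool" where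
  "increments_bounded_along \<Omega> u g \<gamma> \<longleftrightarrow>
     emeasure (curve_measure (zero_ext \<Omega> g) \<gamma>) UNIV < \<infinity> \<and>
     (\<forall>a b. 0 \<le> a \<longrightarrow> a < b \<longrightarrow> b \<le> total_length \<gamma> \<longrightarrow> arclength_param \<gamma> ` {a..b} \<subseteq> \<Omega> \<longrightarrow>
       \<bar>u (arclength_param \<gamma> a)\<bar> \<noteq> \<infinity> \<and> \<bar>u (arclength_param \<gamma> b)\<bar> \<noteq> \<infinity> \<and>
       ennreal \<bar>real_of_ereal (u (arclength_param \<gamma> a)) - real_of_ereal (u (arclength_param \<gamma> b))\<bar>
         \<le> emeasure (curve_measure (zero_ext \<Omega> g) \<gamma>) {a<..b})"

lemma increments_bounded_alongD:
  assumes "increments_bounded_along \<Omega> u g \<gamma>"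
  shows "emeasure (curve_measure (zero_ext \<Omega> g) \<gamma>) UNIV < \<infinity>"
    and "0 \<le> a \<Longrightarrow> a < b \<Longrightarrow> b \<le> total_length \<gamma> \<Longrightarrow> arclength_param \<gamma> ` {a..b} \<subseteq> \<Omega> \<Longrightarrow>
       \<bar>u (arclength_param \<gamma> a)\<bar> \<noteq> \<infinity> \<and> \<bar>u (arclength_param \<gamma> b)\<bar> \<noteq> \<infinity> \<and>
       ennreal \<bar>real_of_ereal (u (arclength_param \<gamma> a)) - real_of_ereal (u (arclength_param \<gamma> b))\<bar>
         \<le> emeasure (curve_measure (zero_ext \<Omega> g) \<gamma>) {a<..b}"
  using assms unfolding increments_bounded_along_def by simp_all

context metric_measure
begin

lemma zero_ext_Lp_density:
  assumes "\<Omega> \<in> sets borel" "g \<in> borel_measurable (restrict_space borel \<Omega>)"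
    and "Lp_integral \<Omega> g < \<infinity>"
  shows "zero_ext \<Omega> g \<in> Lp_densities p \<mu>"
proof -
  have "(\<integral>\<^sup>+x. epowr (zero_ext \<Omega> g x) p \<partial>\<mu>) = Lp_integral \<Omega> g"
    by (intro nn_integral_cong) (auto simp: indicator_def)
  then show ?thesis using assms by (auto simp: Lp_densities_def borel_measurable_zero_ext_iff)
qed

text \<open>The density \<open>\<rho>\<close> detects the exceptional paths of \<open>g\<close> as well as those over which \<open>g\<close> has infinite
  integral. If its integral over a path is finite, then so it is over all subpaths.\<close>

lemma weak_upper_gradient_increments:
  assumes \<Omega>: "\<Omega> \<in> sets borel" and wug: "weak_upper_gradient p \<mu> \<Omega> u g"
    and fin: "Lp_integral \<Omega> g < \<infinity>"
  obtains \<rho> where "\<rho> \<in> Lp_densities p \<mu>"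
    "\<And>\<gamma> \<Omega>\<^sub>0. \<gamma> \<in> rectifiable_paths \<Omega>\<^sub>0 \<Longrightarrow> line_integral \<rho> \<gamma> < \<infinity> \<Longrightarrow>
       increments_bounded_along \<Omega> u g \<gamma>"
proof -
  obtain \<rho>\<^sub>0 where \<rho>\<^sub>0: "\<rho>\<^sub>0 \<in> Lp_densities p \<mu>"
    "\<And>\<gamma>. \<gamma> \<in> rectifiable_paths \<Omega> \<Longrightarrow> line_integral \<rho>\<^sub>0 \<gamma> < \<infinity> \<Longrightarrow> ug_inequality u g \<gamma>"
    and g: "g \<in> borel_measurable (restrict_space borel \<Omega>)"
    using wug by (auto simp: weak_upper_gradient_iff)
  have ext [measurable]: "zero_ext \<Omega> g \<in> borel_measurable borel"
    using g \<Omega> by (simp add: borel_measurable_zero_ext_iff)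
  obtain \<rho> where \<rho>: "\<rho> \<in> Lp_densities p \<mu>"
    "\<And>\<gamma> \<Omega>\<^sub>0. \<gamma> \<in> rectifiable_paths \<Omega>\<^sub>0 \<Longrightarrow> line_integral \<rho> \<gamma> < \<infinity> \<Longrightarrow>
      line_integral \<rho>\<^sub>0 \<gamma> < \<infinity> \<and> line_integral (zero_ext \<Omega> g) \<gamma> < \<infinity>"
    using ex_common_density2[OF \<rho>\<^sub>0(1) zero_ext_Lp_density[OF \<Omega> g fin]] by blast
  show thesis
  proof (rule that[OF \<rho>(1)])
    fix \<gamma> \<Omega>\<^sub>0 assume \<gamma>: "\<gamma> \<in> rectifiable_paths \<Omega>\<^sub>0" "line_integral \<rho> \<gamma> < \<infinity>"
    show "increments_bounded_along \<Omega> u g \<gamma>"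
      unfolding increments_bounded_along_def
    proof (intro conjI[of "_ < _"] allI impI)
      show finite: "emeasure (curve_measure (zero_ext \<Omega> g) \<gamma>) UNIV < \<infinity>"
        using \<rho>(2)[OF \<gamma>] by (simp add: emeasure_curve_measure_UNIV[OF \<gamma>(1)])
      fix a b assume ab: "0 \<le> a" "a < b" "b \<le> total_length \<gamma>" and im: "arclength_param \<gamma> ` {a..b} \<subseteq> \<Omega>"
      obtain \<sigma> where \<sigma>: "\<sigma> \<in> rectifiable_paths \<Omega>" and ends: "pathstart \<sigma> = arclength_param \<gamma> a"
        "pathfinish \<sigma> = arclength_param \<gamma> b" and len: "total_length \<sigma> = b - a"
        and par: "\<And>s. s \<in> {0..b - a} \<Longrightarrow> arclength_param \<sigma> s = arclength_param \<gamma> (a + s)"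
        using rectifiable_subpath[OF \<gamma>(1) ab im] by blast
      have \<gamma>U: "\<gamma> \<in> rectifiable_paths UNIV" using \<gamma> rectifiable_paths_mono[of \<Omega>\<^sub>0 UNIV] by auto
      have sub: "line_integral f \<sigma> = emeasure (curve_measure f \<gamma>) {a<..b}" if "f \<in> borel_measurable borel" for f
        using line_integral_subpath[OF \<gamma>U _ ab len par, of f] emeasure_curve_measure_Ioc[OF \<gamma>(1) that ab(1,3)]
          that by simp
      have "line_integral \<rho>\<^sub>0 \<sigma> \<le> line_integral \<rho>\<^sub>0 \<gamma>"
        using \<rho>\<^sub>0(1) \<gamma>(1) by (simp add: sub Lp_densities_def emeasure_mono flip: emeasure_curve_measure_UNIV)
      then have "line_integral \<rho>\<^sub>0 \<sigma> < \<infinity>" using \<rho>(2)[OF \<gamma>] by (simp add: le_less_trans)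
      then have ug: "ug_inequality u g \<sigma>" by (rule \<rho>\<^sub>0(2)[OF \<sigma>])
      have "line_integral g \<sigma> = line_integral (zero_ext \<Omega> g) \<sigma>"
        unfolding line_integral_eq using arclength_param_in[OF \<sigma>]
        by (intro nn_integral_cong) (auto simp: indicator_def)
      also have "\<dots> = emeasure (curve_measure (zero_ext \<Omega> g) \<gamma>) {a<..b}" by (rule sub[OF ext])
      finally have *: "line_integral g \<sigma> = emeasure (curve_measure (zero_ext \<Omega> g) \<gamma>) {a<..b}" .
      moreover have "\<dots> \<le> emeasure (curve_measure (zero_ext \<Omega> g) \<gamma>) UNIV" by (intro emeasure_mono) auto
      ultimately have small: "line_integral g \<sigma> < \<infinity>" using finite by (simp add: le_less_trans)
      show "\<bar>u (arclength_param \<gamma> a)\<bar> \<noteq> \<infinity> \<and> \<bar>u (arclength_param \<gamma> b)\<bar> \<noteq> \<infinity> \<and>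
         ennreal \<bar>real_of_ereal (u (arclength_param \<gamma> a)) - real_of_ereal (u (arclength_param \<gamma> b))\<bar>
           \<le> emeasure (curve_measure (zero_ext \<Omega> g) \<gamma>) {a<..b}"
        using iffD1[OF abs_ereal_diff_le_iff[OF small] ug[unfolded ug_inequality_def]]
        unfolding ends * .
    qed
  qed
qed

lemma ex_density_increments_bounded2:
  assumes "\<Omega> \<in> sets borel" "weak_upper_gradient p \<mu> \<Omega> u g" "Lp_integral \<Omega> g < \<infinity>"
    and "\<Omega>' \<in> sets borel" "weak_upper_gradient p \<mu> \<Omega>' w h" "Lp_integral \<Omega>' h < \<infinity>"
  obtains \<rho> where "\<rho> \<in> Lp_densities p \<mu>"
    "\<And>\<gamma> \<Omega>\<^sub>0. \<gamma> \<in> rectifiable_paths \<Omega>\<^sub>0 \<Longrightarrow> line_integral \<rho> \<gamma> < \<infinity> \<Longrightarrow>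
       increments_bounded_along \<Omega> u g \<gamma> \<and> increments_bounded_along \<Omega>' w h \<gamma>"
proof -
  obtain \<rho>g where \<rho>g: "\<rho>g \<in> Lp_densities p \<mu>"
    "\<And>\<gamma> \<Omega>\<^sub>0. \<gamma> \<in> rectifiable_paths \<Omega>\<^sub>0 \<Longrightarrow> line_integral \<rho>g \<gamma> < \<infinity> \<Longrightarrow> increments_bounded_along \<Omega> u g \<gamma>"
    using weak_upper_gradient_increments[OF assms(1-3)] by blast
  obtain \<rho>h where \<rho>h: "\<rho>h \<in> Lp_densities p \<mu>"
    "\<And>\<gamma> \<Omega>\<^sub>0. \<gamma> \<in> rectifiable_paths \<Omega>\<^sub>0 \<Longrightarrow> line_integral \<rho>h \<gamma> < \<infinity> \<Longrightarrow> increments_bounded_along \<Omega>' w h \<gamma>"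
    using weak_upper_gradient_increments[OF assms(4-6)] by blast
  obtain \<rho> where \<rho>: "\<rho> \<in> Lp_densities p \<mu>"
    "\<And>\<gamma> \<Omega>\<^sub>0. \<gamma> \<in> rectifiable_paths \<Omega>\<^sub>0 \<Longrightarrow> line_integral \<rho> \<gamma> < \<infinity> \<Longrightarrow>
      line_integral \<rho>g \<gamma> < \<infinity> \<and> line_integral \<rho>h \<gamma> < \<infinity>"
    using ex_common_density2[OF \<rho>g(1) \<rho>h(1)] by blast
  show thesis
    using \<rho>g(2) \<rho>h(2) \<rho>(2) by (intro that[OF \<rho>(1)]) blast
qed

lemma weak_upper_gradientI:
  assumes \<Omega>: "\<Omega> \<in> sets borel" and k: "k \<in> borel_measurable (restrict_space borel \<Omega>)"
    and \<rho>: "\<rho> \<in> Lp_densities p \<mu>"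
    and incr: "\<And>\<gamma>. \<gamma> \<in> rectifiable_paths \<Omega> \<Longrightarrow> line_integral \<rho> \<gamma> < \<infinity> \<Longrightarrow>
       \<bar>u (arclength_param \<gamma> 0)\<bar> \<noteq> \<infinity> \<and> \<bar>u (arclength_param \<gamma> (total_length \<gamma>))\<bar> \<noteq> \<infinity> \<and>
       ennreal \<bar>real_of_ereal (u (arclength_param \<gamma> 0)) - real_of_ereal (u (arclength_param \<gamma> (total_length \<gamma>)))\<bar>
         \<le> emeasure (curve_measure (zero_ext \<Omega> k) \<gamma>) {0<..total_length \<gamma>}"
  shows "weak_upper_gradient p \<mu> \<Omega> u k"
  unfolding weak_upper_gradient_iff
proof (intro conjI k bexI[OF _ \<rho>] ballI impI)
  fix \<gamma> assume \<gamma>: "\<gamma> \<in> rectifiable_paths \<Omega>" "line_integral \<rho> \<gamma> < \<infinity>"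
  have "line_integral k \<gamma> = line_integral (zero_ext \<Omega> k) \<gamma>"
    unfolding line_integral_eq using arclength_param_in[OF \<gamma>(1)]
    by (intro nn_integral_cong) (auto simp: indicator_def)
  also have "\<dots> = emeasure (curve_measure (zero_ext \<Omega> k) \<gamma>) {0<..total_length \<gamma>}"
    using k \<Omega> by (subst emeasure_curve_measure_all[OF \<gamma>(1)]) (auto simp: borel_measurable_zero_ext_iff)
  finally have *: "line_integral k \<gamma> = emeasure (curve_measure (zero_ext \<Omega> k) \<gamma>) {0<..total_length \<gamma>}" .
  show "ug_inequality u k \<gamma>"
  proof (cases "line_integral k \<gamma> < \<infinity>")
    case True
    from abs_ereal_diff_le_iff[OF this] incr[OF \<gamma>] show ?thesis
      by (simp add: ug_inequality_def * arclength_param_0[OF \<gamma>(1)] arclength_param_total[OF \<gamma>(1)])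
  next
    case False
    then have "line_integral k \<gamma> = top" using less_top by fastforce
    then show ?thesis by (simp add: ug_inequality_def enn2ereal_top)
  qed
qed

text \<open>A piece of a path that is shorter than \<open>\<delta>\<close> either misses \<open>E\<close>, and then the bound by \<open>g\<close> is enough, or
  it stays in \<open>\<Omega>'\<close>, where both bounds are available and can be glued. Bounds on short pieces add up.
  For \<open>\<Omega>' = \<Omega>\<close> this yields minima of weak upper gradients; smaller sets \<open>\<Omega>'\<close> yield locality in \<open>\<Omega>\<close>.\<close>

lemma weak_upper_gradient_glue:
  assumes \<Omega> [measurable]: "\<Omega> \<in> sets borel" and \<Omega>' [measurable]: "\<Omega>' \<in> sets borel" and sub: "\<Omega>' \<subseteq> \<Omega>"
    and E [measurable]: "E \<in> sets borel" and E\<Omega>': "E \<subseteq> \<Omega>'"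
    and \<delta>: "0 < \<delta>" and margin: "\<And>x. x \<in> E \<Longrightarrow> ball x \<delta> \<inter> \<Omega> \<subseteq> \<Omega>'"
    and g: "weak_upper_gradient p \<mu> \<Omega> u g" "Lp_integral \<Omega> g < \<infinity>"
    and h: "weak_upper_gradient p \<mu> \<Omega>' u h" "Lp_integral \<Omega>' h < \<infinity>"
  shows "weak_upper_gradient p \<mu> \<Omega> u (\<lambda>x. if x \<in> E then h x else g x)"
proof -
  let ?k = "\<lambda>x. if x \<in> E then h x else g x"
  obtain \<rho> where \<rho>: "\<rho> \<in> Lp_densities p \<mu>"
    "\<And>\<gamma> \<Omega>\<^sub>0. \<gamma> \<in> rectifiable_paths \<Omega>\<^sub>0 \<Longrightarrow> line_integral \<rho> \<gamma> < \<infinity> \<Longrightarrow>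
       increments_bounded_along \<Omega> u g \<gamma> \<and> increments_bounded_along \<Omega>' u h \<gamma>"
    using ex_density_increments_bounded2[OF \<Omega> g \<Omega>' h] by blast
  have ext [measurable]: "zero_ext \<Omega> g \<in> borel_measurable borel" "zero_ext \<Omega>' h \<in> borel_measurable borel"
    using g(1) h(1) by (auto simp: borel_measurable_zero_ext_iff weak_upper_gradient_def)
  have k_ext: "zero_ext \<Omega> ?k = (\<lambda>x. if x \<in> E then zero_ext \<Omega>' h x else zero_ext \<Omega> g x)"
    using E\<Omega>' sub by (auto simp: indicator_def fun_eq_iff)
  have "zero_ext \<Omega> ?k \<in> borel_measurable borel" unfolding k_ext by measurable
  then have k: "?k \<in> borel_measurable (restrict_space borel \<Omega>)"
    using \<Omega> by (simp add: borel_measurable_zero_ext_iff)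
  show ?thesis
  proof (rule weak_upper_gradientI[OF \<Omega> k \<rho>(1)])
    fix \<gamma> assume \<gamma>: "\<gamma> \<in> rectifiable_paths \<Omega>" and "line_integral \<rho> \<gamma> < \<infinity>"
    then have bg: "increments_bounded_along \<Omega> u g \<gamma>" and bh: "increments_bounded_along \<Omega>' u h \<gamma>"
      using \<rho>(2) by auto
    let ?c = "arclength_param \<gamma>" and ?L = "total_length \<gamma>"
    define f where "f s = real_of_ereal (u (?c s))" for s
    define M where "M = curve_measure (zero_ext \<Omega>' h) \<gamma>"
    define N where "N = curve_measure (zero_ext \<Omega> g) \<gamma>"
    define R where "R = curve_measure (zero_ext \<Omega> ?k) \<gamma>"
    define B where "B = {s \<in> {0..?L}. ?c s \<in> E}"
    have sets: "sets M = sets borel" "sets N = sets borel" "sets R = sets borel"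
      by (auto simp: M_def N_def R_def)
    have B [measurable]: "B \<in> sets borel" unfolding B_def by (rule borel_preimage_along_path[OF \<gamma> E])
    have R: "emeasure R A = emeasure M (A \<inter> B) + emeasure N (A - B)" if "A \<in> sets borel" for A
      unfolding R_def M_def N_def B_def k_ext using that
      by (intro emeasure_curve_measure_if[OF \<gamma> E]) auto
    have in_\<Omega>: "?c ` {a..b} \<subseteq> \<Omega>" if "0 \<le> a" "b \<le> ?L" for a b
      using arclength_param_in[OF \<gamma>] that by auto
    have N: "ennreal \<bar>f a - f b\<bar> \<le> emeasure N {a<..b}" if "0 \<le> a" "a < b" "b \<le> ?L" for a b
      using increments_bounded_alongD(2)[OF bg that] in_\<Omega> that by (auto simp: f_def N_def)
    have short: "ennreal \<bar>f a - f b\<bar> \<le> emeasure R {a<..b}"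
      if ab: "0 \<le> a" "a < b" "b \<le> ?L" and small: "b - a \<le> \<delta> / 2" for a b
    proof (cases "{a..b} \<inter> B = {}")
      case True
      then have "{a<..b} \<inter> B = {}" "{a<..b} - B = {a<..b}" by (auto simp: disjoint_iff)
      then show ?thesis using N[OF ab] by (simp add: R)
    next
      case False
      then obtain s where s: "s \<in> {a..b}" "?c s \<in> E" unfolding B_def by blast
      have in_\<Omega>': "?c t \<in> \<Omega>'" if t: "t \<in> {a..b}" for t
      proof -
        have "dist (?c s) (?c t) \<le> 1 * dist s t"
          using lipschitz_onD[OF arclength_param_lipschitz[OF \<gamma>]] s t ab by auto
        also have "\<dots> < \<delta>" using s t small \<delta> by (auto simp: dist_real_def)
        finally show ?thesis using margin[OF s(2)] arclength_param_in[OF \<gamma>, of t] t ab by auto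
      qed
      have M: "ennreal \<bar>f x - f y\<bar> \<le> emeasure M {x<..y}" if "a \<le> x" "x < y" "y \<le> b" for x y
      proof -
        have "?c ` {x..y} \<subseteq> \<Omega>'" using in_\<Omega>' that by auto
        with increments_bounded_alongD(2)[OF bh, of x y] that ab show ?thesis by (auto simp: f_def M_def)
      qed
      show ?thesis
        unfolding R[of "{a<..b}", simplified]
      proof (rule increment_le_borel_gluing[OF sets(1,2), where lo = a and hi = b])
        show "emeasure M UNIV < \<infinity>" "emeasure N UNIV < \<infinity>"
          using increments_bounded_alongD(1)[OF bg] increments_bounded_alongD(1)[OF bh] by (auto simp: M_def N_def)
        show "emeasure N {x} = 0" for x
          unfolding N_def by (rule emeasure_curve_measure_point[OF \<gamma>]) simp
        show "ennreal \<bar>f x - f y\<bar> \<le> emeasure N {x<..y}" if "a \<le> x" "x < y" "y \<le> b" for x y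
          using that ab by (intro N) auto
      qed (use M ab B in auto)
    qed
    have "ennreal \<bar>f 0 - f ?L\<bar> \<le> emeasure R {0<..?L}"
      by (rule increment_le_measure_of_short[where \<delta> = "\<delta> / 2", OF sets(3) short]) (use \<delta> total_length_pos[OF \<gamma>] in auto)
    moreover have "\<bar>u (?c 0)\<bar> \<noteq> \<infinity> \<and> \<bar>u (?c ?L)\<bar> \<noteq> \<infinity>"
      using increments_bounded_alongD(2)[OF bg, of 0 ?L] in_\<Omega>[of 0 ?L] total_length_pos[OF \<gamma>] by auto
    ultimately show "\<bar>u (?c 0)\<bar> \<noteq> \<infinity> \<and> \<bar>u (?c ?L)\<bar> \<noteq> \<infinity> \<and>
        ennreal \<bar>real_of_ereal (u (?c 0)) - real_of_ereal (u (?c ?L))\<bar>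
          \<le> emeasure (curve_measure (zero_ext \<Omega> ?k) \<gamma>) {0<..?L}"
      by (simp add: f_def R_def)
  qed
qed

text \<open>Between two parameters at which a path meets \<open>Z\<close>, the increment of \<open>u\<close> is the increment of \<open>w\<close> and
  is thus bounded by \<open>h\<close>, although \<open>h\<close> tells nothing about \<open>u\<close> off \<open>Z\<close>.\<close>

lemma weak_upper_gradient_glue_closed:
  assumes \<Omega> [measurable]: "\<Omega> \<in> sets borel"
    and Z: "closedin (top_of_set \<Omega>) Z" and eq: "\<And>x. x \<in> Z \<Longrightarrow> u x = w x"
    and g: "weak_upper_gradient p \<mu> \<Omega> u g" "Lp_integral \<Omega> g < \<infinity>"
    and h: "weak_upper_gradient p \<mu> \<Omega> w h" "Lp_integral \<Omega> h < \<infinity>"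
  shows "weak_upper_gradient p \<mu> \<Omega> u (\<lambda>x. if x \<in> Z then h x else g x)"
proof -
  let ?k = "\<lambda>x. if x \<in> Z then h x else g x"
  have Z_sub: "Z \<subseteq> \<Omega>" using Z closedin_imp_subset by blast
  have Z_borel [measurable]: "Z \<in> sets borel"
    using Z unfolding closedin_closed by auto
  obtain \<rho> where \<rho>: "\<rho> \<in> Lp_densities p \<mu>"
    "\<And>\<gamma> \<Omega>\<^sub>0. \<gamma> \<in> rectifiable_paths \<Omega>\<^sub>0 \<Longrightarrow> line_integral \<rho> \<gamma> < \<infinity> \<Longrightarrow>
       increments_bounded_along \<Omega> u g \<gamma> \<and> increments_bounded_along \<Omega> w h \<gamma>"
    using ex_density_increments_bounded2[OF \<Omega> g \<Omega> h] by blast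
  have ext [measurable]: "zero_ext \<Omega> g \<in> borel_measurable borel" "zero_ext \<Omega> h \<in> borel_measurable borel"
    using g(1) h(1) by (auto simp: borel_measurable_zero_ext_iff weak_upper_gradient_def)
  have k_ext: "zero_ext \<Omega> ?k = (\<lambda>x. if x \<in> Z then zero_ext \<Omega> h x else zero_ext \<Omega> g x)"
    by (auto simp: indicator_def fun_eq_iff)
  have "zero_ext \<Omega> ?k \<in> borel_measurable borel" unfolding k_ext by measurable
  then have k: "?k \<in> borel_measurable (restrict_space borel \<Omega>)"
    using \<Omega> by (simp add: borel_measurable_zero_ext_iff)
  show ?thesis
  proof (rule weak_upper_gradientI[OF \<Omega> k \<rho>(1)])
    fix \<gamma> assume \<gamma>: "\<gamma> \<in> rectifiable_paths \<Omega>" and "line_integral \<rho> \<gamma> < \<infinity>"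
    then have bg: "increments_bounded_along \<Omega> u g \<gamma>" and bh: "increments_bounded_along \<Omega> w h \<gamma>"
      using \<rho>(2) by auto
    let ?c = "arclength_param \<gamma>" and ?L = "total_length \<gamma>"
    define f where "f s = real_of_ereal (u (?c s))" for s
    define M where "M = curve_measure (zero_ext \<Omega> h) \<gamma>"
    define N where "N = curve_measure (zero_ext \<Omega> g) \<gamma>"
    define B where "B = {s \<in> {0..?L}. ?c s \<in> Z}"
    have in_\<Omega>: "?c ` {a..b} \<subseteq> \<Omega>" if "0 \<le> a" "b \<le> ?L" for a b
      using arclength_param_in[OF \<gamma>] that by auto
    have "closedin (top_of_set {0..?L}) ({0..?L} \<inter> ?c -` Z)"
      using lipschitz_on_continuous_on[OF arclength_param_lipschitz[OF \<gamma>]] Z in_\<Omega>[of 0 ?L]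
      by (intro continuous_closedin_preimage_gen) auto
    then have "closed ({0..?L} \<inter> ?c -` Z)" by (rule closedin_closed_trans) simp
    moreover have "{0..?L} \<inter> ?c -` Z = B" by (auto simp: B_def)
    ultimately have closed: "closed B" by simp
    have sets: "sets M = sets borel" "sets N = sets borel" by (auto simp: M_def N_def)
    have N: "ennreal \<bar>f a - f b\<bar> \<le> emeasure N {a<..b}" if "0 \<le> a" "a < b" "b \<le> ?L" for a b
      using increments_bounded_alongD(2)[OF bg that] in_\<Omega> that by (auto simp: f_def N_def)
    have M: "ennreal \<bar>f a - f b\<bar> \<le> emeasure M {a<..b}"
      if "a \<in> B" "b \<in> B" "0 \<le> a" "a < b" "b \<le> ?L" for a b
      using increments_bounded_alongD(2)[OF bh, of a b] in_\<Omega> that eq by (auto simp: f_def M_def B_def)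
    have "ennreal \<bar>f 0 - f ?L\<bar> \<le> emeasure M ({0<..?L} \<inter> B) + emeasure N ({0<..?L} - B)"
    proof (rule increment_le_closed_gluing[OF sets _ _ closed, where lo = 0 and hi = ?L])
      show "emeasure M UNIV < \<infinity>"
        using increments_bounded_alongD(1)[OF bh] by (auto simp: M_def)
      show "emeasure N {x} = 0" for x
        unfolding N_def by (rule emeasure_curve_measure_point[OF \<gamma>]) simp
    qed (use M N total_length_pos[OF \<gamma>] in auto)
    also have "\<dots> = emeasure (curve_measure (zero_ext \<Omega> ?k) \<gamma>) {0<..?L}"
      unfolding M_def N_def B_def k_ext
      by (intro emeasure_curve_measure_if[OF \<gamma> Z_borel, symmetric]) auto
    finally have "ennreal \<bar>f 0 - f ?L\<bar> \<le> emeasure (curve_measure (zero_ext \<Omega> ?k) \<gamma>) {0<..?L}" .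
    moreover have "\<bar>u (?c 0)\<bar> \<noteq> \<infinity> \<and> \<bar>u (?c ?L)\<bar> \<noteq> \<infinity>"
      using increments_bounded_alongD(2)[OF bg, of 0 ?L] in_\<Omega>[of 0 ?L] total_length_pos[OF \<gamma>] by auto
    ultimately show "\<bar>u (?c 0)\<bar> \<noteq> \<infinity> \<and> \<bar>u (?c ?L)\<bar> \<noteq> \<infinity> \<and>
        ennreal \<bar>real_of_ereal (u (?c 0)) - real_of_ereal (u (?c ?L))\<bar>
          \<le> emeasure (curve_measure (zero_ext \<Omega> ?k) \<gamma>) {0<..?L}"
      by (simp add: f_def)
  qed
qed

end

section \<open>Minimal weak upper gradients\<close>

context metric_measure
begin

lemma weak_upper_gradient_cong:
  assumes "\<And>x. x \<in> \<Omega> \<Longrightarrow> g x = g' x"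
  shows "weak_upper_gradient p \<mu> \<Omega> u g \<longleftrightarrow> weak_upper_gradient p \<mu> \<Omega> u g'"
proof -
  have "g \<in> borel_measurable (restrict_space borel \<Omega>) \<longleftrightarrow> g' \<in> borel_measurable (restrict_space borel \<Omega>)"
    using assms by (intro measurable_cong) (auto simp: space_restrict_space)
  moreover have "line_integral g \<gamma> = line_integral g' \<gamma>" if "\<gamma> \<in> rectifiable_paths \<Omega>" for \<gamma>
    unfolding line_integral_eq using arclength_param_in[OF that] assms
    by (intro nn_integral_cong) (auto simp: indicator_def)
  ultimately show ?thesis by (simp add: weak_upper_gradient_iff ug_inequality_def cong: ball_cong)
qed

lemma weak_upper_gradient_subset:
  assumes "weak_upper_gradient p \<mu> \<Omega> u g" "\<Omega>' \<subseteq> \<Omega>"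
  shows "weak_upper_gradient p \<mu> \<Omega>' u g"
proof -
  have "g \<in> borel_measurable (restrict_space borel \<Omega>')"
    using assms by (intro measurable_restrict_mono[OF _ assms(2)]) (auto simp: weak_upper_gradient_iff)
  with assms(1) rectifiable_paths_mono[OF assms(2)] show ?thesis
    unfolding weak_upper_gradient_iff by blast
qed

lemma Lp_integral_mono:
  assumes "\<And>x. x \<in> \<Omega>' \<Longrightarrow> x \<in> \<Omega> \<and> g x \<le> h x"
  shows "Lp_integral \<Omega>' g \<le> Lp_integral \<Omega> h"
  using assms by (intro nn_integral_mono) (auto simp: indicator_def intro: epowr_mono[OF p_pos])

lemma weak_upper_gradient_min:
  assumes \<Omega> [measurable]: "\<Omega> \<in> sets borel"
    and g: "weak_upper_gradient p \<mu> \<Omega> u g" "Lp_integral \<Omega> g < \<infinity>"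
    and h: "weak_upper_gradient p \<mu> \<Omega> u h" "Lp_integral \<Omega> h < \<infinity>"
  shows "weak_upper_gradient p \<mu> \<Omega> u (\<lambda>x. min (g x) (h x))"
proof -
  define E where "E = {x \<in> \<Omega>. zero_ext \<Omega> h x \<le> zero_ext \<Omega> g x}"
  have [measurable]: "zero_ext \<Omega> g \<in> borel_measurable borel" "zero_ext \<Omega> h \<in> borel_measurable borel"
    using g(1) h(1) by (auto simp: borel_measurable_zero_ext_iff weak_upper_gradient_def)
  have "{x \<in> space borel. x \<in> \<Omega> \<and> zero_ext \<Omega> h x \<le> zero_ext \<Omega> g x} \<in> sets borel" by measurable
  then have E: "E \<in> sets borel" by (simp add: E_def)
  have eq: "(if x \<in> E then h x else g x) = min (g x) (h x)" if "x \<in> \<Omega>" for x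
    using that by (auto simp: E_def min_def)
  have "weak_upper_gradient p \<mu> \<Omega> u (\<lambda>x. if x \<in> E then h x else g x)"
    by (rule weak_upper_gradient_glue[where \<delta> = 1 and \<Omega>' = \<Omega>, OF \<Omega> \<Omega> _ E _ _ _ g h]) (auto simp: E_def)
  moreover have "weak_upper_gradient p \<mu> \<Omega> u (\<lambda>x. if x \<in> E then h x else g x)
      \<longleftrightarrow> weak_upper_gradient p \<mu> \<Omega> u (\<lambda>x. min (g x) (h x))"
    by (rule weak_upper_gradient_cong) (rule eq)
  ultimately show ?thesis by (simp only:)
qed

text \<open>Along a path over which \<open>g 0\<close> has finite integral, the integrals of the decreasing sequence converge
  to the integral of the limit.\<close>

lemma weak_upper_gradient_INF:
  fixes g :: "nat \<Rightarrow> 'a \<Rightarrow> ennreal"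
  assumes \<Omega> [measurable]: "\<Omega> \<in> sets borel"
    and g: "\<And>n. weak_upper_gradient p \<mu> \<Omega> u (g n)" and fin: "Lp_integral \<Omega> (g 0) < \<infinity>"
    and dec: "\<And>n x. g (Suc n) x \<le> g n x"
  shows "weak_upper_gradient p \<mu> \<Omega> u (\<lambda>x. INF n. g n x)"
proof -
  have meas: "g n \<in> borel_measurable (restrict_space borel \<Omega>)" for n
    using g[of n] by (simp add: weak_upper_gradient_iff)
  have "\<exists>\<rho>\<in>Lp_densities p \<mu>. \<forall>\<gamma>\<in>rectifiable_paths \<Omega>. line_integral \<rho> \<gamma> < \<infinity> \<longrightarrow> ug_inequality u (g n) \<gamma>" for n
    using g[of n] by (simp add: weak_upper_gradient_iff)
  then obtain \<rho> where \<rho>: "\<And>n. \<rho> n \<in> Lp_densities p \<mu>"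
    "\<And>n \<gamma>. \<gamma> \<in> rectifiable_paths \<Omega> \<Longrightarrow> line_integral (\<rho> n) \<gamma> < \<infinity> \<Longrightarrow> ug_inequality u (g n) \<gamma>"
    by metis
  define \<rho>s where "\<rho>s = case_nat (zero_ext \<Omega> (g 0)) \<rho>"
  have "\<rho>s n \<in> Lp_densities p \<mu>" for n
    using \<rho>(1) zero_ext_Lp_density[OF \<Omega> meas fin] by (auto simp: \<rho>s_def split: nat.split)
  then obtain \<sigma> where \<sigma>: "\<sigma> \<in> Lp_densities p \<mu>" "\<And>\<gamma> \<Omega> n. \<gamma> \<in> rectifiable_paths \<Omega> \<Longrightarrow>
      line_integral \<sigma> \<gamma> < \<infinity> \<Longrightarrow> line_integral (\<rho>s n) \<gamma> < \<infinity>"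
    using ex_common_density[of \<rho>s] by blast
  show ?thesis
    unfolding weak_upper_gradient_iff
  proof (intro conjI bexI[OF _ \<sigma>(1)] ballI impI)
    show "(\<lambda>x. INF n. g n x) \<in> borel_measurable (restrict_space borel \<Omega>)"
      using meas by measurable
    fix \<gamma> assume \<gamma>: "\<gamma> \<in> rectifiable_paths \<Omega>" "line_integral \<sigma> \<gamma> < \<infinity>"
    have ug: "ug_inequality u (g n) \<gamma>" for n
      using \<sigma>(2)[OF \<gamma>, of "Suc n"] by (intro \<rho>(2)[OF \<gamma>(1)]) (simp add: \<rho>s_def)
    have "line_integral (g 0) \<gamma> = line_integral (zero_ext \<Omega> (g 0)) \<gamma>"
      unfolding line_integral_eq using arclength_param_in[OF \<gamma>(1)]
      by (intro nn_integral_cong) (auto simp: indicator_def)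
    then have fin0: "line_integral (g 0) \<gamma> < \<infinity>"
      using \<sigma>(2)[OF \<gamma>, of 0] by (simp add: \<rho>s_def)
    have dec0: "g n x \<le> g 0 x" for n x
      by (induction n) (auto intro: order_trans[OF dec])
    define f where "f n s = g n (arclength_param \<gamma> s) * indicator {0..total_length \<gamma>} s" for n s
    have "line_integral (\<lambda>x. INF n. g n x) \<gamma> = (\<integral>\<^sup>+s. (INF n. f n s) \<partial>lborel)"
      unfolding line_integral_eq f_def by (intro nn_integral_cong) (auto simp: indicator_def)
    also have "\<dots> = (INF n. integral\<^sup>N lborel (f n))"
    proof (rule nn_integral_monotone_convergence_INF_decseq)
      show "decseq f"
        by (intro decseq_SucI le_funI) (auto simp: f_def intro: mult_right_mono dec)
      show "f n \<in> borel_measurable lborel" for n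
        using borel_measurable_along_path[OF \<gamma>(1) meas[of n]] by (simp add: f_def[abs_def])
      show "(\<integral>\<^sup>+s. f 0 s \<partial>lborel) < \<infinity>" using fin0 by (simp add: f_def[abs_def] line_integral_eq)
    qed
    finally have INF: "line_integral (\<lambda>x. INF n. g n x) \<gamma> = (INF n. line_integral (g n) \<gamma>)"
      by (simp add: f_def[abs_def] line_integral_eq)
    have fin_n: "line_integral (g n) \<gamma> < \<infinity>" for n
      using line_integral_mono[of "g n" "g 0" \<gamma>] dec0 fin0 by (auto intro: le_less_trans)
    have fin_INF: "(INF n. line_integral (g n) \<gamma>) < \<infinity>"
      using fin0 by (rule le_less_trans[rotated]) (auto intro: INF_lower)
    show "ug_inequality u (\<lambda>x. INF n. g n x) \<gamma>"
      using ug unfolding ug_inequality_def INF abs_ereal_diff_le_iff[OF fin_n] abs_ereal_diff_le_iff[OF fin_INF]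
      by (auto intro: INF_greatest)
  qed
qed

lemma minimal_weak_upper_gradient_iff:
  "minimal_weak_upper_gradient p \<mu> \<Omega> u g \<longleftrightarrow>
     weak_upper_gradient p \<mu> \<Omega> u g \<and> Lp_integral \<Omega> g < \<infinity> \<and>
     (\<forall>h. weak_upper_gradient p \<mu> \<Omega> u h \<and> Lp_integral \<Omega> h < \<infinity> \<longrightarrow>
        (AE x in \<mu>. x \<in> \<Omega> \<longrightarrow> g x \<le> h x))"
  unfolding minimal_weak_upper_gradient_def Lp_norm_less_top_iff[OF p_pos] ..

text \<open>Minimise the energy. Taking minima turns a minimising sequence into a decreasing one, and its limit
  \<open>h\<close> attains the infimum. If some \<open>h'\<close> were smaller than \<open>h\<close> on a set of positive measure, then
  \<open>min h h'\<close> would have less energy than \<open>h\<close>.\<close>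

lemma ex_minimal_weak_upper_gradient:
  assumes \<Omega> [measurable]: "\<Omega> \<in> sets borel"
    and g\<^sub>0: "weak_upper_gradient p \<mu> \<Omega> u g\<^sub>0" "Lp_integral \<Omega> g\<^sub>0 < \<infinity>"
  shows "\<exists>g. minimal_weak_upper_gradient p \<mu> \<Omega> u g"
proof -
  define I where "I g = Lp_integral \<Omega> g" for g
  define G where "G = {g. weak_upper_gradient p \<mu> \<Omega> u g \<and> I g < \<infinity>}"
  define i where "i = (INF g\<in>G. I g)"
  have i_le: "i \<le> I g" if "g \<in> G" for g unfolding i_def using that by (rule INF_lower)
  have "g\<^sub>0 \<in> G" using g\<^sub>0 by (simp add: G_def I_def)
  then have i_fin: "i < \<infinity>" using i_le[of g\<^sub>0] by (auto simp: G_def intro: le_less_trans)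
  have "\<exists>k\<in>G. I k < i + ennreal (1 / Suc n)" for n
  proof -
    have "i + 0 < i + ennreal (1 / Suc n)"
      using i_fin by (subst ennreal_add_left_cancel_less) auto
    then show ?thesis unfolding i_def[symmetric] using INF_less_iff[of I G] by (simp add: i_def)
  qed
  then obtain k where k: "\<And>n. k n \<in> G" "\<And>n. I (k n) < i + ennreal (1 / Suc n)" by metis
  define g where "g n x = (INF m\<in>{..n}. k m x)" for n :: nat and x
  have g_Suc: "g (Suc n) x = min (g n x) (k (Suc n) x)" for n x
    by (simp add: g_def atMost_Suc inf_min min.commute)
  have gG: "g n \<in> G" for n
  proof (induction n)
    case 0
    have "g 0 = k 0" by (simp add: g_def fun_eq_iff)
    then show ?case using k(1) by simp
  next
    case (Suc n)
    have "g (Suc n) = (\<lambda>x. min (g n x) (k (Suc n) x))" by (simp add: g_Suc fun_eq_iff)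
    moreover have "weak_upper_gradient p \<mu> \<Omega> u (\<lambda>x. min (g n x) (k (Suc n) x))"
      using Suc k(1)[of "Suc n"] by (intro weak_upper_gradient_min[OF \<Omega>]) (auto simp: G_def I_def)
    moreover have "I (\<lambda>x. min (g n x) (k (Suc n) x)) \<le> I (g n)"
      unfolding I_def by (rule Lp_integral_mono) auto
    ultimately show ?case using Suc by (auto simp: G_def intro: le_less_trans)
  qed
  define h where "h x = (INF n. g n x)" for x
  have h_le: "h x \<le> k n x" for n x
    unfolding h_def by (rule INF_lower2[of n]) (auto simp: g_def intro: INF_lower)
  have wug_h: "weak_upper_gradient p \<mu> \<Omega> u h"
    unfolding h_def
    using gG by (intro weak_upper_gradient_INF[OF \<Omega>]) (auto simp: G_def I_def g_Suc)
  have "I h \<le> i + 0"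
  proof (rule ennreal_le_epsilon)
    fix e :: real assume "0 < e"
    then obtain n where n: "1 / Suc n < e" using nat_approx_posE by blast
    have "I h \<le> I (k n)" unfolding I_def using h_le by (intro Lp_integral_mono) auto
    also have "\<dots> \<le> i + ennreal (1 / Suc n)" using k(2)[of n] by simp
    also have "\<dots> \<le> i + ennreal e" using n by (intro add_left_mono ennreal_leI) simp
    finally show "I h \<le> i + 0 + ennreal e" by simp
  qed
  then have I_h: "I h \<le> i" by simp
  have "minimal_weak_upper_gradient p \<mu> \<Omega> u h"
    unfolding minimal_weak_upper_gradient_iff
  proof (intro conjI allI impI wug_h)
    show fin_h: "Lp_integral \<Omega> h < \<infinity>"
      using I_h i_fin by (simp add: I_def le_less_trans)
    fix h' assume h': "weak_upper_gradient p \<mu> \<Omega> u h' \<and> Lp_integral \<Omega> h' < \<infinity>"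
    let ?m = "\<lambda>x. min (h x) (h' x)"
    have "weak_upper_gradient p \<mu> \<Omega> u ?m"
      using h' by (intro weak_upper_gradient_min[OF \<Omega> wug_h fin_h]) auto
    moreover have m_le: "I ?m \<le> I h" unfolding I_def by (rule Lp_integral_mono) auto
    ultimately have "?m \<in> G" using fin_h by (auto simp: G_def I_def intro: le_less_trans)
    from I_h i_le[OF this] have h_le_m: "I h \<le> I ?m" by (rule order_trans)
    have [measurable]: "zero_ext \<Omega> h \<in> borel_measurable borel" "zero_ext \<Omega> h' \<in> borel_measurable borel"
      using wug_h h' by (auto simp: borel_measurable_zero_ext_iff weak_upper_gradient_def)
    let ?F = "\<lambda>x. epowr (min (zero_ext \<Omega> h x) (zero_ext \<Omega> h' x)) p" and ?H = "\<lambda>x. epowr (zero_ext \<Omega> h x) p"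
    have F: "I ?m = integral\<^sup>N \<mu> ?F" and H: "I h = integral\<^sup>N \<mu> ?H"
      unfolding I_def by (intro nn_integral_cong; auto simp: indicator_def)+
    have "AE x in \<mu>. ?H x \<le> ?F x"
    proof (rule ccontr)
      assume neg: "\<not> (AE x in \<mu>. ?H x \<le> ?F x)"
      have "integral\<^sup>N \<mu> ?F < integral\<^sup>N \<mu> ?H"
      proof (rule nn_integral_less)
        show "integral\<^sup>N \<mu> ?F \<noteq> \<infinity>" using m_le fin_h F unfolding I_def by (auto simp: top_unique)
        show "AE x in \<mu>. ?F x \<le> ?H x" by (auto intro!: epowr_mono[OF p_pos])
      qed (use neg in measurable)
      with h_le_m show False by (simp add: F H)
    qed
    then show "AE x in \<mu>. x \<in> \<Omega> \<longrightarrow> h x \<le> h' x"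
    proof eventually_elim
      case (elim x)
      have "epowr (zero_ext \<Omega> h x) p = epowr (min (zero_ext \<Omega> h x) (zero_ext \<Omega> h' x)) p"
        using elim epowr_mono[OF p_pos] by (intro antisym) auto
      then have "zero_ext \<Omega> h x = min (zero_ext \<Omega> h x) (zero_ext \<Omega> h' x)"
        using p_pos by (simp add: epowr_eq_iff)
      then show ?case by (auto simp: min_def split: if_splits)
    qed
  qed
  then show ?thesis by (rule exI[of _ h])
qed

lemma minimal_weak_upper_gradient_unique:
  assumes "minimal_weak_upper_gradient p \<mu> \<Omega> u g" "minimal_weak_upper_gradient p \<mu> \<Omega> u h"
  shows "AE x in \<mu>. x \<in> \<Omega> \<longrightarrow> g x = h x"
proof -
  have "AE x in \<mu>. x \<in> \<Omega> \<longrightarrow> g x \<le> h x" "AE x in \<mu>. x \<in> \<Omega> \<longrightarrow> h x \<le> g x"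
    using assms by (auto simp: minimal_weak_upper_gradient_def)
  then show ?thesis by eventually_elim (auto intro: antisym)
qed

text \<open>A competitor \<open>h\<close> on \<open>\<Omega>'\<close> is glued into \<open>g\<close> on the part of \<open>F m\<close> where it is smaller, and minimality
  on \<open>\<Omega>\<close> gives \<open>g \<le> h\<close> almost everywhere on this part, too. The sets \<open>F m\<close> keep a positive distance from
  the complement of \<open>\<Omega>'\<close>, as gluing requires, and exhaust \<open>\<Omega>'\<close>.\<close>

lemma minimal_weak_upper_gradient_subset:
  assumes \<Omega> [measurable]: "\<Omega> \<in> sets borel" and \<Omega>': "open \<Omega>'" "\<Omega>' \<subseteq> \<Omega>"
    and g: "minimal_weak_upper_gradient p \<mu> \<Omega> u g"
  shows "minimal_weak_upper_gradient p \<mu> \<Omega>' u g"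
  unfolding minimal_weak_upper_gradient_iff
proof (intro conjI allI impI)
  have [measurable]: "\<Omega>' \<in> sets borel" using \<Omega>' by simp
  have g_wug: "weak_upper_gradient p \<mu> \<Omega> u g" and g_fin: "Lp_integral \<Omega> g < \<infinity>"
    and g_min: "\<And>h. weak_upper_gradient p \<mu> \<Omega> u h \<Longrightarrow> Lp_integral \<Omega> h < \<infinity> \<Longrightarrow>
      AE x in \<mu>. x \<in> \<Omega> \<longrightarrow> g x \<le> h x"
    using g by (auto simp: minimal_weak_upper_gradient_iff)
  show "weak_upper_gradient p \<mu> \<Omega>' u g" by (rule weak_upper_gradient_subset[OF g_wug \<Omega>'(2)])
  have "Lp_integral \<Omega>' g \<le> Lp_integral \<Omega> g"
    using \<Omega>' by (intro Lp_integral_mono) auto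
  then show "Lp_integral \<Omega>' g < \<infinity>" using g_fin by (rule le_less_trans)
  fix h assume h: "weak_upper_gradient p \<mu> \<Omega>' u h \<and> Lp_integral \<Omega>' h < \<infinity>"
  have [measurable]: "zero_ext \<Omega> g \<in> borel_measurable borel" "zero_ext \<Omega>' h \<in> borel_measurable borel"
    using g_wug h by (auto simp: borel_measurable_zero_ext_iff weak_upper_gradient_def)
  define F where "F m = {x. ball x (1 / real (Suc m)) \<subseteq> \<Omega>'}" for m
  have F_sub: "F m \<subseteq> \<Omega>'" for m by (auto simp: F_def)
  have [measurable]: "F m \<in> sets borel" for m
  proof -
    have "F m = - (\<Union>y\<in>- \<Omega>'. ball y (1 / real (Suc m)))"
      by (auto simp: F_def subset_eq dist_commute)
    then show ?thesis by (auto intro!: borel_closed)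
  qed
  have "AE x in \<mu>. x \<in> F m \<longrightarrow> g x \<le> h x" for m
  proof -
    define E where "E = {x \<in> F m. zero_ext \<Omega>' h x \<le> zero_ext \<Omega> g x}"
    have "{x \<in> space borel. x \<in> F m \<and> zero_ext \<Omega>' h x \<le> zero_ext \<Omega> g x} \<in> sets borel" by measurable
    then have E: "E \<in> sets borel" by (simp add: E_def)
    have E_sub: "E \<subseteq> \<Omega>'" using F_sub by (auto simp: E_def)
    let ?k = "\<lambda>x. if x \<in> E then h x else g x"
    have "weak_upper_gradient p \<mu> \<Omega> u ?k"
      by (rule weak_upper_gradient_glue[where \<delta> = "1 / real (Suc m)" and \<Omega>' = \<Omega>', OF \<Omega> _ \<Omega>'(2) E E_sub _ _ g_wug g_fin])
        (use h in \<open>auto simp: E_def F_def\<close>)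
    moreover have "Lp_integral \<Omega> ?k \<le> Lp_integral \<Omega> g"
      using E_sub by (intro Lp_integral_mono) (auto simp: E_def indicator_def split: if_splits)
    then have "Lp_integral \<Omega> ?k < \<infinity>" using g_fin by (rule le_less_trans)
    ultimately have "AE x in \<mu>. x \<in> \<Omega> \<longrightarrow> g x \<le> ?k x" by (rule g_min)
    then show ?thesis
    proof eventually_elim
      case (elim x)
      show ?case
      proof
        assume x: "x \<in> F m"
        then have "x \<in> \<Omega>" "x \<in> \<Omega>'" using F_sub \<Omega>' by auto
        with elim x show "g x \<le> h x" by (cases "x \<in> E") (auto simp: E_def)
      qed
    qed
  qed
  then have "AE x in \<mu>. \<forall>m. x \<in> F m \<longrightarrow> g x \<le> h x" unfolding AE_all_countable by (rule allI)
  then show "AE x in \<mu>. x \<in> \<Omega>' \<longrightarrow> g x \<le> h x"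
  proof eventually_elim
    case (elim x)
    show ?case
    proof
      assume "x \<in> \<Omega>'"
      then obtain e where e: "e > 0" "ball x e \<subseteq> \<Omega>'" using \<Omega>'(1) by (meson open_contains_ball)
      then obtain m where "1 / real (Suc m) < e" using nat_approx_posE by blast
      then have "x \<in> F m" using e by (auto simp: F_def)
      with elim show "g x \<le> h x" by blast
    qed
  qed
qed

text \<open>The density that is infinite on the null set where \<open>g\<close> and \<open>g'\<close> differ has energy zero, and it makes
  every path that spends a positive length there exceptional.\<close>

lemma weak_upper_gradient_AE_cong:
  assumes \<Omega> [measurable]: "\<Omega> \<in> sets borel" and g: "weak_upper_gradient p \<mu> \<Omega> u g"
    and g': "g' \<in> borel_measurable (restrict_space borel \<Omega>)"
    and AE: "AE x in \<mu>. x \<in> \<Omega> \<longrightarrow> g x = g' x"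
  shows "weak_upper_gradient p \<mu> \<Omega> u g'"
proof -
  have [measurable]: "zero_ext \<Omega> g \<in> borel_measurable borel" "zero_ext \<Omega> g' \<in> borel_measurable borel"
    using g g' by (auto simp: borel_measurable_zero_ext_iff weak_upper_gradient_def)
  define N where "N = {x. zero_ext \<Omega> g x \<noteq> zero_ext \<Omega> g' x}"
  have "{x \<in> space borel. zero_ext \<Omega> g x \<noteq> zero_ext \<Omega> g' x} \<in> sets borel" by measurable
  then have N [measurable]: "N \<in> sets borel" by (simp add: N_def)
  define \<rho>N :: "'a \<Rightarrow> ennreal" where "\<rho>N x = top * indicator N x" for x
  have "AE x in \<mu>. x \<notin> N" using AE by eventually_elim (auto simp: N_def indicator_def)
  then have "(\<integral>\<^sup>+x. epowr (\<rho>N x) p \<partial>\<mu>) = (\<integral>\<^sup>+x. 0 \<partial>\<mu>)"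
    by (intro nn_integral_cong_AE) (auto elim!: eventually_mono simp: \<rho>N_def)
  moreover have \<rho>N_meas [measurable]: "\<rho>N \<in> borel_measurable borel" unfolding \<rho>N_def by measurable
  ultimately have \<rho>N: "\<rho>N \<in> Lp_densities p \<mu>" by (simp add: Lp_densities_def)
  obtain \<rho> where \<rho>: "\<rho> \<in> Lp_densities p \<mu>"
    "\<And>\<gamma>. \<gamma> \<in> rectifiable_paths \<Omega> \<Longrightarrow> line_integral \<rho> \<gamma> < \<infinity> \<Longrightarrow> ug_inequality u g \<gamma>"
    using g by (auto simp: weak_upper_gradient_iff)
  obtain \<sigma> where \<sigma>: "\<sigma> \<in> Lp_densities p \<mu>"
    "\<And>\<gamma> \<Omega>\<^sub>0. \<gamma> \<in> rectifiable_paths \<Omega>\<^sub>0 \<Longrightarrow> line_integral \<sigma> \<gamma> < \<infinity> \<Longrightarrow>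
      line_integral \<rho> \<gamma> < \<infinity> \<and> line_integral \<rho>N \<gamma> < \<infinity>"
    using ex_common_density2[OF \<rho>(1) \<rho>N] by blast
  show ?thesis
    unfolding weak_upper_gradient_iff
  proof (intro conjI g' bexI[OF _ \<sigma>(1)] ballI impI)
    fix \<gamma> assume \<gamma>: "\<gamma> \<in> rectifiable_paths \<Omega>" and "line_integral \<sigma> \<gamma> < \<infinity>"
    then have fin: "line_integral \<rho> \<gamma> < \<infinity>" "line_integral \<rho>N \<gamma> < \<infinity>" using \<sigma>(2) by auto
    have "AE s in lborel. \<rho>N (arclength_param \<gamma> s) * indicator {0..total_length \<gamma>} s \<noteq> \<infinity>"
      using borel_measurable_along_path'[OF \<gamma> \<rho>N_meas] fin(2)
      by (intro nn_integral_PInf_AE) (auto simp: line_integral_eq)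
    then have "line_integral g \<gamma> = line_integral g' \<gamma>"
      unfolding line_integral_eq
    proof (intro nn_integral_cong_AE, eventually_elim)
      case (elim s)
      show ?case
      proof (cases "s \<in> {0..total_length \<gamma>}")
        case True
        then have "arclength_param \<gamma> s \<notin> N" "arclength_param \<gamma> s \<in> \<Omega>"
          using elim arclength_param_in[OF \<gamma> True] by (auto simp: \<rho>N_def indicator_def split: if_splits)
        then show ?thesis by (auto simp: N_def)
      qed simp
    qed
    then show "ug_inequality u g' \<gamma>" using \<rho>(2)[OF \<gamma> fin(1)] by (simp add: ug_inequality_def)
  qed
qed

lemma minimal_weak_upper_gradient_AE_cong:
  assumes \<Omega>: "\<Omega> \<in> sets borel" and g: "minimal_weak_upper_gradient p \<mu> \<Omega> u g"
    and g': "g' \<in> borel_measurable (restrict_space borel \<Omega>)"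
    and AE: "AE x in \<mu>. x \<in> \<Omega> \<longrightarrow> g x = g' x"
  shows "minimal_weak_upper_gradient p \<mu> \<Omega> u g'"
  unfolding minimal_weak_upper_gradient_iff
proof (intro conjI allI impI)
  show "weak_upper_gradient p \<mu> \<Omega> u g'"
    using g by (intro weak_upper_gradient_AE_cong[OF \<Omega> _ g' AE]) (simp add: minimal_weak_upper_gradient_iff)
  have "Lp_integral \<Omega> g' = Lp_integral \<Omega> g"
    using AE by (intro nn_integral_cong_AE) (auto elim!: eventually_mono simp: indicator_def)
  then show "Lp_integral \<Omega> g' < \<infinity>" using g by (simp add: minimal_weak_upper_gradient_iff)
  fix h assume "weak_upper_gradient p \<mu> \<Omega> u h \<and> Lp_integral \<Omega> h < \<infinity>"
  then have "AE x in \<mu>. x \<in> \<Omega> \<longrightarrow> g x \<le> h x" using g by (auto simp: minimal_weak_upper_gradient_iff)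
  with AE show "AE x in \<mu>. x \<in> \<Omega> \<longrightarrow> g' x \<le> h x" by eventually_elim auto
qed

text \<open>By uniqueness, the minimal functions on two of the sets agree almost everywhere on the smaller one.\<close>

lemma ex_minimal_weak_upper_gradient_exhaustion:
  fixes \<Omega> :: "nat \<Rightarrow> 'a set"
  assumes "open": "\<And>n. open (\<Omega> n)" and mono: "\<And>m n. m \<le> n \<Longrightarrow> \<Omega> m \<subseteq> \<Omega> n"
    and ex: "\<And>n. \<exists>g. minimal_weak_upper_gradient p \<mu> (\<Omega> n) u g"
  shows "\<exists>g. \<forall>n. minimal_weak_upper_gradient p \<mu> (\<Omega> n) u g"
proof -
  have \<Omega> [measurable]: "\<Omega> n \<in> sets borel" for n using "open" by simp
  obtain G where G: "\<And>n. minimal_weak_upper_gradient p \<mu> (\<Omega> n) u (G n)" using ex by metis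
  have [measurable]: "zero_ext (\<Omega> n) (G n) \<in> borel_measurable borel" for n
    using G[of n] \<Omega> by (auto simp: borel_measurable_zero_ext_iff weak_upper_gradient_def minimal_weak_upper_gradient_def)
  \<comment> \<open>The value \<open>top\<close> lets the infimum ignore the sets that do not contain \<open>x\<close>.\<close>
  define g where "g x = (INF n. if x \<in> \<Omega> n then G n x else top)" for x
  have "g = (\<lambda>x. INF n. if x \<in> \<Omega> n then zero_ext (\<Omega> n) (G n) x else top)"
    by (auto simp: g_def fun_eq_iff intro!: INF_cong)
  also have "\<dots> \<in> borel_measurable borel" by measurable
  finally have g: "g \<in> borel_measurable borel" .
  have "minimal_weak_upper_gradient p \<mu> (\<Omega> n) u g" for n
  proof (rule minimal_weak_upper_gradient_AE_cong[OF \<Omega> G])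
    show "g \<in> borel_measurable (restrict_space borel (\<Omega> n))" using g by (rule measurable_restrict_space1)
    have "AE x in \<mu>. x \<in> \<Omega> (min m n) \<longrightarrow> G m x = G n x" for m
      by (intro minimal_weak_upper_gradient_unique[where u = u]
            minimal_weak_upper_gradient_subset[OF \<Omega> "open" mono G]) auto
    then have "AE x in \<mu>. \<forall>m. x \<in> \<Omega> (min m n) \<longrightarrow> G m x = G n x" unfolding AE_all_countable by (rule allI)
    then show "AE x in \<mu>. x \<in> \<Omega> n \<longrightarrow> G n x = g x"
    proof eventually_elim
      case (elim x)
      show ?case
      proof
        assume x: "x \<in> \<Omega> n"
        have "(if x \<in> \<Omega> m then G m x else top) \<ge> G n x" for m
          using elim[rule_format, of m] x by (auto simp: min_def)
        then show "G n x = g x"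
          unfolding g_def using x by (intro antisym INF_greatest INF_lower2[of n]) auto
      qed
    qed
  qed
  then show ?thesis by blast
qed

end

section \<open>Doubling measures and exhaustion by compactly contained sets\<close>

lemma doubling_iterate:
  fixes \<mu> :: "'a::metric_space measure"
  assumes C: "\<And>x r. 0 < r \<Longrightarrow> emeasure \<mu> (ball x (2 * r)) \<le> ennreal C * emeasure \<mu> (ball x r)"
    and r: "0 < r"
  shows "emeasure \<mu> (ball x (2 ^ k * r)) \<le> ennreal C ^ k * emeasure \<mu> (ball x r)"
proof (induction k)
  case (Suc k)
  have "emeasure \<mu> (ball x (2 ^ Suc k * r)) = emeasure \<mu> (ball x (2 * (2 ^ k * r)))"
    by (simp add: mult.assoc)
  also have "\<dots> \<le> ennreal C * emeasure \<mu> (ball x (2 ^ k * r))"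
    using r by (intro C) simp
  also have "\<dots> \<le> ennreal C * (ennreal C ^ k * emeasure \<mu> (ball x r))"
    by (intro mult_left_mono Suc) simp
  finally show ?case by (simp add: mult.assoc)
qed simp

text \<open>It is enough to find finite nets. In a subset \<open>A\<close> of \<open>S\<close> with mutual distances at least \<open>e\<close>, the balls of
  radius \<open>e / 2\<close> are disjoint and contained in a fixed ball, while iterated doubling bounds the measure
  of each of them from below. So the cardinality of \<open>A\<close> is bounded, and a set \<open>A\<close> of maximal cardinality is
  a net.\<close>

lemma doubling_imp_proper:
  fixes \<mu> :: "'a::complete_space measure" and S :: "'a set"
  assumes "doubling_measure \<mu>" and S: "closed S" "bounded S"
  shows "compact S"
  unfolding compact_eq_totally_bounded
proof (intro conjI allI impI)
  show "complete S" using S by (simp add: complete_eq_closed)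
  fix e :: real assume e: "0 < e"
  have sets [simp]: "sets \<mu> = sets borel"
    and pos: "\<And>x r. 0 < r \<Longrightarrow> 0 < emeasure \<mu> (ball x r)"
    and fin: "\<And>x r. 0 < r \<Longrightarrow> emeasure \<mu> (ball x r) < \<infinity>"
    using assms(1) by (auto simp: doubling_measure_def)
  obtain C where C: "1 \<le> C"
    "\<And>x r. 0 < r \<Longrightarrow> emeasure \<mu> (ball x (2 * r)) \<le> ennreal C * emeasure \<mu> (ball x r)"
    using assms(1) by (auto simp: doubling_measure_def)
  obtain x\<^sub>0 R where R: "0 < R" "S \<subseteq> ball x\<^sub>0 R"
  proof -
    obtain x\<^sub>0 B where "\<forall>y\<in>S. dist x\<^sub>0 y \<le> B" using S(2) by (auto simp: bounded_def)
    then have "S \<subseteq> ball x\<^sub>0 (max B 0 + 1)" by force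
    then show thesis by (intro that[of "max B 0 + 1" x\<^sub>0]) auto
  qed
  define r where "r = e / 2"
  have r: "0 < r" using e by (simp add: r_def)
  obtain k where "2 * R / r < 2 ^ k" using real_arch_pow[of 2 "2 * R / r"] by auto
  then have k: "2 * R < 2 ^ k * r" using r by (simp add: field_simps)
  define m where "m = measure \<mu> (ball x\<^sub>0 R)"
  define V where "V = measure \<mu> (ball x\<^sub>0 (R + r))"
  have m: "emeasure \<mu> (ball x\<^sub>0 R) = ennreal m"
    unfolding m_def using fin[OF R(1), of x\<^sub>0] by (intro emeasure_eq_ennreal_measure) auto
  have V: "emeasure \<mu> (ball x\<^sub>0 (R + r)) = ennreal V"
    unfolding V_def using fin[of "R + r" x\<^sub>0] R r by (intro emeasure_eq_ennreal_measure) auto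
  have m_pos: "0 < m" using pos[OF R(1), of x\<^sub>0] m by (simp add: m_def)
  have ball_large: "ennreal m \<le> ennreal (C ^ k) * emeasure \<mu> (ball x r)" if "x \<in> S" for x
  proof -
    have "ball x\<^sub>0 R \<subseteq> ball x (2 ^ k * r)"
    proof
      fix y assume "y \<in> ball x\<^sub>0 R"
      then have "dist x y < 2 * R"
        using dist_triangle[of x y x\<^sub>0] R(2) that by (fastforce simp: dist_commute)
      then show "y \<in> ball x (2 ^ k * r)" using k by simp
    qed
    then have "ennreal m \<le> emeasure \<mu> (ball x (2 ^ k * r))"
      unfolding m[symmetric] by (intro emeasure_mono) auto
    also have "\<dots> \<le> ennreal C ^ k * emeasure \<mu> (ball x r)" by (rule doubling_iterate[OF C(2) r])
    finally show ?thesis using C(1) by (simp add: ennreal_power)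
  qed
  define P where "P A \<longleftrightarrow> finite A \<and> A \<subseteq> S \<and> (\<forall>x\<in>A. \<forall>y\<in>A. x \<noteq> y \<longrightarrow> e \<le> dist x y)" for A
  have card_le: "real (card A) \<le> C ^ k * V / m" if "P A" for A
  proof -
    have A: "finite A" "A \<subseteq> S" "\<And>x y. x \<in> A \<Longrightarrow> y \<in> A \<Longrightarrow> x \<noteq> y \<Longrightarrow> e \<le> dist x y"
      using that by (auto simp: P_def)
    have "disjoint_family_on (\<lambda>x. ball x r) A"
      unfolding disjoint_family_on_def
    proof (intro ballI impI, rule ccontr)
      fix x y assume xy: "x \<in> A" "y \<in> A" "x \<noteq> y" and "ball x r \<inter> ball y r \<noteq> {}"
      then obtain z where "dist x z < r" "dist y z < r" by auto
      then have "dist x y < e" using dist_triangle[of x y z] by (simp add: dist_commute r_def)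
      with A(3)[OF xy] show False by simp
    qed
    then have "(\<Sum>x\<in>A. emeasure \<mu> (ball x r)) = emeasure \<mu> (\<Union>x\<in>A. ball x r)"
      using A(1) by (intro sum_emeasure) auto
    also have "\<dots> \<le> ennreal V"
      unfolding V[symmetric]
    proof (intro emeasure_mono UN_least)
      fix x assume "x \<in> A"
      then have x: "dist x\<^sub>0 x < R" using A(2) R(2) by auto
      show "ball x r \<subseteq> ball x\<^sub>0 (R + r)"
      proof
        fix y assume "y \<in> ball x r"
        then show "y \<in> ball x\<^sub>0 (R + r)" using dist_triangle[of x\<^sub>0 y x] x by simp
      qed
    qed simp
    finally have sum_le: "(\<Sum>x\<in>A. emeasure \<mu> (ball x r)) \<le> ennreal V" .
    have "ennreal (real (card A) * m) = (\<Sum>x\<in>A. ennreal m)"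
      using m_pos by (simp add: ennreal_mult ennreal_of_nat_eq_real_of_nat)
    also have "\<dots> \<le> (\<Sum>x\<in>A. ennreal (C ^ k) * emeasure \<mu> (ball x r))"
      using A(2) ball_large by (intro sum_mono) auto
    also have "\<dots> = ennreal (C ^ k) * (\<Sum>x\<in>A. emeasure \<mu> (ball x r))"
      by (simp add: sum_distrib_left)
    also have "\<dots> \<le> ennreal (C ^ k) * ennreal V" by (intro mult_left_mono sum_le) simp
    also have "\<dots> = ennreal (C ^ k * V)" using C(1) by (simp add: ennreal_mult V_def)
    finally have "real (card A) * m \<le> C ^ k * V"
      using C(1) by (subst (asm) ennreal_le_iff) (auto simp: V_def)
    then show ?thesis using m_pos by (simp add: field_simps)
  qed
  obtain b :: nat where b: "C ^ k * V / m < real b" using reals_Archimedean2 by blast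
  have "card A < b" if "P A" for A using card_le[OF that] b by linarith
  moreover have "P {}" by (simp add: P_def)
  ultimately obtain A where A: "P A" "\<And>B. P B \<Longrightarrow> card B \<le> card A"
    using ex_has_greatest_nat[of P "{}" card b] by (metis less_imp_le_nat)
  show "\<exists>A. finite A \<and> S \<subseteq> (\<Union>x\<in>A. ball x e)"
  proof (intro exI[of _ A] conjI subsetI)
    show "finite A" using A(1) by (simp add: P_def)
    fix x assume x: "x \<in> S"
    show "x \<in> (\<Union>x\<in>A. ball x e)"
    proof (rule ccontr)
      assume "x \<notin> (\<Union>x\<in>A. ball x e)"
      then have far: "\<And>y. y \<in> A \<Longrightarrow> e \<le> dist y x" by (auto simp: not_less)
      then have "P (insert x A)" using A(1) x by (auto simp: P_def dist_commute)
      moreover have "x \<notin> A" using far[of x] e by auto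
      ultimately show False using A(2)[of "insert x A"] A(1) by (simp add: P_def)
    qed
  qed
qed

lemma closed_inner_parallel_set: "closed {x. ball x r \<subseteq> (\<Omega> :: 'a::metric_space set)}"
proof -
  have "{x. ball x r \<subseteq> \<Omega>} = - (\<Union>y\<in>- \<Omega>. ball y r)" by (auto simp: subset_eq dist_commute)
  then show ?thesis by auto
qed

text \<open>Stated with balls instead of the distance to the complement of \<open>\<Omega>\<close>, which is empty if \<open>\<Omega>\<close> is the
  whole space.\<close>

definition inner_exhaustion :: "'a::metric_space set \<Rightarrow> nat \<Rightarrow> 'a set" where
  "inner_exhaustion \<Omega> n = interior {x. ball x (1 / real (Suc n)) \<subseteq> \<Omega>}"

lemma open_inner_exhaustion: "open (inner_exhaustion \<Omega> n)"
  by (simp add: inner_exhaustion_def)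

lemma inner_exhaustion_mono: "m \<le> n \<Longrightarrow> inner_exhaustion \<Omega> m \<subseteq> inner_exhaustion \<Omega> n"
  unfolding inner_exhaustion_def
  by (intro interior_mono Collect_mono impI)
    (auto elim!: order_trans[rotated] intro!: subset_ball simp: frac_le)

lemma closure_inner_exhaustion: "closure (inner_exhaustion \<Omega> n) \<subseteq> \<Omega>"
proof -
  have "closure (inner_exhaustion \<Omega> n) \<subseteq> {x. ball x (1 / real (Suc n)) \<subseteq> \<Omega>}"
    unfolding inner_exhaustion_def
    by (rule closure_minimal[OF interior_subset closed_inner_parallel_set])
  also have "\<dots> \<subseteq> \<Omega>" by (auto simp: subset_eq)
  finally show ?thesis .
qed

lemma inner_exhaustion_subset: "inner_exhaustion \<Omega> n \<subseteq> \<Omega>"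
  by (rule order_trans[OF closure_subset closure_inner_exhaustion])

lemma inner_exhaustion_covers_compact:
  assumes \<Omega>: "open \<Omega>" and K: "compact K" "K \<subseteq> \<Omega>"
  obtains n where "K \<subseteq> inner_exhaustion \<Omega> n"
proof -
  have "\<exists>n. x \<in> inner_exhaustion \<Omega> n" if "x \<in> K" for x
  proof -
    have "x \<in> \<Omega>" using K that by auto
    then obtain e where e: "0 < e" "ball x e \<subseteq> \<Omega>" by (rule openE[OF \<Omega>])
    obtain n where n: "1 / real (Suc n) < e / 2" using nat_approx_posE[of "e / 2"] e by auto
    have "ball x (e / 2) \<subseteq> {y. ball y (1 / real (Suc n)) \<subseteq> \<Omega>}"
    proof clarify
      fix y z assume "y \<in> ball x (e / 2)" "z \<in> ball y (1 / real (Suc n))"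
      then have "dist x z < e" using n dist_triangle[of x z y] by simp
      then show "z \<in> \<Omega>" using e by auto
    qed
    then have "ball x (e / 2) \<subseteq> inner_exhaustion \<Omega> n"
      unfolding inner_exhaustion_def by (intro interior_maximal) auto
    then show ?thesis using e by (intro exI[of _ n]) auto
  qed
  then have "K \<subseteq> (\<Union>n. inner_exhaustion \<Omega> n)" by blast
  then obtain N where N: "finite N" "K \<subseteq> (\<Union>n\<in>N. inner_exhaustion \<Omega> n)"
    using compactE_image[OF K(1), of UNIV "inner_exhaustion \<Omega>", OF open_inner_exhaustion] by auto
  have "(\<Union>n\<in>N. inner_exhaustion \<Omega> n) \<subseteq> inner_exhaustion \<Omega> (Max (insert 0 N))"
    using N(1) by (intro UN_least inner_exhaustion_mono) simp
  with N(2) show thesis by (intro that) (rule order_trans)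
qed

lemma inner_exhaustion_compactly_contained:
  fixes \<mu> :: "'a::complete_space measure"
    and \<Omega> :: "'a set"
  assumes "doubling_measure \<mu>" "bounded \<Omega>"
  shows "inner_exhaustion \<Omega> n \<Subset> \<Omega>"
  unfolding compactly_contained_def
proof
  have "bounded (closure (inner_exhaustion \<Omega> n))"
    using bounded_subset[OF assms(2) closure_inner_exhaustion] .
  then show "compact (closure (inner_exhaustion \<Omega> n))"
    by (intro doubling_imp_proper[OF assms(1)]) auto
qed (rule closure_inner_exhaustion)

section \<open>Locality of the minimal weak upper gradient\<close>

lemma epowr_add_le:
  assumes "0 < a"
  shows "epowr (x + y) a \<le> ennreal (2 powr a) * (epowr x a + epowr y a)"
proof -
  have "x + y \<le> ennreal 2 * max x y"
    by (cases "x \<le> y") (auto simp: max_def mult_2 intro: add_mono)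
  then have "epowr (x + y) a \<le> ennreal (2 powr a) * epowr (max x y) a"
    using assms by (metis epowr_mono epowr_mult zero_le_numeral)
  also have "\<dots> \<le> ennreal (2 powr a) * (epowr x a + epowr y a)"
    by (intro mult_left_mono) (auto simp: max_def)
  finally show ?thesis .
qed

context metric_measure
begin

text \<open>A crude bound. Its purpose is that \<open>v + \<psi>\<close> has some \<open>p\<close>-integrable weak upper gradient, and hence a
  minimal one.\<close>

lemma weak_upper_gradient_add_lipschitz:
  assumes \<Omega> [measurable]: "\<Omega> \<in> sets borel"
    and g: "weak_upper_gradient p \<mu> \<Omega> v g"
    and \<psi>: "L-lipschitz_on \<Omega> \<psi>"
  shows "weak_upper_gradient p \<mu> \<Omega> (\<lambda>x. v x + ereal (\<psi> x)) (\<lambda>x. g x + ennreal L)"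
proof -
  have meas: "g \<in> borel_measurable (restrict_space borel \<Omega>)"
    using g by (simp add: weak_upper_gradient_iff)
  obtain \<rho> where \<rho>: "\<rho> \<in> Lp_densities p \<mu>"
    "\<And>\<gamma>. \<gamma> \<in> rectifiable_paths \<Omega> \<Longrightarrow> line_integral \<rho> \<gamma> < \<infinity> \<Longrightarrow> ug_inequality v g \<gamma>"
    using g by (auto simp: weak_upper_gradient_iff)
  show ?thesis
    unfolding weak_upper_gradient_iff
  proof (intro conjI bexI[OF _ \<rho>(1)] ballI impI)
    show "(\<lambda>x. g x + ennreal L) \<in> borel_measurable (restrict_space borel \<Omega>)"
      using meas by measurable
    fix \<gamma> assume \<gamma>: "\<gamma> \<in> rectifiable_paths \<Omega>" "line_integral \<rho> \<gamma> < \<infinity>"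
    let ?c = "arclength_param \<gamma>" and ?L = "total_length \<gamma>"
    have [measurable]: "(\<lambda>s. g (?c s) * indicator {0..?L} s) \<in> borel_measurable borel"
      by (rule borel_measurable_along_path[OF \<gamma>(1) meas])
    have L: "0 \<le> L" using \<psi> by (rule lipschitz_on_nonneg)
    have pos: "0 < ?L" using total_length_pos[OF \<gamma>(1)] .
    have "line_integral (\<lambda>x. g x + ennreal L) \<gamma>
        = (\<integral>\<^sup>+s. g (?c s) * indicator {0..?L} s + ennreal L * indicator {0..?L} s \<partial>lborel)"
      unfolding line_integral_eq by (simp add: distrib_right)
    also have "\<dots> = line_integral g \<gamma> + ennreal L * emeasure lborel {0..?L}"
      unfolding line_integral_eq by (subst nn_integral_add) (auto simp: nn_integral_cmult_indicator)
    also have "ennreal L * emeasure lborel {0..?L} = ennreal (L * ?L)"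
      using pos L by (simp add: ennreal_mult)
    finally have int: "line_integral (\<lambda>x. g x + ennreal L) \<gamma> = line_integral g \<gamma> + ennreal (L * ?L)" .
    show "ug_inequality (\<lambda>x. v x + ereal (\<psi> x)) (\<lambda>x. g x + ennreal L) \<gamma>"
    proof (cases "line_integral g \<gamma> < \<infinity>")
      case True
      have "dist (?c 0) (?c ?L) \<le> 1 * dist 0 ?L"
        using pos by (intro lipschitz_onD[OF arclength_param_lipschitz[OF \<gamma>(1)]]) auto
      moreover have "dist (\<psi> (?c 0)) (\<psi> (?c ?L)) \<le> L * dist (?c 0) (?c ?L)"
        using pos arclength_param_in[OF \<gamma>(1)] by (intro lipschitz_onD[OF \<psi>]) auto
      moreover have "L * dist (?c 0) (?c ?L) \<le> L * ?L"
        using calculation(1) L pos by (intro mult_left_mono) (auto simp: dist_real_def)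
      ultimately have "dist (\<psi> (?c 0)) (\<psi> (?c ?L)) \<le> L * ?L" by linarith
      then have d\<psi>: "\<bar>\<psi> (pathstart \<gamma>) - \<psi> (pathfinish \<gamma>)\<bar> \<le> L * ?L"
        by (simp add: arclength_param_0[OF \<gamma>(1)] arclength_param_total[OF \<gamma>(1)] dist_real_def)
      obtain r where r: "line_integral g \<gamma> = ennreal r" "0 \<le> r" using True by (cases "line_integral g \<gamma>") auto
      have sum: "enn2ereal (line_integral g \<gamma> + ennreal (L * ?L)) = ereal (r + L * ?L)"
        using r L pos by (simp flip: ennreal_plus)
      show ?thesis
        using \<rho>(2)[OF \<gamma>] d\<psi> r unfolding ug_inequality_def int sum
        by (cases "v (pathstart \<gamma>)"; cases "v (pathfinish \<gamma>)") auto
    next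
      case False
      then have "line_integral g \<gamma> = top" using less_top by fastforce
      then show ?thesis by (simp add: ug_inequality_def int enn2ereal_top)
    qed
  qed
qed

lemma Lp_integral_add_const_finite:
  assumes \<Omega> [measurable]: "\<Omega> \<in> sets borel" and "emeasure \<mu> \<Omega> < \<infinity>"
    and g: "g \<in> borel_measurable (restrict_space borel \<Omega>)"
    and fin: "Lp_integral \<Omega> g < \<infinity>"
  shows "(\<integral>\<^sup>+x\<in>\<Omega>. epowr (g x + ennreal L) p \<partial>\<mu>) < \<infinity>"
proof -
  have [measurable]: "zero_ext \<Omega> g \<in> borel_measurable borel"
    using g \<Omega> by (simp add: borel_measurable_zero_ext_iff)
  have "(\<integral>\<^sup>+x\<in>\<Omega>. epowr (g x + ennreal L) p \<partial>\<mu>)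
     \<le> (\<integral>\<^sup>+x. ennreal (2 powr p) * (epowr (zero_ext \<Omega> g x) p + epowr (ennreal L) p * indicator \<Omega> x) \<partial>\<mu>)"
    using epowr_add_le[OF p_pos] by (intro nn_integral_mono) (auto simp: indicator_def)
  also have "\<dots> = ennreal (2 powr p) * ((\<integral>\<^sup>+x. epowr (zero_ext \<Omega> g x) p \<partial>\<mu>) + epowr (ennreal L) p * emeasure \<mu> \<Omega>)"
    by (subst nn_integral_cmult, measurable, subst nn_integral_add) (auto simp: nn_integral_cmult_indicator)
  also have "(\<integral>\<^sup>+x. epowr (zero_ext \<Omega> g x) p \<partial>\<mu>) = Lp_integral \<Omega> g"
    by (intro nn_integral_cong) (auto simp: indicator_def)
  also have "ennreal (2 powr p) * (\<dots> + epowr (ennreal L) p * emeasure \<mu> \<Omega>) < \<infinity>"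
    using fin assms(2) by (auto simp: ennreal_mult_less_top)
  finally show ?thesis .
qed

text \<open>Every compactly contained set lies in a member of the exhaustion, so a function that is minimal on
  these members is a witness for the choice in \<^const>\<open>min_grad_loc\<close>.\<close>

lemma min_grad_loc_minimal:
  assumes \<Omega>: "open \<Omega>"
    and ex: "\<And>n. \<exists>g. weak_upper_gradient p \<mu> (inner_exhaustion \<Omega> n) v g \<and>
      Lp_integral (inner_exhaustion \<Omega> n) g < \<infinity>"
    and \<Omega>': "open \<Omega>'" "\<Omega>' \<Subset> \<Omega>"
  shows "minimal_weak_upper_gradient p \<mu> \<Omega>' v (min_grad_loc p \<mu> \<Omega> v)"
proof -
  let ?D = "inner_exhaustion \<Omega>"
  have D [simp]: "?D n \<in> sets borel" for n by (rule borel_open[OF open_inner_exhaustion])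
  have "\<exists>g. minimal_weak_upper_gradient p \<mu> (?D n) v g" for n
    using ex[of n] ex_minimal_weak_upper_gradient[OF D] by blast
  then obtain g where g: "\<And>n. minimal_weak_upper_gradient p \<mu> (?D n) v g"
    using ex_minimal_weak_upper_gradient_exhaustion[of ?D v] open_inner_exhaustion inner_exhaustion_mono
    by blast
  have "\<exists>g. \<forall>\<Omega>'. open \<Omega>' \<and> \<Omega>' \<Subset> \<Omega> \<longrightarrow> minimal_weak_upper_gradient p \<mu> \<Omega>' v g"
  proof (intro exI[of _ g] allI impI, elim conjE)
    fix \<Omega>' assume \<Omega>': "open \<Omega>'" "\<Omega>' \<Subset> \<Omega>"
    then obtain n where "closure \<Omega>' \<subseteq> ?D n"
      using inner_exhaustion_covers_compact[OF \<Omega>, of "closure \<Omega>'"] by (auto simp: compactly_contained_def)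
    then have "\<Omega>' \<subseteq> ?D n" using closure_subset by blast
    then show "minimal_weak_upper_gradient p \<mu> \<Omega>' v g"
      by (intro minimal_weak_upper_gradient_subset[OF D \<Omega>'(1) _ g])
  qed
  then have "\<forall>\<Omega>'. open \<Omega>' \<and> \<Omega>' \<Subset> \<Omega> \<longrightarrow>
      minimal_weak_upper_gradient p \<mu> \<Omega>' v (min_grad_loc p \<mu> \<Omega> v)"
    unfolding min_grad_loc_def by (rule someI_ex)
  then show ?thesis using \<Omega>' by (elim allE[of _ \<Omega>'] impE) (rule conjI)
qed

text \<open>Replacing the minimal weak upper gradient of \<open>v\<close> by that of \<open>v + \<psi>\<close> on the zero set of \<open>\<psi>\<close> leaves a
  weak upper gradient of \<open>v\<close>, to which the minimal one is compared.\<close>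

lemma min_grad_loc_le_on_zero_set:
  assumes \<Omega>: "open \<Omega>" and D: "\<And>n. inner_exhaustion \<Omega> n \<Subset> \<Omega>"
    and finite_measure: "\<And>n. emeasure \<mu> (inner_exhaustion \<Omega> n) < \<infinity>"
    and ex: "\<And>n. \<exists>g. weak_upper_gradient p \<mu> (inner_exhaustion \<Omega> n) v g \<and>
      Lp_integral (inner_exhaustion \<Omega> n) g < \<infinity>"
    and \<psi>: "L-lipschitz_on \<Omega> \<psi>"
  shows "AE x in \<mu>. x \<in> \<Omega> \<and> \<psi> x = 0 \<longrightarrow>
    min_grad_loc p \<mu> \<Omega> v x \<le> min_grad_loc p \<mu> \<Omega> (\<lambda>x. v x + ereal (\<psi> x)) x"
proof -
  let ?D = "inner_exhaustion \<Omega>" and ?w = "\<lambda>x. v x + ereal (\<psi> x)"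
  let ?g = "min_grad_loc p \<mu> \<Omega> v" and ?h = "min_grad_loc p \<mu> \<Omega> ?w"
  have D_borel [simp]: "?D n \<in> sets borel" for n by (rule borel_open[OF open_inner_exhaustion])
  have \<psi>_D: "L-lipschitz_on (?D n) \<psi>" for n
    by (rule lipschitz_on_subset[OF \<psi> inner_exhaustion_subset])
  have ex_w: "\<exists>g. weak_upper_gradient p \<mu> (?D n) ?w g \<and> Lp_integral (?D n) g < \<infinity>" for n
  proof -
    obtain g where g: "weak_upper_gradient p \<mu> (?D n) v g" "Lp_integral (?D n) g < \<infinity>"
      using ex by blast
    then have "g \<in> borel_measurable (restrict_space borel (?D n))" by (simp add: weak_upper_gradient_iff)
    from weak_upper_gradient_add_lipschitz[OF D_borel g(1) \<psi>_D]
      Lp_integral_add_const_finite[OF D_borel finite_measure this g(2)]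
    show ?thesis by (intro exI[of _ "\<lambda>x. g x + ennreal L"] conjI)
  qed
  have g: "minimal_weak_upper_gradient p \<mu> (?D n) v ?g" for n
    by (rule min_grad_loc_minimal[OF \<Omega> ex open_inner_exhaustion D])
  have h: "minimal_weak_upper_gradient p \<mu> (?D n) ?w ?h" for n
    by (rule min_grad_loc_minimal[OF \<Omega> ex_w open_inner_exhaustion D])
  have "AE x in \<mu>. x \<in> ?D n \<and> \<psi> x = 0 \<longrightarrow> ?g x \<le> ?h x" for n
  proof -
    define Z where "Z = {x \<in> ?D n. \<psi> x = 0}"
    let ?k = "\<lambda>x. if x \<in> Z then ?h x else ?g x"
    have Z: "closedin (top_of_set (?D n)) Z"
    proof -
      have "Z = ?D n \<inter> \<psi> -` {0}" by (auto simp: Z_def)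
      then show ?thesis
        using continuous_closedin_preimage[OF lipschitz_on_continuous_on[OF \<psi>_D], of "{0}" n] by simp
    qed
    have Z_borel [measurable]: "Z \<in> sets borel" using Z unfolding closedin_closed by auto
    have g_wug: "weak_upper_gradient p \<mu> (?D n) v ?g" "Lp_integral (?D n) ?g < \<infinity>"
      and h_wug: "weak_upper_gradient p \<mu> (?D n) ?w ?h" "Lp_integral (?D n) ?h < \<infinity>"
      using g[of n] h[of n] by (auto simp: minimal_weak_upper_gradient_iff)
    have [measurable]: "zero_ext (?D n) ?g \<in> borel_measurable borel" "zero_ext (?D n) ?h \<in> borel_measurable borel"
      using g_wug(1) h_wug(1) by (auto simp: borel_measurable_zero_ext_iff weak_upper_gradient_def)
    have "weak_upper_gradient p \<mu> (?D n) v ?k"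
      by (rule weak_upper_gradient_glue_closed[OF D_borel Z _ g_wug h_wug])
        (simp add: Z_def flip: zero_ereal_def)
    moreover have "Lp_integral (?D n) ?k < \<infinity>"
    proof -
      have "Lp_integral (?D n) ?k
          \<le> (\<integral>\<^sup>+x. epowr (zero_ext (?D n) ?g x) p + epowr (zero_ext (?D n) ?h x) p \<partial>\<mu>)"
        by (intro nn_integral_mono) (auto simp: indicator_def)
      also have "\<dots> = (\<integral>\<^sup>+x. epowr (zero_ext (?D n) ?g x) p \<partial>\<mu>) + (\<integral>\<^sup>+x. epowr (zero_ext (?D n) ?h x) p \<partial>\<mu>)"
        by (rule nn_integral_add) measurable
      also have "(\<integral>\<^sup>+x. epowr (zero_ext (?D n) ?g x) p \<partial>\<mu>) = Lp_integral (?D n) ?g"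
        by (intro nn_integral_cong) (auto simp: indicator_def)
      also have "(\<integral>\<^sup>+x. epowr (zero_ext (?D n) ?h x) p \<partial>\<mu>) = Lp_integral (?D n) ?h"
        by (intro nn_integral_cong) (auto simp: indicator_def)
      also have "Lp_integral (?D n) ?g + \<dots> < \<infinity>"
        using g_wug(2) h_wug(2) by simp
      finally show ?thesis .
    qed
    ultimately have "AE x in \<mu>. x \<in> ?D n \<longrightarrow> ?g x \<le> ?k x"
      using g[of n] unfolding minimal_weak_upper_gradient_iff by blast
    then show ?thesis by eventually_elim (auto simp: Z_def)
  qed
  then have "AE x in \<mu>. \<forall>n. x \<in> ?D n \<and> \<psi> x = 0 \<longrightarrow> ?g x \<le> ?h x"
    unfolding AE_all_countable by (rule allI)
  then show ?thesis
  proof eventually_elim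
    case (elim x)
    have "\<exists>n. {x} \<subseteq> ?D n" if "x \<in> \<Omega>"
      using inner_exhaustion_covers_compact[OF \<Omega>, of "{x}"] that by auto
    with elim show ?case by blast
  qed
qed

end

section \<open>Porous points of subsets of the real line\<close>

text \<open>The set consists of points \<open>t\<close> next to which \<open>Z\<close> has holes of a size proportional to their distance from
  \<open>t\<close>. Every small ball around such a point that reaches across a hole has a fixed fraction of its measure
  outside \<open>Z\<close>. If the balls of a Vitali covering are taken in an open set \<open>W\<close> around \<open>Z\<close>, then their
  total measure is bounded by a multiple of the measure of \<open>W - Z\<close>, which is as small as desired.\<close>

lemma negligible_porous_points:
  fixes Z :: "real set"
  assumes Z: "Z \<in> sets lebesgue" and \<theta>: "0 < \<theta>" "\<theta> \<le> 1"
  shows "negligible {t \<in> Z. \<forall>d>0. \<exists>r. r \<noteq> 0 \<and> \<bar>r\<bar> < d \<and> ball (t + r) (\<theta> * \<bar>r\<bar>) \<inter> Z = {}}"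
    (is "negligible ?S")
  unfolding negligible_outer_le
proof (intro allI impI)
  fix e :: real assume e: "0 < e"
  let ?m = "measure lebesgue"
  obtain W where W: "open W" "Z \<subseteq> W" "W - Z \<in> lmeasurable" "emeasure lebesgue (W - Z) < ennreal (\<theta> / 2 * e)"
    using sets_lebesgue_outer_open[OF Z, of "\<theta> / 2 * e"] e \<theta> by auto
  have mW: "?m (W - Z) \<le> \<theta> / 2 * e"
  proof -
    have "ennreal (?m (W - Z)) < ennreal (\<theta> / 2 * e)"
      using W(4) by (simp add: emeasure_eq_measure2[OF W(3)])
    then show ?thesis using e \<theta> by (simp add: ennreal_less_iff)
  qed
  \<comment> \<open>The factor: a hole of radius \<open>\<theta> * \<bar>r\<bar>\<close> lies in a ball of radius \<open>2 * \<bar>r\<bar>\<close>.\<close>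
  define K where "K = {(a, \<rho>). 0 < \<rho> \<and> ball a \<rho> \<subseteq> W \<and> ?m (ball a \<rho>) \<le> 2 / \<theta> * ?m (ball a \<rho> - Z)}"
  have bZ: "ball a \<rho> - Z \<in> lmeasurable" for a \<rho> :: real
    using Z by (intro fmeasurable_Diff) auto
  obtain C where C: "countable C" "C \<subseteq> K"
    and disj: "pairwise (\<lambda>i j. disjnt (ball (fst i) (snd i)) (ball (fst j) (snd j))) C"
    and neg: "negligible (?S - (\<Union>i\<in>C. ball (fst i) (snd i)))"
  proof (rule Vitali_covering_theorem_balls[of ?S K fst snd])
    fix t d :: real assume t: "t \<in> ?S" and d: "0 < d"
    then have "t \<in> W" using W(2) by auto
    then obtain k where k: "0 < k" "ball t k \<subseteq> W" by (rule openE[OF W(1)])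
    obtain r where r: "r \<noteq> 0" "\<bar>r\<bar> < min (d / 2) (k / 2)" and free: "ball (t + r) (\<theta> * \<bar>r\<bar>) \<inter> Z = {}"
      using t d k(1) by (auto dest!: spec[of _ "min (d / 2) (k / 2)"])
    have "ball t (2 * \<bar>r\<bar>) \<subseteq> W" using k r by (intro order_trans[OF subset_ball k(2)]) auto
    moreover have "?m (ball t (2 * \<bar>r\<bar>)) \<le> 2 / \<theta> * ?m (ball t (2 * \<bar>r\<bar>) - Z)"
    proof -
      have "ball (t + r) (\<theta> * \<bar>r\<bar>) \<subseteq> ball t (2 * \<bar>r\<bar>)"
      proof
        fix s assume "s \<in> ball (t + r) (\<theta> * \<bar>r\<bar>)"
        then have "\<bar>t + r - s\<bar> < \<theta> * \<bar>r\<bar>" by (simp add: dist_real_def)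
        moreover have "\<theta> * \<bar>r\<bar> \<le> 1 * \<bar>r\<bar>" using \<theta> by (intro mult_right_mono) auto
        ultimately show "s \<in> ball t (2 * \<bar>r\<bar>)" by (simp add: dist_real_def)
      qed
      then have "?m (ball (t + r) (\<theta> * \<bar>r\<bar>)) \<le> ?m (ball t (2 * \<bar>r\<bar>) - Z)"
        using free bZ by (intro measure_mono_fmeasurable) auto
      moreover have "?m (ball (t + r) (\<theta> * \<bar>r\<bar>)) = 2 * (\<theta> * \<bar>r\<bar>)" "?m (ball t (2 * \<bar>r\<bar>)) = 2 * (2 * \<bar>r\<bar>)"
        using \<theta> by (simp_all add: ball_eq_greaterThanLessThan)
      ultimately show ?thesis using \<theta> by (simp add: field_simps)
    qed
    ultimately have "(t, 2 * \<bar>r\<bar>) \<in> K" using r by (simp add: K_def)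
    then show "\<exists>i. i \<in> K \<and> t \<in> ball (fst i) (snd i) \<and> snd i < d"
      using r by (intro exI[of _ "(t, 2 * \<bar>r\<bar>)"]) auto
  qed
  have finite_le: "?m (\<Union>i\<in>I. ball (fst i) (snd i)) \<le> e" if I: "I \<subseteq> C" "finite I" for I
  proof -
    have KI: "ball (fst i) (snd i) \<subseteq> W" "?m (ball (fst i) (snd i)) \<le> 2 / \<theta> * ?m (ball (fst i) (snd i) - Z)"
      if "i \<in> I" for i
    proof -
      have "i \<in> K" using that I(1) C(2) by blast
      then show "ball (fst i) (snd i) \<subseteq> W" "?m (ball (fst i) (snd i)) \<le> 2 / \<theta> * ?m (ball (fst i) (snd i) - Z)"
        unfolding K_def by (cases i, simp)+
    qed
    have "?m (\<Union>i\<in>I. ball (fst i) (snd i)) \<le> (\<Sum>i\<in>I. ?m (ball (fst i) (snd i)))"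
      using I by (intro measure_UNION_le) auto
    also have "\<dots> \<le> (\<Sum>i\<in>I. 2 / \<theta> * ?m (ball (fst i) (snd i) - Z))"
      by (intro sum_mono KI)
    also have "\<dots> = 2 / \<theta> * (\<Sum>i\<in>I. ?m (ball (fst i) (snd i) - Z))"
      by (simp add: sum_distrib_left)
    also have "(\<Sum>i\<in>I. ?m (ball (fst i) (snd i) - Z)) = ?m (\<Union>i\<in>I. ball (fst i) (snd i) - Z)"
    proof (rule measure_UNION'[symmetric, OF I(2) bZ])
      show "pairwise (\<lambda>i j. disjnt (ball (fst i) (snd i) - Z) (ball (fst j) (snd j) - Z)) I"
        using pairwise_subset[OF disj I(1)] by (rule pairwise_mono) (auto simp: disjnt_def)
    qed
    also have "2 / \<theta> * \<dots> \<le> 2 / \<theta> * ?m (W - Z)"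
    proof (intro mult_left_mono measure_mono_fmeasurable W(3))
      show "(\<Union>i\<in>I. ball (fst i) (snd i) - Z) \<subseteq> W - Z" using KI(1) by blast
      show "(\<Union>i\<in>I. ball (fst i) (snd i) - Z) \<in> sets lebesgue"
        using I(2) bZ by (intro sets.finite_UN) (auto dest: fmeasurableD)
    qed (use \<theta> in auto)
    also have "\<dots> \<le> 2 / \<theta> * (\<theta> / 2 * e)" using \<theta> by (intro mult_left_mono mW) auto
    also have "\<dots> = e" using \<theta> by simp
    finally show ?thesis .
  qed
  let ?U = "\<Union>i\<in>C. ball (fst i) (snd i)"
  have U: "?U \<in> lmeasurable" "?m ?U \<le> e"
    using finite_le e
    by (auto intro!: fmeasurable_UN_bound[OF C(1)] measure_UN_bound[OF C(1)])
  show "\<exists>T. ?S \<subseteq> T \<and> T \<in> lmeasurable \<and> ?m T \<le> e"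
  proof (intro exI[of _ "?U \<union> (?S - ?U)"] conjI)
    show "?U \<union> (?S - ?U) \<in> lmeasurable"
      using U(1) neg by (intro fmeasurable.Un) (auto intro: negligible_imp_measurable)
    have "?m (?U \<union> (?S - ?U)) \<le> ?m ?U + ?m (?S - ?U)"
      using U(1) neg by (intro measure_Un_le) (auto intro: negligible_imp_sets dest: fmeasurableD)
    also have "?m (?S - ?U) = 0" using neg by (rule negligible_imp_measure0)
    finally show "?m (?U \<union> (?S - ?U)) \<le> e" using U(2) by simp
  qed auto
qed

lemma AE_lborel_not_in_negligible:
  assumes "negligible N"
  shows "AE t in lborel. t \<notin> N"
proof -
  have "N \<in> null_sets (completion lborel)" using assms by (simp add: negligible_iff_null_sets)
  then have "AE t in completion lborel. t \<notin> N" by (rule AE_not_in)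
  then show ?thesis unfolding AE_completion_iff .
qed

section \<open>Measurability and integrals over subsets of the cylinder\<close>

text \<open>Open sets of a product need not belong to the product of the Borel \<open>\<sigma>\<close>-algebras if a factor is not
  separable. The compact closure of \<open>U\<close> supplies countably many centres for product sets that cover \<open>U\<close>.\<close>

lemma open_compactly_contained_borel_product:
  fixes U :: "('a::metric_space \<times> real) set"
  assumes U: "open U" "compact (closure U)"
  shows "U \<in> sets (borel \<Otimes>\<^sub>M lborel)"
proof -
  have "compact (fst ` closure U)" using U(2) by (intro compact_continuous_image continuous_intros)
  then have "\<exists>k. finite k \<and> fst ` closure U \<subseteq> (\<Union>x\<in>k. ball x (1 / real (Suc n)))" for n
    unfolding compact_eq_totally_bounded by simp
  then obtain k where k: "\<And>n. finite (k n)" "\<And>n. fst ` closure U \<subseteq> (\<Union>x\<in>k n. ball x (1 / real (Suc n)))"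
    by metis
  define R where "R n d q = ball d (1 / real (Suc n)) \<times> ball q (1 / real (Suc n))" for n :: nat and d :: 'a and q :: real
  define J where "J = {(n, d, q). d \<in> k n \<and> q \<in> \<rat> \<and> R n d q \<subseteq> U}"
  have "J \<subseteq> UNIV \<times> (\<Union>n. k n) \<times> \<rat>" by (auto simp: J_def)
  moreover have "countable ((UNIV :: nat set) \<times> (\<Union>n. k n) \<times> (\<rat> :: real set))"
    by (intro countable_SIGMA countable_UN) (auto simp: k(1) countable_finite countable_rat)
  ultimately have J: "countable J" by (rule countable_subset)
  have "U = (\<Union>(n, d, q)\<in>J. R n d q)"
  proof (intro equalityI subsetI)
    fix z assume z: "z \<in> U"
    obtain e where e: "0 < e" "ball z e \<subseteq> U" using openE[OF U(1) z] .
    obtain n where n: "1 / real (Suc n) < e / 4" using nat_approx_posE[of "e / 4"] e by auto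
    have "fst z \<in> fst ` closure U" using z closure_subset by blast
    then obtain d where d: "d \<in> k n" "dist d (fst z) < 1 / real (Suc n)" using k(2)[of n] by auto
    obtain q where q: "q \<in> \<rat>" "snd z < q" "q < snd z + 1 / real (Suc n)"
      using Rats_dense_in_real[of "snd z" "snd z + 1 / real (Suc n)"] by auto
    have "R n d q \<subseteq> U"
    proof
      fix y assume y: "y \<in> R n d q"
      define c where "c = 1 / real (Suc n)"
      have c: "c < e / 4" "dist d (fst z) < c" "snd z < q" "q < snd z + c"
        "dist d (fst y) < c" "dist q (snd y) < c"
        using n d(2) q y by (auto simp: c_def R_def)
      then have "dist (fst z) (fst y) < e / 2"
        using dist_triangle[of "fst z" "fst y" d] dist_commute[of "fst z" d] by linarith
      moreover have "dist (snd z) (snd y) < e / 2"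
        using c unfolding dist_real_def by linarith
      ultimately have "dist z y < e"
        unfolding dist_prod_def using sqrt_sum_squares_le_sum[of "dist (fst z) (fst y)" "dist (snd z) (snd y)"] by simp
      then show "y \<in> U" using e by auto
    qed
    moreover have "z \<in> R n d q" using d q by (cases z) (auto simp: R_def dist_real_def)
    ultimately show "z \<in> (\<Union>(n, d, q)\<in>J. R n d q)" using d q by (auto simp: J_def)
  qed (auto simp: J_def)
  also have "\<dots> \<in> sets (borel \<Otimes>\<^sub>M lborel)"
    using J by (intro sets.countable_UN') (auto simp: R_def)
  finally show ?thesis .
qed

text \<open>Over a completion, measurability itself is invariant under changes on null sets. So either both
  functions are measurable, or both integrals have the default value.\<close>

lemma integral_completion_cong_AE:
  fixes f g :: "'a \<Rightarrow> real"
  assumes AE: "AE x in completion M. f x = g x"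
  shows "integral\<^sup>L (completion M) f = integral\<^sup>L (completion M) g"
proof -
  have *: "k \<in> borel_measurable (completion M)"
    if h: "h \<in> borel_measurable (completion M)" and ae: "AE x in completion M. h x = k x" for h k :: "'a \<Rightarrow> real"
  proof (rule measurableI)
    fix A :: "real set" assume A: "A \<in> sets borel"
    show "k -` A \<inter> space (completion M) \<in> sets (completion M)"
    proof (rule completion.in_sets_AE)
      show "AE x in completion M. x \<in> h -` A \<inter> space (completion M) \<longleftrightarrow> x \<in> k -` A \<inter> space (completion M)"
        using ae by eventually_elim auto
      show "h -` A \<inter> space (completion M) \<in> sets (completion M)" using h A by (rule measurable_sets)
    qed auto
  qed simp
  show ?thesis
  proof (cases "f \<in> borel_measurable (completion M)")
    case True
    then show ?thesis using *[OF True AE] AE by (intro integral_cong_AE)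
  next
    case False
    have "AE x in completion M. g x = f x" using AE by eventually_elim simp
    then have "g \<notin> borel_measurable (completion M)" using False *[of g f] by blast
    then show ?thesis using False
      by (metis borel_measurable_integrable not_integrable_integral_eq)
  qed
qed

context metric_measure
begin

text \<open>As an upper integral, \<^const>\<open>grad_energy\<close> is additive on disjoint measurable sets because functions that
  dominate the gradient on each of them can be combined into one.\<close>

lemma grad_energy_Un_le:
  assumes A [measurable]: "A \<in> sets (parabolic_measure \<mu>)" and B [measurable]: "B \<in> sets (parabolic_measure \<mu>)"
    and disj: "A \<inter> B = {}"
  shows "grad_energy p \<mu> \<Omega> v (A \<union> B) \<le> grad_energy p \<mu> \<Omega> v A + grad_energy p \<mu> \<Omega> v B"
proof -
  let ?H = "\<lambda>U. {h \<in> borel_measurable (parabolic_measure \<mu>).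
          AE t in lborel. AE x in \<mu>. (x, t) \<in> U \<longrightarrow> slice_grad p \<mu> \<Omega> v (x, t) \<le> h (x, t)}"
  let ?I = "\<lambda>h U. \<integral>\<^sup>+z\<in>U. epowr (h z) p \<partial>parabolic_measure \<mu>"
  have "grad_energy p \<mu> \<Omega> v (A \<union> B) \<le> ?I h\<^sub>1 A + ?I h\<^sub>2 B" if h: "h\<^sub>1 \<in> ?H A" "h\<^sub>2 \<in> ?H B" for h\<^sub>1 h\<^sub>2
  proof -
    have [measurable]: "h\<^sub>1 \<in> borel_measurable (parabolic_measure \<mu>)" "h\<^sub>2 \<in> borel_measurable (parabolic_measure \<mu>)"
      using h by auto
    let ?h = "\<lambda>z. if z \<in> A then h\<^sub>1 z else h\<^sub>2 z"
    have "AE t in lborel. AE x in \<mu>. (x, t) \<in> A \<longrightarrow> slice_grad p \<mu> \<Omega> v (x, t) \<le> h\<^sub>1 (x, t)"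
      "AE t in lborel. AE x in \<mu>. (x, t) \<in> B \<longrightarrow> slice_grad p \<mu> \<Omega> v (x, t) \<le> h\<^sub>2 (x, t)"
      using h by auto
    then have "AE t in lborel. AE x in \<mu>. (x, t) \<in> A \<union> B \<longrightarrow> slice_grad p \<mu> \<Omega> v (x, t) \<le> ?h (x, t)"
    proof eventually_elim
      case (elim t)
      from elim show ?case by eventually_elim auto
    qed
    moreover have "?h \<in> borel_measurable (parabolic_measure \<mu>)" by measurable
    ultimately have "?h \<in> ?H (A \<union> B)" by simp
    then have "grad_energy p \<mu> \<Omega> v (A \<union> B) \<le> ?I ?h (A \<union> B)"
      unfolding grad_energy_def by (rule INF_lower)
    also have "?I ?h (A \<union> B) = (\<integral>\<^sup>+z. epowr (h\<^sub>1 z) p * indicator A z + epowr (h\<^sub>2 z) p * indicator B z \<partial>parabolic_measure \<mu>)"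
      using disj by (intro nn_integral_cong) (auto simp: indicator_def)
    also have "\<dots> = ?I h\<^sub>1 A + ?I h\<^sub>2 B" by (rule nn_integral_add) measurable
    finally show ?thesis .
  qed
  note glued = this
  show ?thesis
  proof (rule ennreal_le_epsilon)
    fix e :: real assume fin: "grad_energy p \<mu> \<Omega> v A + grad_energy p \<mu> \<Omega> v B < top" and e: "0 < e"
    have "\<exists>h\<in>?H S. ?I h S < grad_energy p \<mu> \<Omega> v S + ennreal (e / 2)" if "grad_energy p \<mu> \<Omega> v S < top" for S
    proof -
      have "grad_energy p \<mu> \<Omega> v S + 0 < grad_energy p \<mu> \<Omega> v S + ennreal (e / 2)"
        using that e by (subst ennreal_add_left_cancel_less) auto
      then have "(INF h\<in>?H S. ?I h S) < grad_energy p \<mu> \<Omega> v S + ennreal (e / 2)"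
        by (simp add: grad_energy_def)
      then show ?thesis by (simp only: INF_less_iff)
    qed
    note near = this
    have finite: "grad_energy p \<mu> \<Omega> v A < top" "grad_energy p \<mu> \<Omega> v B < top" using fin by simp_all
    obtain h\<^sub>1 where h\<^sub>1: "h\<^sub>1 \<in> ?H A" "?I h\<^sub>1 A < grad_energy p \<mu> \<Omega> v A + ennreal (e / 2)"
      using near[OF finite(1)] by (elim bexE)
    obtain h\<^sub>2 where h\<^sub>2: "h\<^sub>2 \<in> ?H B" "?I h\<^sub>2 B < grad_energy p \<mu> \<Omega> v B + ennreal (e / 2)"
      using near[OF finite(2)] by (elim bexE)
    have "grad_energy p \<mu> \<Omega> v (A \<union> B) \<le> ?I h\<^sub>1 A + ?I h\<^sub>2 B" by (rule glued[OF h\<^sub>1(1) h\<^sub>2(1)])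
    also have "\<dots> \<le> (grad_energy p \<mu> \<Omega> v A + ennreal (e / 2)) + (grad_energy p \<mu> \<Omega> v B + ennreal (e / 2))"
      by (intro add_mono less_imp_le h\<^sub>1(2) h\<^sub>2(2))
    also have "\<dots> = grad_energy p \<mu> \<Omega> v A + grad_energy p \<mu> \<Omega> v B + (ennreal (e / 2) + ennreal (e / 2))"
      by (simp add: ac_simps)
    also have "ennreal (e / 2) + ennreal (e / 2) = ennreal e" using e by (simp flip: ennreal_plus)
    finally show "grad_energy p \<mu> \<Omega> v (A \<union> B) \<le> grad_energy p \<mu> \<Omega> v A + grad_energy p \<mu> \<Omega> v B + ennreal e" .
  qed
qed

lemma grad_energy_Un_ge:
  assumes A [measurable]: "A \<in> sets (parabolic_measure \<mu>)" and B [measurable]: "B \<in> sets (parabolic_measure \<mu>)"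
    and disj: "A \<inter> B = {}"
  shows "grad_energy p \<mu> \<Omega> v A + grad_energy p \<mu> \<Omega> v B \<le> grad_energy p \<mu> \<Omega> v (A \<union> B)"
  unfolding grad_energy_def[of _ _ _ _ "A \<union> B"]
proof (rule INF_greatest)
  fix h assume "h \<in> {h \<in> borel_measurable (parabolic_measure \<mu>).
          AE t in lborel. AE x in \<mu>. (x, t) \<in> A \<union> B \<longrightarrow> slice_grad p \<mu> \<Omega> v (x, t) \<le> h (x, t)}"
  then have h [measurable]: "h \<in> borel_measurable (parabolic_measure \<mu>)"
    and dom: "AE t in lborel. AE x in \<mu>. (x, t) \<in> A \<union> B \<longrightarrow> slice_grad p \<mu> \<Omega> v (x, t) \<le> h (x, t)"
    by auto
  have sub: "grad_energy p \<mu> \<Omega> v S \<le> (\<integral>\<^sup>+z\<in>S. epowr (h z) p \<partial>parabolic_measure \<mu>)" if "S \<subseteq> A \<union> B" for S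
  proof -
    have "AE t in lborel. AE x in \<mu>. (x, t) \<in> S \<longrightarrow> slice_grad p \<mu> \<Omega> v (x, t) \<le> h (x, t)"
      using dom
    proof eventually_elim
      case (elim t)
      then show ?case by eventually_elim (use that in auto)
    qed
    with h show ?thesis unfolding grad_energy_def by (intro INF_lower) simp
  qed
  have "grad_energy p \<mu> \<Omega> v A + grad_energy p \<mu> \<Omega> v B
      \<le> (\<integral>\<^sup>+z\<in>A. epowr (h z) p \<partial>parabolic_measure \<mu>) + (\<integral>\<^sup>+z\<in>B. epowr (h z) p \<partial>parabolic_measure \<mu>)"
    by (intro add_mono sub) auto
  also have "\<dots> = (\<integral>\<^sup>+z. epowr (h z) p * indicator A z + epowr (h z) p * indicator B z \<partial>parabolic_measure \<mu>)"
    by (rule nn_integral_add[symmetric]) measurable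
  also have "\<dots> = (\<integral>\<^sup>+z\<in>A \<union> B. epowr (h z) p \<partial>parabolic_measure \<mu>)"
    using disj by (intro nn_integral_cong) (auto simp: indicator_def)
  finally show "grad_energy p \<mu> \<Omega> v A + grad_energy p \<mu> \<Omega> v B
      \<le> (\<integral>\<^sup>+z\<in>A \<union> B. epowr (h z) p \<partial>parabolic_measure \<mu>)" .
qed

end

lemma grad_energy_mono:
  assumes "AE t in lborel. AE x in \<mu>. (x, t) \<in> A \<longrightarrow> slice_grad p \<mu> \<Omega> v (x, t) \<le> slice_grad p \<mu> \<Omega> w (x, t)"
  shows "grad_energy p \<mu> \<Omega> v A \<le> grad_energy p \<mu> \<Omega> w A"
  unfolding grad_energy_def
proof (rule INF_superset_mono)
  show "{h \<in> borel_measurable (parabolic_measure \<mu>).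
          AE t in lborel. AE x in \<mu>. (x, t) \<in> A \<longrightarrow> slice_grad p \<mu> \<Omega> w (x, t) \<le> h (x, t)}
    \<subseteq> {h \<in> borel_measurable (parabolic_measure \<mu>).
          AE t in lborel. AE x in \<mu>. (x, t) \<in> A \<longrightarrow> slice_grad p \<mu> \<Omega> v (x, t) \<le> h (x, t)}"
  proof (intro Collect_mono impI, elim conjE, intro conjI)
    fix h assume "AE t in lborel. AE x in \<mu>. (x, t) \<in> A \<longrightarrow> slice_grad p \<mu> \<Omega> w (x, t) \<le> h (x, t)"
    with assms show "AE t in lborel. AE x in \<mu>. (x, t) \<in> A \<longrightarrow> slice_grad p \<mu> \<Omega> v (x, t) \<le> h (x, t)"
    proof eventually_elim
      case (elim t)
      from elim show ?case by eventually_elim (auto intro: order_trans)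
    qed
  qed auto
qed simp

section \<open>The time derivative on the zero set\<close>

text \<open>The hypothesis on increments consists of countably many conditions. This makes the set of points at
  which it holds measurable when a parameter is added.\<close>

lemma DERIV_zero_of_rational_increments:
  fixes f :: "real \<Rightarrow> real"
  assumes I: "open I" "t \<in> I" and cont: "continuous_on I f" and zero: "f t = 0" and nonneg: "\<And>s. s \<in> I \<Longrightarrow> 0 \<le> f s"
    and small: "\<And>n::nat. \<exists>m::nat. \<forall>r::rat. \<bar>real_of_rat r\<bar> < 1 / real (Suc m) \<and> t + real_of_rat r \<in> I \<longrightarrow>
      f (t + real_of_rat r) \<le> \<bar>real_of_rat r\<bar> / real (Suc n)"
  shows "DERIV f t :> 0"
  unfolding DERIV_def
proof (rule LIM_I)
  fix e :: real assume e: "0 < e"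
  obtain n where n: "1 / real (Suc n) < e" using nat_approx_posE[OF e] by auto
  obtain m where m: "\<And>r::rat. \<bar>real_of_rat r\<bar> < 1 / real (Suc m) \<Longrightarrow> t + real_of_rat r \<in> I \<Longrightarrow>
      f (t + real_of_rat r) \<le> \<bar>real_of_rat r\<bar> / real (Suc n)"
    using small[of n] by auto
  obtain d where d: "0 < d" "ball t d \<subseteq> I" using openE[OF I] .
  define b where "b = min d (1 / real (Suc m))"
  have b: "0 < b" using d(1) by (simp add: b_def)
  have in_I: "t + h \<in> I" if "\<bar>h\<bar> < b" for h
    using that d(2) by (auto simp: b_def dist_real_def subset_eq)
  have bound: "f (t + h) \<le> \<bar>h\<bar> / real (Suc n)" if h: "\<bar>h\<bar> < b" for h
  proof (rule ccontr)
    assume "\<not> f (t + h) \<le> \<bar>h\<bar> / real (Suc n)"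
    define F where "F h = f (t + h) - \<bar>h\<bar> / real (Suc n)" for h
    have "continuous_on {-b<..<b} F"
      unfolding F_def
      by (intro continuous_intros continuous_on_compose2[OF cont]) (auto intro!: in_I)
    then have "open ({-b<..<b} \<inter> F -` {0<..})"
      by (intro continuous_open_preimage) auto
    moreover have "h \<in> {-b<..<b} \<inter> F -` {0<..}"
      using h \<open>\<not> f (t + h) \<le> _\<close> by (auto simp: F_def)
    ultimately obtain k where k: "0 < k" "ball h k \<subseteq> {-b<..<b} \<inter> F -` {0<..}" by (rule openE)
    obtain q where q: "q \<in> \<rat>" "h < q" "q < h + k" using Rats_dense_in_real[of h "h + k"] k(1) by auto
    then obtain r where r: "q = real_of_rat r" by (auto elim: Rats_cases)
    have "q \<in> ball h k" using q by (simp add: dist_real_def)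
    with k(2) have "q \<in> {-b<..<b} \<inter> F -` {0<..}" by (rule subsetD)
    then have q_b: "\<bar>q\<bar> < b" and F: "0 < F q" by auto
    have "\<bar>real_of_rat r\<bar> < 1 / real (Suc m)" using q_b unfolding r b_def by linarith
    moreover have "t + real_of_rat r \<in> I" using in_I[OF q_b] unfolding r .
    ultimately have "f (t + q) \<le> \<bar>q\<bar> / real (Suc n)" unfolding r by (rule m)
    with F show False by (simp add: F_def)
  qed
  show "\<exists>s>0. \<forall>h::real. h \<noteq> 0 \<and> norm (h - 0) < s \<longrightarrow> norm ((f (t + h) - f t) / h - 0) < e"
  proof (intro exI[of _ b] conjI b allI impI)
    fix h :: real assume "h \<noteq> 0 \<and> norm (h - 0) < b"
    then have h: "h \<noteq> 0" "\<bar>h\<bar> < b" by auto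
    have "norm ((f (t + h) - f t) / h - 0) = f (t + h) / \<bar>h\<bar>"
      using nonneg[OF in_I[OF h(2)]] by (simp add: zero abs_divide)
    also have "\<dots> \<le> (\<bar>h\<bar> / real (Suc n)) / \<bar>h\<bar>"
      using bound[OF h(2)] by (intro divide_right_mono) auto
    also have "\<dots> = 1 / real (Suc n)" using h by simp
    finally show "norm ((f (t + h) - f t) / h - 0) < e" using n by linarith
  qed
qed

text \<open>By Fubini it is enough to consider a fixed \<open>x\<close>. If \<open>\<phi>(x, t) = 0\<close> and there are arbitrarily small \<open>h\<close> with
  \<open>\<phi>(x, t + h) > \<bar>h\<bar> / (n + 1)\<close>, then the Lipschitz bound keeps the zeros of \<open>\<phi>(x,\<cdot>)\<close> away from \<open>t + h\<close> by a
  fixed multiple of \<open>\<bar>h\<bar>\<close>, so \<open>t\<close> is a porous point of the set of zeros.\<close>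

lemma AE_time_deriv_zero:
  fixes \<mu> :: "'a::metric_space measure"
  assumes sets_\<mu> [measurable_cong, simp]: "sets \<mu> = sets borel" and sf: "sigma_finite_measure \<mu>"
    and \<Omega>: "open \<Omega>" and lip: "L-lipschitz_on (cylinder \<Omega> T) \<phi>"
    and nonneg: "\<And>z. z \<in> cylinder \<Omega> T \<Longrightarrow> 0 \<le> \<phi> z"
    and supp: "{z \<in> cylinder \<Omega> T. \<phi> z \<noteq> 0} \<Subset> cylinder \<Omega> T"
  shows "AE z in parabolic_measure \<mu>. z \<in> cylinder \<Omega> T \<and> \<phi> z = 0 \<longrightarrow> time_deriv \<phi> z = 0"
proof -
  interpret \<mu>: sigma_finite_measure \<mu> by (rule sf)
  interpret P: pair_sigma_finite \<mu> "lborel :: real measure" ..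
  let ?C = "cylinder \<Omega> T"
  define S where "S = {z \<in> ?C. \<phi> z \<noteq> 0}"
  \<comment> \<open>Outside the cylinder nothing is known about \<open>\<phi>\<close>; the extension by zero is jointly measurable.\<close>
  define \<phi>\<^sub>0 where "\<phi>\<^sub>0 z = \<phi> z * indicator S z" for z
  have [simp]: "space \<mu> = UNIV" using sets_eq_imp_space_eq[OF sets_\<mu>] by simp
  have space [simp]: "space (parabolic_measure \<mu>) = UNIV" by (simp add: space_pair_measure)
  have C_open: "open ?C" using \<Omega> by (intro open_Times) auto
  have C [measurable]: "?C \<in> sets (parabolic_measure \<mu>)"
    using \<Omega> by (intro pair_measureI) auto
  have prod: "sets (parabolic_measure \<mu>) = sets (borel \<Otimes>\<^sub>M lborel)"
    by (intro sets_pair_measure_cong) auto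
  have cont: "continuous_on ?C \<phi>" using lip by (rule lipschitz_on_continuous_on)
  have \<phi>\<^sub>0_eq: "\<phi>\<^sub>0 z = \<phi> z" if "z \<in> ?C" for z
    using that by (cases "\<phi> z = 0") (auto simp: \<phi>\<^sub>0_def S_def)
  have super: "{z. a < \<phi>\<^sub>0 z} \<in> sets (parabolic_measure \<mu>)" if a: "0 \<le> a" for a
  proof -
    have eq: "{z. a < \<phi>\<^sub>0 z} = ?C \<inter> \<phi> -` {a<..}"
      using a by (auto simp: \<phi>\<^sub>0_def S_def indicator_def split: if_splits)
    have "{z. a < \<phi>\<^sub>0 z} \<subseteq> S" using a by (auto simp: \<phi>\<^sub>0_def indicator_def split: if_splits)
    then have "closure {z. a < \<phi>\<^sub>0 z} \<subseteq> closure S" by (rule closure_mono)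
    moreover have "compact (closure S)" using supp by (simp add: compactly_contained_def S_def)
    ultimately have "compact (closure {z. a < \<phi>\<^sub>0 z})"
      using compact_Int_closed[of "closure S" "closure {z. a < \<phi>\<^sub>0 z}"] by (simp add: Int_absorb1)
    moreover have "open {z. a < \<phi>\<^sub>0 z}"
      unfolding eq using cont C_open by (intro continuous_open_preimage) auto
    ultimately show ?thesis unfolding prod by (intro open_compactly_contained_borel_product)
  qed
  have \<phi>\<^sub>0_nonneg: "0 \<le> \<phi>\<^sub>0 z" for z using nonneg by (auto simp: \<phi>\<^sub>0_def S_def indicator_def)
  have \<phi>\<^sub>0 [measurable]: "\<phi>\<^sub>0 \<in> borel_measurable (parabolic_measure \<mu>)"
    unfolding borel_measurable_iff_greater
  proof
    fix a
    show "{z \<in> space (parabolic_measure \<mu>). a < \<phi>\<^sub>0 z} \<in> sets (parabolic_measure \<mu>)"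
    proof (cases "0 \<le> a")
      case False
      then have "{z \<in> space (parabolic_measure \<mu>). a < \<phi>\<^sub>0 z} = space (parabolic_measure \<mu>)"
        by (auto simp: not_le intro!: less_le_trans[OF _ \<phi>\<^sub>0_nonneg])
      then show ?thesis by (simp only: sets.top)
    next
      case True
      have "{z \<in> space (parabolic_measure \<mu>). a < \<phi>\<^sub>0 z} = {z. a < \<phi>\<^sub>0 z}" by simp
      then show ?thesis using super[OF True] by (simp only:)
    qed
  qed
  define good where "good z \<longleftrightarrow> (z \<in> ?C \<and> \<phi>\<^sub>0 z = 0 \<longrightarrow> (\<forall>n::nat. \<exists>m::nat. \<forall>r::rat.
      \<bar>real_of_rat r\<bar> < 1 / real (Suc m) \<longrightarrow>
      \<phi>\<^sub>0 (fst z, snd z + real_of_rat r) \<le> \<bar>real_of_rat r\<bar> / real (Suc n)))" for z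
  have "AE z in parabolic_measure \<mu>. good z"
  proof (rule P.AE_pair_measure)
    have shift [measurable]: "(\<lambda>z. \<phi>\<^sub>0 (fst z, snd z + c)) \<in> borel_measurable (parabolic_measure \<mu>)" for c
      by (rule measurable_compose[OF _ \<phi>\<^sub>0]) measurable
    show "{z \<in> space (parabolic_measure \<mu>). good z} \<in> sets (parabolic_measure \<mu>)"
      unfolding good_def by measurable
    show "AE x in \<mu>. AE t in lborel. good (x, t)"
    proof (rule AE_I2)
      fix x
      define Z where "Z = {t \<in> {0<..<T}. \<phi> (x, t) = 0}"
      show "AE t in lborel. good (x, t)"
      proof (cases "x \<in> \<Omega>")
        case x: True
        \<comment> \<open>A Lipschitz constant of at least 1 keeps the porosity constant at most 1.\<close>
        define M where "M = max L 1"
        have M: "L \<le> M" "1 \<le> M" by (auto simp: M_def)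
        have "continuous_on {0<..<T} (\<lambda>t. \<phi> (x, t))"
          using x by (intro continuous_on_compose2[OF cont] continuous_intros) auto
        then have "closedin (top_of_set {0<..<T}) ({0<..<T} \<inter> (\<lambda>t. \<phi> (x, t)) -` {0})"
          by (intro continuous_closedin_preimage) auto
        moreover have "{0<..<T} \<inter> (\<lambda>t. \<phi> (x, t)) -` {0} = Z" by (auto simp: Z_def)
        ultimately have "closedin (top_of_set {0<..<T}) Z" by simp
        then obtain Q where "closed Q" "Z = {0<..<T} \<inter> Q" unfolding closedin_closed by auto
        then have "Z \<in> sets borel" by auto
        then have Z: "Z \<in> sets lebesgue" by simp
        define porous where "porous n = {t \<in> Z. \<forall>d>0. \<exists>r. r \<noteq> 0 \<and> \<bar>r\<bar> < d \<and>
            ball (t + r) (1 / (M * real (Suc n)) * \<bar>r\<bar>) \<inter> Z = {}}" for n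
        have "negligible (porous n)" for n
        proof -
          have "1 * 1 \<le> M * real (Suc n)" using M by (intro mult_mono) auto
          then show ?thesis
            unfolding porous_def by (intro negligible_porous_points[OF Z]) (auto simp: field_simps)
        qed
        then have "AE t in lborel. \<forall>n. t \<notin> porous n"
          unfolding AE_all_countable by (intro allI AE_lborel_not_in_negligible)
        then show ?thesis
        proof eventually_elim
          case (elim t)
          show "good (x, t)"
            unfolding good_def
          proof (intro impI allI)
            fix n assume "(x, t) \<in> ?C \<and> \<phi>\<^sub>0 (x, t) = 0"
            then have t: "(x, t) \<in> ?C" "\<phi> (x, t) = 0" using \<phi>\<^sub>0_eq by auto
            then have "t \<in> Z" by (auto simp: Z_def)
            with elim[rule_format, of n] obtain d where d: "0 < d"
              "\<And>r. r \<noteq> 0 \<Longrightarrow> \<bar>r\<bar> < d \<Longrightarrow> ball (t + r) (1 / (M * real (Suc n)) * \<bar>r\<bar>) \<inter> Z \<noteq> {}"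
              unfolding porous_def by blast
            obtain m where m: "1 / real (Suc m) < d" using nat_approx_posE[OF d(1)] by auto
            show "\<exists>m::nat. \<forall>r::rat. \<bar>real_of_rat r\<bar> < 1 / real (Suc m) \<longrightarrow>
              \<phi>\<^sub>0 (fst (x, t), snd (x, t) + real_of_rat r) \<le> \<bar>real_of_rat r\<bar> / real (Suc n)"
            proof (intro exI[of _ m] allI impI)
              fix r :: rat assume r: "\<bar>real_of_rat r\<bar> < 1 / real (Suc m)"
              define h where "h = real_of_rat r"
              show "\<phi>\<^sub>0 (fst (x, t), snd (x, t) + real_of_rat r) \<le> \<bar>real_of_rat r\<bar> / real (Suc n)"
              proof (cases "h \<noteq> 0 \<and> (x, t + h) \<in> ?C")
                case False
                then have "\<phi>\<^sub>0 (x, t + h) = 0" using t by (auto simp: \<phi>\<^sub>0_def S_def)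
                then show ?thesis by (simp add: h_def)
              next
                case True
                have "ball (t + h) (1 / (M * real (Suc n)) * \<bar>h\<bar>) \<inter> Z \<noteq> {}"
                  using True r m by (intro d(2)) (auto simp: h_def)
                then obtain s where s: "s \<in> Z" "dist (t + h) s < 1 / (M * real (Suc n)) * \<bar>h\<bar>" by auto
                have sC: "(x, s) \<in> ?C" "\<phi> (x, s) = 0" using s x by (auto simp: Z_def)
                have "\<phi>\<^sub>0 (x, t + h) = \<phi> (x, t + h)" using True \<phi>\<^sub>0_eq by auto
                also have "\<dots> \<le> dist (\<phi> (x, t + h)) (\<phi> (x, s))" using sC by (simp add: dist_real_def)
                also have "\<dots> \<le> L * dist (x, t + h) (x, s)"
                  using True sC by (intro lipschitz_onD[OF lip]) auto
                also have "\<dots> = L * dist (t + h) s" by (simp add: dist_Pair_Pair)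
                also have "\<dots> \<le> M * dist (t + h) s" using M by (intro mult_right_mono) auto
                also have "\<dots> \<le> M * (1 / (M * real (Suc n)) * \<bar>h\<bar>)"
                  using M s(2) by (intro mult_left_mono) auto
                also have "\<dots> = \<bar>h\<bar> / real (Suc n)" using M by simp
                finally show ?thesis by (simp add: h_def)
              qed
            qed
          qed
        qed
      qed (simp add: good_def)
    qed
  qed
  then show ?thesis
  proof eventually_elim
    case (elim z)
    show ?case
    proof
      assume z: "z \<in> ?C \<and> \<phi> z = 0"
      obtain x t where xt: "z = (x, t)" by (cases z)
      have "DERIV (\<lambda>t. \<phi> (x, t)) t :> 0"
      proof (rule DERIV_zero_of_rational_increments[where I = "{0<..<T}"])
        show "continuous_on {0<..<T} (\<lambda>t. \<phi> (x, t))"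
          using z xt by (intro continuous_on_compose2[OF cont] continuous_intros) auto
        have "\<phi>\<^sub>0 z = 0" using z \<phi>\<^sub>0_eq by auto
        fix n :: nat
        obtain m where m: "\<And>r::rat. \<bar>real_of_rat r\<bar> < 1 / real (Suc m) \<Longrightarrow>
            \<phi>\<^sub>0 (x, t + real_of_rat r) \<le> \<bar>real_of_rat r\<bar> / real (Suc n)"
          using elim z \<open>\<phi>\<^sub>0 z = 0\<close> unfolding good_def xt by auto
        show "\<exists>m::nat. \<forall>r::rat. \<bar>real_of_rat r\<bar> < 1 / real (Suc m) \<and> t + real_of_rat r \<in> {0<..<T} \<longrightarrow>
            \<phi> (x, t + real_of_rat r) \<le> \<bar>real_of_rat r\<bar> / real (Suc n)"
        proof (intro exI[of _ m] allI impI, elim conjE)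
          fix r :: rat assume r: "\<bar>real_of_rat r\<bar> < 1 / real (Suc m)" "t + real_of_rat r \<in> {0<..<T}"
          then have "(x, t + real_of_rat r) \<in> ?C" using z xt by auto
          with m[OF r(1)] show "\<phi> (x, t + real_of_rat r) \<le> \<bar>real_of_rat r\<bar> / real (Suc n)"
            by (simp add: \<phi>\<^sub>0_eq)
        qed
      qed (use z xt nonneg in auto)
      then show "time_deriv \<phi> z = 0" by (simp add: time_deriv_def xt DERIV_imp_deriv)
    qed
  qed
qed

section \<open>Enlarging the domain of integration\<close>

lemma doubling_sigma_finite:
  fixes \<mu> :: "'a::metric_space measure"
  assumes "doubling_measure \<mu>"
  shows "sigma_finite_measure \<mu>"
proof
  have sets: "sets \<mu> = sets borel" and fin: "\<And>x r. 0 < r \<Longrightarrow> emeasure \<mu> (ball x r) < \<infinity>"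
    using assms by (auto simp: doubling_measure_def)
  have space: "space \<mu> = UNIV" using sets_eq_imp_space_eq[OF sets] by simp
  define B where "B n = ball (undefined :: 'a) (real (Suc n))" for n :: nat
  have "\<Union>(range B) = space \<mu>"
  proof -
    have "\<exists>n. x \<in> B n" for x
    proof -
      obtain n :: nat where "dist undefined x < real n" using reals_Archimedean2 by blast
      then show ?thesis by (intro exI[of _ n]) (simp add: B_def)
    qed
    then show ?thesis by (auto simp: space)
  qed
  moreover have "emeasure \<mu> (B n) \<noteq> \<infinity>" for n
    using fin[of "real (Suc n)" undefined] unfolding B_def by (simp add: less_top)
  ultimately show "\<exists>A. countable A \<and> A \<subseteq> sets \<mu> \<and> \<Union> A = space \<mu> \<and> (\<forall>a\<in>A. emeasure \<mu> a \<noteq> \<infinity>)"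
    by (intro exI[of _ "range B"]) (auto simp: sets B_def)
qed

context metric_measure
begin

lemma upper_gradient_imp_weak:
  assumes "upper_gradient \<Omega> u g"
  shows "weak_upper_gradient p \<mu> \<Omega> u g"
proof -
  have "(\<lambda>_. 0) \<in> Lp_densities p \<mu>" by (simp add: Lp_densities_def)
  then show ?thesis using assms unfolding weak_upper_gradient_iff upper_gradient_def by blast
qed

text \<open>The exceptional times depend on the time interval and on the subset of \<open>\<Omega>\<close>. Countably many of both
  suffice, so there is a common null set.\<close>

lemma AE_slices_ex_weak_upper_gradient:
  assumes u: "u \<in> Lp_newtonian_loc p \<mu> \<Omega> T" and T: "0 < T"
    and D: "\<And>n::nat. open (D n) \<and> D n \<Subset> \<Omega>"
  shows "AE t in lborel. t \<in> {0<..<T} \<longrightarrow> (\<forall>n. \<exists>g. weak_upper_gradient p \<mu> (D n) (\<lambda>x. u (x, t)) g \<and>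
      Lp_integral (D n) g < \<infinity>)"
proof -
  \<comment> \<open>With \<open>k + 3\<close> the interval from \<open>t\<^sub>1 k\<close> to \<open>T - t\<^sub>1 k\<close> is nonempty already for \<open>k = 0\<close>.\<close>
  define t\<^sub>1 where "t\<^sub>1 k = T / real (k + 3)" for k :: nat
  have t\<^sub>1: "0 < t\<^sub>1 k" "t\<^sub>1 k < T - t\<^sub>1 k" "T - t\<^sub>1 k < T" for k
  proof -
    have "t\<^sub>1 k \<le> T / 3" unfolding t\<^sub>1_def using T by (intro divide_left_mono) auto
    moreover show "0 < t\<^sub>1 k" using T by (simp add: t\<^sub>1_def)
    ultimately show "t\<^sub>1 k < T - t\<^sub>1 k" "T - t\<^sub>1 k < T" using T by linarith+
  qed
  have "AE t in lborel. t \<in> {t\<^sub>1 k<..<T - t\<^sub>1 k} \<longrightarrow> (\<lambda>x. u (x, t)) \<in> newtonian p \<mu> (D n)" for k n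
  proof -
    have "u \<in> Lp_newtonian p \<mu> (t\<^sub>1 k) (T - t\<^sub>1 k) (D n)"
      using u t\<^sub>1[of k] D[of n] unfolding Lp_newtonian_loc_def by blast
    then show ?thesis by (simp add: Lp_newtonian_def)
  qed
  then have "AE t in lborel. \<forall>k n. t \<in> {t\<^sub>1 k<..<T - t\<^sub>1 k} \<longrightarrow> (\<lambda>x. u (x, t)) \<in> newtonian p \<mu> (D n)"
    unfolding AE_all_countable by (intro allI)
  then show ?thesis
  proof eventually_elim
    case (elim t)
    show ?case
    proof (intro impI allI)
      fix n assume t: "t \<in> {0<..<T}"
      define e where "e = min t (T - t) / T"
      have e: "0 < e" using t T by (simp add: e_def)
      obtain k where k: "1 / real (Suc k) < e" using nat_approx_posE[OF e] by auto
      have "1 / real (k + 3) \<le> 1 / real (Suc k)" by (intro divide_left_mono) auto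
      then have "1 / real (k + 3) < e" using k by simp
      then have "T * (1 / real (k + 3)) < T * e" using T by (intro mult_strict_left_mono)
      then have "t\<^sub>1 k < min t (T - t)" using T by (simp add: t\<^sub>1_def e_def)
      then have "(\<lambda>x. u (x, t)) \<in> newtonian p \<mu> (D n)" using elim[rule_format, of k n] by simp
      then have "newton_norm p \<mu> (D n) (\<lambda>x. u (x, t)) < \<infinity>" by (simp add: newtonian_def)
      then obtain g where "upper_gradient (D n) (\<lambda>x. u (x, t)) g" "Lp_norm p \<mu> (D n) g < \<infinity>"
        unfolding newton_norm_def by (auto split: if_splits)
      then show "\<exists>g. weak_upper_gradient p \<mu> (D n) (\<lambda>x. u (x, t)) g \<and>
          Lp_integral (D n) g < \<infinity>"
        using upper_gradient_imp_weak Lp_norm_less_top_iff[OF p_pos] by blast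
    qed
  qed
qed

lemma AE_slice_grad_le_on_zero_set:
  assumes doubling: "doubling_measure \<mu>" and compact: "\<And>n. inner_exhaustion \<Omega> n \<Subset> \<Omega>"
    and \<Omega>: "open \<Omega>" "bounded \<Omega>" and T: "0 < T"
    and u: "u \<in> Lp_newtonian_loc p \<mu> \<Omega> T" and lip: "L-lipschitz_on (cylinder \<Omega> T) \<phi>"
  shows "AE t in lborel. AE x in \<mu>. (x, t) \<in> cylinder \<Omega> T \<and> \<phi> (x, t) = 0 \<longrightarrow>
    slice_grad p \<mu> \<Omega> u (x, t) \<le> slice_grad p \<mu> \<Omega> (\<lambda>z. u z + ereal (\<phi> z)) (x, t)"
proof -
  have finite: "emeasure \<mu> (inner_exhaustion \<Omega> n) < \<infinity>" for n
  proof -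
    obtain x r where "\<Omega> \<subseteq> cball x r" using \<Omega>(2) bounded_subset_cball by blast
    then have "inner_exhaustion \<Omega> n \<subseteq> ball x (max r 0 + 1)"
      using inner_exhaustion_subset[of \<Omega> n] by fastforce
    then have "emeasure \<mu> (inner_exhaustion \<Omega> n) \<le> emeasure \<mu> (ball x (max r 0 + 1))"
      by (intro emeasure_mono) auto
    also have "\<dots> < \<infinity>" using doubling unfolding doubling_measure_def by (auto simp: add_nonneg_pos)
    finally show ?thesis .
  qed
  have "AE t in lborel. t \<in> {0<..<T} \<longrightarrow> (\<forall>n. \<exists>g.
      weak_upper_gradient p \<mu> (inner_exhaustion \<Omega> n) (\<lambda>x. u (x, t)) g \<and>
      Lp_integral (inner_exhaustion \<Omega> n) g < \<infinity>)"
    by (rule AE_slices_ex_weak_upper_gradient[OF u T]) (simp add: open_inner_exhaustion compact)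
  then show ?thesis
  proof eventually_elim
    case (elim t)
    show ?case
    proof (cases "t \<in> {0<..<T}")
      case True
      have "L-lipschitz_on \<Omega> (\<lambda>x. \<phi> (x, t))"
      proof (rule lipschitz_onI)
        fix x y assume "x \<in> \<Omega>" "y \<in> \<Omega>"
        then have "dist (\<phi> (x, t)) (\<phi> (y, t)) \<le> L * dist (x, t) (y, t)"
          using True by (intro lipschitz_onD[OF lip]) auto
        then show "dist (\<phi> (x, t)) (\<phi> (y, t)) \<le> L * dist x y" by (simp add: dist_Pair_Pair)
      qed (rule lipschitz_on_nonneg[OF lip])
      from min_grad_loc_le_on_zero_set[OF \<Omega>(1) compact finite elim[rule_format, OF True] this]
      show ?thesis by eventually_elim (auto simp: slice_grad_def)
    qed (intro AE_I2, auto)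
  qed
qed

end

text \<open>On the part of \<open>U\<close> where \<open>\<phi>\<close> vanishes, the time derivative is zero and the energy of \<open>u\<close> is at most
  that of \<open>u + \<phi>\<close>, which occurs on the right-hand side with the factor \<open>K \<ge> 1\<close>.\<close>

lemma quasimin_inequality_enlarge_set:
  fixes \<mu> :: "'a::complete_space measure" and u :: "'a \<times> real \<Rightarrow> ereal"
  assumes p: "0 < p" and doubling: "doubling_measure \<mu>"
    and \<Omega>: "open \<Omega>" "bounded \<Omega>" and T: "0 < T" and K: "1 \<le> K"
    and u: "u \<in> Lp_newtonian_loc p \<mu> \<Omega> T"
    and U: "open U" "U \<Subset> cylinder \<Omega> T"
    and \<phi>: "L-lipschitz_on (cylinder \<Omega> T) \<phi>" "\<And>z. z \<in> cylinder \<Omega> T \<Longrightarrow> 0 \<le> \<phi> z"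
    and sub: "{z \<in> cylinder \<Omega> T. \<phi> z \<noteq> 0} \<subseteq> U"
    and quasimin: "quasimin_inequality p \<mu> \<Omega> \<alpha> K u \<phi> {z \<in> cylinder \<Omega> T. \<phi> z \<noteq> 0}"
  shows "quasimin_inequality p \<mu> \<Omega> \<alpha> K u \<phi> U"
proof -
  let ?C = "cylinder \<Omega> T" and ?w = "\<lambda>z. u z + ereal (\<phi> z)"
  define S where "S = {z \<in> ?C. \<phi> z \<noteq> 0}"
  have sets_\<mu> [simp]: "sets \<mu> = sets borel" using doubling by (simp add: doubling_measure_def)
  interpret metric_measure \<mu> p by unfold_locales (use p in auto)
  have UC: "U \<subseteq> ?C" using U(2) closure_subset unfolding compactly_contained_def by blast
  have SU: "S \<subseteq> U" using sub by (simp add: S_def)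
  have "closure S \<subseteq> closure U" using SU by (rule closure_mono)
  then have S_comp: "S \<Subset> ?C" "compact (closure S)"
    using U(2) compact_Int_closed[of "closure U" "closure S"]
    by (auto simp: compactly_contained_def Int_absorb1)
  have "S = ?C \<inter> \<phi> -` (- {0})" by (auto simp: S_def)
  moreover have "open ?C" using \<Omega>(1) by (intro open_Times) auto
  ultimately have S_open: "open S"
    using lipschitz_on_continuous_on[OF \<phi>(1)] by (auto intro!: continuous_open_preimage)
  have prod: "sets (parabolic_measure \<mu>) = sets (borel \<Otimes>\<^sub>M lborel)"
    by (intro sets_pair_measure_cong) auto
  have S_sets: "S \<in> sets (parabolic_measure \<mu>)"
    unfolding prod by (rule open_compactly_contained_borel_product[OF S_open S_comp(2)])
  have U_sets: "U \<in> sets (parabolic_measure \<mu>)"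
    unfolding prod using U by (intro open_compactly_contained_borel_product) (auto simp: compactly_contained_def)
  let ?E = "grad_energy p \<mu> \<Omega>"
  have split: "U = S \<union> (U - S)" using SU by auto
  have le: "?E u U \<le> ?E u S + ?E u (U - S)"
    using grad_energy_Un_le[of S "U - S" \<Omega> u] S_sets U_sets split by simp
  have ge: "?E ?w S + ?E ?w (U - S) \<le> ?E ?w U"
    using grad_energy_Un_ge[of S "U - S" \<Omega> ?w] S_sets U_sets split by simp
  have mid: "?E u (U - S) \<le> ?E ?w (U - S)"
  proof (rule grad_energy_mono)
    have "AE t in lborel. AE x in \<mu>. (x, t) \<in> ?C \<and> \<phi> (x, t) = 0 \<longrightarrow>
        slice_grad p \<mu> \<Omega> u (x, t) \<le> slice_grad p \<mu> \<Omega> ?w (x, t)"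
      by (rule AE_slice_grad_le_on_zero_set[OF doubling
            inner_exhaustion_compactly_contained[OF doubling \<Omega>(2)] \<Omega> T u \<phi>(1)])
    then show "AE t in lborel. AE x in \<mu>. (x, t) \<in> U - S \<longrightarrow>
        slice_grad p \<mu> \<Omega> u (x, t) \<le> slice_grad p \<mu> \<Omega> ?w (x, t)"
    proof eventually_elim
      case (elim t)
      then show ?case
      proof eventually_elim
        case (elim x)
        then show ?case using UC by (auto simp: S_def)
      qed
    qed
  qed
  have "AE z in parabolic_measure \<mu>. z \<in> ?C \<and> \<phi> z = 0 \<longrightarrow> time_deriv \<phi> z = 0"
    using S_comp(1) unfolding S_def
    by (intro AE_time_deriv_zero[OF sets_\<mu> doubling_sigma_finite[OF doubling] \<Omega>(1) \<phi>])
  then have "AE z in completion (parabolic_measure \<mu>). z \<in> ?C \<and> \<phi> z = 0 \<longrightarrow> time_deriv \<phi> z = 0"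
    by (rule AE_completion)
  then have AE: "AE z in completion (parabolic_measure \<mu>).
      indicator U z *\<^sub>R (real_of_ereal (u z) * time_deriv \<phi> z)
      = indicator S z *\<^sub>R (real_of_ereal (u z) * time_deriv \<phi> z)"
  proof eventually_elim
    case (elim z)
    then show ?case using UC SU by (auto simp: indicator_def S_def)
  qed
  have int: "(LINT z:U|completion (parabolic_measure \<mu>). real_of_ereal (u z) * time_deriv \<phi> z)
      = (LINT z:S|completion (parabolic_measure \<mu>). real_of_ereal (u z) * time_deriv \<phi> z)"
    unfolding set_lebesgue_integral_def by (rule integral_completion_cong_AE[OF AE])
  define J where "J = ereal (\<alpha> * (LINT z:S|completion (parabolic_measure \<mu>). real_of_ereal (u z) * time_deriv \<phi> z))"
  have hyp: "J + enn2ereal (?E u S) \<le> ereal K * enn2ereal (?E ?w S)"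
    using quasimin by (simp add: quasimin_inequality_def J_def S_def)
  have "J + enn2ereal (?E u U) \<le> J + (enn2ereal (?E u S) + enn2ereal (?E u (U - S)))"
    using le by (intro add_left_mono) (simp add: less_eq_ennreal.rep_eq plus_ennreal.rep_eq)
  also have "\<dots> = (J + enn2ereal (?E u S)) + enn2ereal (?E u (U - S))"
    by (simp add: add.assoc)
  also have "\<dots> \<le> ereal K * enn2ereal (?E ?w S) + enn2ereal (?E ?w (U - S))"
    using mid by (intro add_mono hyp) (simp add: less_eq_ennreal.rep_eq)
  also have "\<dots> \<le> ereal K * enn2ereal (?E ?w S) + ereal K * enn2ereal (?E ?w (U - S))"
  proof (rule add_left_mono)
    have "1 * enn2ereal (?E ?w (U - S)) \<le> ereal K * enn2ereal (?E ?w (U - S))"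
      using K by (intro ereal_mult_right_mono) auto
    then show "enn2ereal (?E ?w (U - S)) \<le> ereal K * enn2ereal (?E ?w (U - S))" by simp
  qed
  also have "\<dots> = ereal K * (enn2ereal (?E ?w S) + enn2ereal (?E ?w (U - S)))"
    by (rule ereal_pos_distrib[symmetric, OF _ ]) (use K in auto)
  also have "\<dots> \<le> ereal K * enn2ereal (?E ?w U)"
    using ge K by (intro ereal_mult_left_mono) (auto simp: less_eq_ennreal.rep_eq plus_ennreal.rep_eq)
  finally show ?thesis by (simp add: quasimin_inequality_def int J_def)
qed

theorem lemma3p4:
  fixes \<mu> :: "'a::complete_space measure" and \<Omega> :: "'a set"
    and p T \<alpha> K :: real and u :: "'a \<times> real \<Rightarrow> ereal"
  assumes "1 < p"
    and "doubling_measure \<mu>"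
    and "supports_poincare p \<mu>"
    and "open \<Omega>" and "bounded \<Omega>"
    and "0 < T" and "0 < \<alpha>" and "1 \<le> K"
    and "u \<in> Lp_newtonian_loc p \<mu> \<Omega> T \<inter> L2_loc \<mu> \<Omega> T"
  shows "quasisuperminimizer p \<mu> \<Omega> T \<alpha> K u \<longleftrightarrow>
    (\<forall>\<phi> \<in> Lip (cylinder \<Omega> T).
       (\<forall>z \<in> cylinder \<Omega> T. 0 \<le> \<phi> z) \<and> {z \<in> cylinder \<Omega> T. \<phi> z \<noteq> 0} \<Subset> cylinder \<Omega> T \<longrightarrow>
       quasimin_inequality p \<mu> \<Omega> \<alpha> K u \<phi> {z \<in> cylinder \<Omega> T. \<phi> z \<noteq> 0})"
    (is "_ \<longleftrightarrow> ?R")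
proof
  assume q: "quasisuperminimizer p \<mu> \<Omega> T \<alpha> K u"
  show ?R
  proof (intro ballI impI, elim conjE)
    fix \<phi> assume \<phi>: "\<phi> \<in> Lip (cylinder \<Omega> T)" "\<forall>z \<in> cylinder \<Omega> T. 0 \<le> \<phi> z"
      "{z \<in> cylinder \<Omega> T. \<phi> z \<noteq> 0} \<Subset> cylinder \<Omega> T"
    have "{z \<in> cylinder \<Omega> T. \<phi> z \<noteq> 0} = cylinder \<Omega> T \<inter> \<phi> -` (- {0})" by auto
    moreover have "open (cylinder \<Omega> T)" using assms(4) by (intro open_Times) auto
    moreover have "continuous_on (cylinder \<Omega> T) \<phi>"
      using \<phi>(1) by (auto simp: Lip_def intro: lipschitz_on_continuous_on)
    ultimately have "open {z \<in> cylinder \<Omega> T. \<phi> z \<noteq> 0}"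
      by (auto intro!: continuous_open_preimage)
    moreover have "{z \<in> cylinder \<Omega> T. 0 < \<phi> z} \<subseteq> {z \<in> cylinder \<Omega> T. \<phi> z \<noteq> 0}" by auto
    ultimately show "quasimin_inequality p \<mu> \<Omega> \<alpha> K u \<phi> {z \<in> cylinder \<Omega> T. \<phi> z \<noteq> 0}"
      using q \<phi> unfolding quasisuperminimizer_def by blast
  qed
next
  assume R: ?R
  show "quasisuperminimizer p \<mu> \<Omega> T \<alpha> K u"
    unfolding quasisuperminimizer_def
  proof (intro conjI assms(9) allI impI, elim conjE)
    fix U \<phi> assume U: "open U" "U \<Subset> cylinder \<Omega> T" and \<phi>: "\<phi> \<in> Lip (cylinder \<Omega> T)"
      "\<forall>z \<in> cylinder \<Omega> T. 0 \<le> \<phi> z" and sub: "{z \<in> cylinder \<Omega> T. 0 < \<phi> z} \<subseteq> U"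
    have S_sub: "{z \<in> cylinder \<Omega> T. \<phi> z \<noteq> 0} \<subseteq> U" using sub \<phi>(2) by (fastforce simp: less_le)
    have "closure {z \<in> cylinder \<Omega> T. \<phi> z \<noteq> 0} \<subseteq> closure U" using S_sub by (rule closure_mono)
    then have "{z \<in> cylinder \<Omega> T. \<phi> z \<noteq> 0} \<Subset> cylinder \<Omega> T"
      using U(2) compact_Int_closed[of "closure U" "closure {z \<in> cylinder \<Omega> T. \<phi> z \<noteq> 0}"]
      by (auto simp: compactly_contained_def Int_absorb1)
    then have quasimin: "quasimin_inequality p \<mu> \<Omega> \<alpha> K u \<phi> {z \<in> cylinder \<Omega> T. \<phi> z \<noteq> 0}"
      using R \<phi> by blast
    obtain L where lip: "L-lipschitz_on (cylinder \<Omega> T) \<phi>" using \<phi>(1) by (auto simp: Lip_def)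
    have "0 < p" using assms(1) by simp
    moreover have "u \<in> Lp_newtonian_loc p \<mu> \<Omega> T" using assms(9) by (rule IntD1)
    ultimately show "quasimin_inequality p \<mu> \<Omega> \<alpha> K u \<phi> U"
      by (rule quasimin_inequality_enlarge_set[OF _ assms(2,4,5,6,8) _ U lip bspec[OF \<phi>(2)] S_sub quasimin])
  qed
qed

end
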